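(* There exists an algebraic extension $K/\mathbb{Q}$ (with $K\subseteq\overline{\mathbb{Q}}$) such that $K$ has the Northcott property but the Galois closure of $K/\mathbb{Q}$ (inside $\overline{\mathbb{Q}}$) does not have the Bogomolov property.
   Context: $\overline{\mathbb{Q}}$ is a fixed algebraic closure of $\mathbb{Q}$, and $h:\overline{\mathbb{Q}}\rightarrow\mathbb{R}$ denotes the absolute logarithmic Weil height: for $\alpha$ in a number field $F$, $h(\alpha)=\frac{1}{[F:\mathbb{Q}]}\sum_{v}[F_v:\mathbb{Q}_v]\log\max\{1,|\alpha|_v\}$, where $v$ runs over all places of $F$ and $|\cdot|_v$ is normalized to extend the standard absolute value on $\mathbb{Q}$ (real or $p$-adic); this is independent of the choice of $F$. For a field $K\subseteq\overline{\mathbb{Q}}$ (possibly of infinite degree over $\mathbb{Q}$) and $T>0$ let $K_T:=\{\alpha\in K^\times : h(\alpha)<T\}$. The field $K$ has the Northcott property (N) if $K_T$ is finite for every $T>0$. The field $K$ has the Bogomolov property (B) if there exists $T>0$ such that $K_T$ consists only of the roots of unity in $K$. *)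

theory Defs
  imports
    "HOL-Analysis.Infinite_Sum"
    "HOL-Algebra.Generated_Fields"
    "HOL-Algebra.Algebraic_Closure_Type"
begin

text \<open>The fixed algebraic closure of the rationals is the field of algebraic complex numbers;
  all fields are subsets of \<open>complex\<close>.\<close>

abbreviation CC :: "complex ring" where
  "CC \<equiv> ring_of_type_algebra"

definition Qbar :: "complex set" where
  "Qbar = {z. Polynomial.algebraic z}"

definition field_degree :: "complex set \<Rightarrow> nat" where
  "field_degree F = ring.dim CC \<rat> F"

subsection \<open>Places\<close>

definition padic_abs :: "nat \<Rightarrow> rat \<Rightarrow> real" where
  "padic_abs p q = (if q = 0 then 0 else
     real p powi (int (multiplicity (int p) (snd (quotient_of q)))
                - int (multiplicity (int p) (fst (quotient_of q)))))"

definition absolute_value :: "complex set \<Rightarrow> (complex \<Rightarrow> real) \<Rightarrow> bool" where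
  "absolute_value F v \<longleftrightarrow>
     (\<forall>x\<in>F. 0 \<le> v x) \<and>
     (\<forall>x\<in>F. v x = 0 \<longleftrightarrow> x = 0) \<and>
     (\<forall>x\<in>F. \<forall>y\<in>F. v (x * y) = v x * v y) \<and>
     (\<forall>x\<in>F. \<forall>y\<in>F. v (x + y) \<le> v x + v y)"

text \<open>Every equivalence class of nontrivial absolute values on a number field contains exactly
  one member that extends a standard absolute value of the rationals. A place is represented by
  this normalized member. Values outside \<open>F\<close> are fixed by \<open>extensional\<close>, so that distinct
  functions are distinct places.\<close>

definition places :: "complex set \<Rightarrow> (complex \<Rightarrow> real) set" where
  "places F = {v \<in> extensional F. absolute_value F v \<and>
     ((\<forall>q. v (of_rat q) = \<bar>of_rat q\<bar>) \<or>
      (\<exists>p. Factorial_Ring.prime p \<and> (\<forall>q. v (of_rat q) = padic_abs p q)))}"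

subsection \<open>Completions and local degrees\<close>

definition cauchy_ring :: "complex set \<Rightarrow> (complex \<Rightarrow> real) \<Rightarrow> (nat \<Rightarrow> complex) ring" where
  "cauchy_ring F v =
     \<lparr>carrier = {s. range s \<subseteq> F \<and> (\<forall>e>0. \<exists>N. \<forall>m\<ge>N. \<forall>n\<ge>N. v (s m - s n) < e)},
      mult = (\<lambda>s t n. s n * t n),
      one = (\<lambda>n. 1),
      zero = (\<lambda>n. 0),
      add = (\<lambda>s t n. s n + t n)\<rparr>"

definition null_ideal :: "complex set \<Rightarrow> (complex \<Rightarrow> real) \<Rightarrow> (nat \<Rightarrow> complex) set" where
  "null_ideal F v = {s \<in> carrier (cauchy_ring F v). (\<lambda>n. v (s n)) \<longlonglongrightarrow> 0}"

definition completion :: "complex set \<Rightarrow> (complex \<Rightarrow> real) \<Rightarrow> (nat \<Rightarrow> complex) set ring" where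
  "completion F v = cauchy_ring F v Quot null_ideal F v"

text \<open>The completion of the rationals with respect to the restriction of \<open>v\<close>, as a subfield of
  the completion of \<open>F\<close>: the classes of rational Cauchy sequences.\<close>

definition rat_completion :: "complex set \<Rightarrow> (complex \<Rightarrow> real) \<Rightarrow> (nat \<Rightarrow> complex) set set" where
  "rat_completion F v =
     (\<lambda>s. null_ideal F v +>\<^bsub>cauchy_ring F v\<^esub> s) ` carrier (cauchy_ring \<rat> v)"

definition local_degree :: "complex set \<Rightarrow> (complex \<Rightarrow> real) \<Rightarrow> nat" where
  "local_degree F v =
     ring.dim (completion F v) (rat_completion F v) (carrier (completion F v))"

subsection \<open>The Weil height\<close>

text \<open>Only finitely many terms of the sum are nonzero.\<close>

definition height_in :: "complex set \<Rightarrow> complex \<Rightarrow> real" where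
  "height_in F \<alpha> = 1 / real (field_degree F) *
     (\<Sum>\<^sub>\<infinity>v\<in>places F. real (local_degree F v) * ln (max 1 (v \<alpha>)))"

text \<open>Since \<open>height_in F \<alpha>\<close> is the same for every number field \<open>F\<close> containing \<open>\<alpha>\<close>, the
  height is computed in the field generated by \<open>\<alpha>\<close>.\<close>

definition weil_height :: "complex \<Rightarrow> real" where
  "weil_height \<alpha> = height_in (generate_field CC {\<alpha>}) \<alpha>"

definition height_less :: "complex set \<Rightarrow> real \<Rightarrow> complex set" where
  "height_less K T = {\<alpha> \<in> K - {0}. weil_height \<alpha> < T}"

definition northcott :: "complex set \<Rightarrow> bool" where
  "northcott K \<longleftrightarrow> (\<forall>T>0. finite (height_less K T))"

definition bogomolov :: "complex set \<Rightarrow> bool" where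
  "bogomolov K \<longleftrightarrow> (\<exists>T>0. \<forall>\<alpha>\<in>height_less K T. \<exists>n>0. \<alpha> ^ n = 1)"

subsection \<open>Galois closure\<close>

text \<open>In characteristic zero, Galois means algebraic and normal. As \<open>complex\<close> is algebraically
  closed, a rational polynomial splits over \<open>L\<close> iff all its complex roots lie in \<open>L\<close>.\<close>

definition galois_over_rat :: "complex set \<Rightarrow> bool" where
  "galois_over_rat L \<longleftrightarrow> subfield L CC \<and> L \<subseteq> Qbar \<and>
     (\<forall>f :: rat poly. Factorial_Ring.irreducible f \<longrightarrow>
        (\<exists>x\<in>L. poly (map_poly of_rat f) x = 0) \<longrightarrow>
        (\<forall>x. poly (map_poly of_rat f) x = 0 \<longrightarrow> x \<in> L))"

definition galois_closure :: "complex set \<Rightarrow> complex set" where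
  "galois_closure K = \<Inter>{L. galois_over_rat L \<and> K \<subseteq> L}"

end

theory Submission
  imports Defs
begin

text \<open>
  The field is the union of a tower of real number fields \<open>k i\<close>, where \<open>k (Suc i)\<close> arises from
  \<open>k i\<close> by adjoining the real radical \<open>t = ((1 + sqrt 2) q)^{1/n}\<close> for a prime \<open>n\<close> which exceeds
  \<open>i\<close> and the degree of \<open>k i\<close>, and for a suitable prime \<open>q\<close>.

  The Galois closure contains elements of small height because \<open>t\<close> has a conjugate \<open>z\<close> with
  \<open>z^n = (1 - sqrt 2) q\<close>. In the quotient \<open>z / t\<close> the prime \<open>q\<close> cancels: it is an \<open>n\<close>-th root of the
  unit \<open>(1 - sqrt 2) / (1 + sqrt 2)\<close>, so that its height is \<open>O(1 / n)\<close>, and it is not a root of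
  unity (\<open>ex_small_element_in_galois_closure\<close>).

  The union has the Northcott property because \<open>q\<close> can be chosen such that all new elements of
  \<open>k (Suc i)\<close> have height at least \<open>i\<close> (\<open>ex_radical_large_height\<close>). For fixed \<open>n\<close> the possible
  fields \<open>k i (t)\<close> have a common degree bound, so by Northcott's theorem for bounded degree
  (\<open>finite_bounded_degree_height\<close>) only finitely many elements in all of them together have height
  less than \<open>i\<close>. If every \<open>q\<close> had such an element outside \<open>k i\<close>, infinitely many of the fields would
  share one; as \<open>n\<close> is prime, this element generates each of these fields, so they coincide. By a
  trace argument each radical in such a field becomes an element of \<open>k i\<close> when it is multiplied by
  a suitable power of a fixed one (\<open>radicals_in_same_field\<close>). Two radicals that need the same power
  put an \<open>n\<close>-th root of a quotient of two different primes into \<open>k i\<close>, and its degree \<open>n\<close> is too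
  large for that.

  As the height is a sum over places weighted by local degrees, the arithmetic input consists of
  crude facts about places. For the lower bound it suffices that the sum has finitely many nonzero
  terms, that local degrees are positive, that every conjugate gives a place, and that a prime power
  \<open>p^k\<close> in the leading coefficient of a primitive minimal polynomial of degree \<open>d\<close> forces a place
  over \<open>p\<close> where the value is at least \<open>p^{k/d}\<close> (\<open>ex_padic_place_large\<close>). For the upper bound it
  suffices that all Archimedean places come from conjugates (\<open>arch_place_is_conj\<close>) and have local
  degree at most 2. This description of the Archimedean places and the finiteness of the places over
  a prime both follow from weak approximation (\<open>artin_whaples\<close>).
\<close>

hide_const (open) Divisibility.prime Divisibility.irreducible

section \<open>Subfields of the complex numbers\<close>

lemma CC_simps [simp]:
  "carrier CC = UNIV" "x \<otimes>\<^bsub>CC\<^esub> y = x * y" "\<one>\<^bsub>CC\<^esub> = 1" "\<zero>\<^bsub>CC\<^esub> = 0" "x \<oplus>\<^bsub>CC\<^esub> y = x + y"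
  by (simp_all add: ring_of_type_algebra_def)

lemma field_CC: "field CC"
  by (rule field_from_type_algebra)

lemma ring_CC: "ring CC"
  by (rule ring_from_type_algebra)

lemma CC_a_inv [simp]: "\<ominus>\<^bsub>CC\<^esub> x = - x"
proof -
  interpret ring CC by (rule ring_CC)
  show ?thesis using minus_equality[of "-x" x] by simp
qed

lemma CC_m_inv: "x \<noteq> 0 \<Longrightarrow> inv\<^bsub>CC\<^esub> x = inverse x"
proof -
  assume "x \<noteq> 0"
  interpret ring CC by (rule ring_CC)
  interpret field CC by (rule field_CC)
  show ?thesis using comm_inv_char[of x "inverse x"] \<open>x \<noteq> 0\<close> by simp
qed

locale complex_subfield =
  fixes k :: "complex set"
  assumes one_mem [simp, intro]: "1 \<in> k"
    and diff_mem [intro]: "x \<in> k \<Longrightarrow> y \<in> k \<Longrightarrow> x - y \<in> k"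
    and divide_mem [intro]: "x \<in> k \<Longrightarrow> y \<in> k \<Longrightarrow> x / y \<in> k"
begin

lemma zero_mem [simp, intro]: "0 \<in> k"
  using diff_mem[of 1 1] by simp

lemma minus_mem [intro]: "x \<in> k \<Longrightarrow> - x \<in> k"
  using diff_mem[of 0 x] by simp

lemma add_mem [intro]: "x \<in> k \<Longrightarrow> y \<in> k \<Longrightarrow> x + y \<in> k"
  using diff_mem[of x "- y"] by auto

lemma inverse_mem [intro]: "x \<in> k \<Longrightarrow> inverse x \<in> k"
  using divide_mem[of 1 x] by (simp add: inverse_eq_divide)

lemma mult_mem [intro]: "x \<in> k \<Longrightarrow> y \<in> k \<Longrightarrow> x * y \<in> k"
  using divide_mem[of x "inverse y"] by (auto simp: field_simps)

lemma power_mem [intro]: "x \<in> k \<Longrightarrow> x ^ n \<in> k"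
  by (induction n) auto

lemma of_nat_mem [simp, intro]: "of_nat n \<in> k"
  by (induction n) auto

lemma of_int_mem [simp, intro]: "of_int n \<in> k"
  by (cases n rule: int_diff_cases) auto

lemma of_rat_mem [simp, intro]: "of_rat q \<in> k"
  by (cases q) (auto simp: of_rat_rat)

lemma Rats_subset: "\<rat> \<subseteq> k"
  by (auto elim: Rats_cases)

lemma sum_mem [intro]: "(\<And>i. i \<in> A \<Longrightarrow> f i \<in> k) \<Longrightarrow> (\<Sum>i\<in>A. f i) \<in> k"
  by (induction A rule: infinite_finite_induct) auto

end

lemma subfield_CC_iff: "subfield k CC \<longleftrightarrow> complex_subfield k"
proof
  assume sf: "subfield k CC"
  note r = subringE[OF subfieldE(1)[OF sf]]
  have inv: "inverse x \<in> k" if "x \<in> k" for x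
  proof (cases "x = 0")
    case True thus ?thesis using r(2) by simp
  next
    case False
    thus ?thesis using ring.subfield_m_inv(1)[OF ring_CC sf, of x] that by (auto simp: CC_m_inv)
  qed
  show "complex_subfield k"
  proof
    show "1 \<in> k" using r(3) by simp
    show "x - y \<in> k" if "x \<in> k" "y \<in> k" for x y
      using r(7)[OF that(1) r(5)[OF that(2)]] by simp
    show "x / y \<in> k" if "x \<in> k" "y \<in> k" for x y
      using r(6)[OF that(1) inv[OF that(2)]] by (simp add: divide_inverse)
  qed
next
  assume "complex_subfield k"
  then interpret complex_subfield k .
  show "subfield k CC"
    by (intro field.subfieldI'[OF field_CC] ring.subringI[OF ring_CC])
       (auto simp: CC_m_inv)
qed

lemma complex_subfield_Rats: "complex_subfield \<rat>"
  by unfold_locales auto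

lemma complex_subfield_Reals: "complex_subfield \<real>"
  by unfold_locales auto

section \<open>Polynomials over a subfield and minimal polynomials\<close>

definition polys_over :: "complex set \<Rightarrow> complex poly set" where
  "polys_over k = {p. \<forall>i. coeff p i \<in> k}"

lemma polys_overD: "p \<in> polys_over k \<Longrightarrow> coeff p i \<in> k"
  by (simp add: polys_over_def)

lemma polys_over_mono: "k \<subseteq> l \<Longrightarrow> polys_over k \<subseteq> polys_over l"
  by (auto simp: polys_over_def)

definition minimal_poly :: "complex set \<Rightarrow> complex \<Rightarrow> complex poly \<Rightarrow> bool" where
  "minimal_poly k \<alpha> m \<longleftrightarrow> m \<in> polys_over k \<and> lead_coeff m = 1 \<and> poly m \<alpha> = 0 \<and>
     (\<forall>g\<in>polys_over k. poly g \<alpha> = 0 \<longrightarrow> g \<noteq> 0 \<longrightarrow> degree m \<le> degree g)"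

definition simple_ext :: "complex set \<Rightarrow> complex \<Rightarrow> complex set" where
  "simple_ext k \<alpha> = (\<lambda>p. poly p \<alpha>) ` polys_over k"

context complex_subfield
begin

lemma polys_over_0 [simp]: "0 \<in> polys_over k"
  by (simp add: polys_over_def)

lemma polys_over_1 [simp]: "1 \<in> polys_over k"
  by (simp add: polys_over_def coeff_1)

lemma polys_over_add: "p \<in> polys_over k \<Longrightarrow> q \<in> polys_over k \<Longrightarrow> p + q \<in> polys_over k"
  by (auto simp: polys_over_def)

lemma polys_over_diff: "p \<in> polys_over k \<Longrightarrow> q \<in> polys_over k \<Longrightarrow> p - q \<in> polys_over k"
  by (auto simp: polys_over_def)

lemma polys_over_minus: "p \<in> polys_over k \<Longrightarrow> - p \<in> polys_over k"
  by (auto simp: polys_over_def)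

lemma polys_over_smult: "c \<in> k \<Longrightarrow> p \<in> polys_over k \<Longrightarrow> smult c p \<in> polys_over k"
  by (auto simp: polys_over_def)

lemma polys_over_monom: "c \<in> k \<Longrightarrow> monom c n \<in> polys_over k"
  by (auto simp: polys_over_def coeff_monom)

lemma polys_over_pCons: "c \<in> k \<Longrightarrow> p \<in> polys_over k \<Longrightarrow> pCons c p \<in> polys_over k"
  by (auto simp: polys_over_def coeff_pCons split: nat.splits)

lemma polys_over_mult: "p \<in> polys_over k \<Longrightarrow> q \<in> polys_over k \<Longrightarrow> p * q \<in> polys_over k"
  by (auto simp: polys_over_def coeff_mult)

lemma polys_over_power: "p \<in> polys_over k \<Longrightarrow> p ^ n \<in> polys_over k"
  by (induction n) (auto intro: polys_over_mult)

lemma polys_over_sum: "(\<And>i. i \<in> A \<Longrightarrow> f i \<in> polys_over k) \<Longrightarrow> (\<Sum>i\<in>A. f i) \<in> polys_over k"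
  by (induction A rule: infinite_finite_induct) (auto intro: polys_over_add)

lemma polys_over_pderiv: "p \<in> polys_over k \<Longrightarrow> pderiv p \<in> polys_over k"
  by (auto simp: polys_over_def coeff_pderiv simp del: of_nat_Suc)

lemma polys_over_pcompose: "p \<in> polys_over k \<Longrightarrow> q \<in> polys_over k \<Longrightarrow> pcompose p q \<in> polys_over k"
proof (induction p)
  case (pCons a p)
  hence "a \<in> k" "p \<in> polys_over k"
    using polys_overD[OF pCons.prems(1), of 0] polys_overD[OF pCons.prems(1), of "Suc i" for i]
    by (auto simp: polys_over_def)
  thus ?case using pCons by (auto simp: pcompose_pCons intro!: polys_over_add polys_over_mult polys_over_pCons)
qed simp

lemma poly_mem: "p \<in> polys_over k \<Longrightarrow> x \<in> k \<Longrightarrow> poly p x \<in> k"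
  by (auto simp: poly_altdef polys_over_def)

lemmas polys_over_closed = polys_over_0 polys_over_1 polys_over_add polys_over_diff
  polys_over_minus polys_over_smult polys_over_monom polys_over_pCons polys_over_mult
  polys_over_power polys_over_sum polys_over_pderiv polys_over_pcompose

lemma polys_over_division:
  assumes m: "m \<in> polys_over k" "m \<noteq> 0" and p: "p \<in> polys_over k"
  shows "\<exists>q\<in>polys_over k. \<exists>r\<in>polys_over k. p = m * q + r \<and> (r = 0 \<or> degree r < degree m)"
  using p
proof (induction "degree p" arbitrary: p rule: less_induct)
  case less
  show ?case
  proof (cases "p = 0 \<or> degree p < degree m")
    case True
    thus ?thesis using less.prems by (intro bexI[of _ 0] bexI[of _ p]) auto
  next
    case False
    define c where "c = lead_coeff p / lead_coeff m"
    define t where "t = monom c (degree p - degree m)"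
    have c: "c \<in> k" "c \<noteq> 0" using False m less.prems by (auto simp: c_def polys_over_def)
    have t: "t \<in> polys_over k" using c by (auto simp: t_def intro: polys_over_monom)
    define p' where "p' = p - m * t"
    have p': "p' \<in> polys_over k" using less.prems m t by (auto simp: p'_def intro!: polys_over_closed)
    have tn: "t \<noteq> 0" "degree t = degree p - degree m" using c(2) unfolding t_def by (simp_all add: degree_monom_eq monom_eq_0_iff)
    have dmt: "degree (m * t) = degree p" using tn m False by (simp add: degree_mult_eq)
    have lc: "lead_coeff (m * t) = lead_coeff p"
    proof -
      have "lead_coeff t = c" using tn by (simp add: t_def)
      thus ?thesis using m by (simp add: lead_coeff_mult c_def)
    qed
    have "p' = 0 \<or> degree p' < degree p"
    proof (cases "degree p = 0")
      case True
      hence "degree (m*t) = 0" using dmt by simp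
      hence "p' = 0" using True lc dmt
        by (metis p'_def coeff_0 diff_self degree_eq_zeroE coeff_pCons_0 degree_pCons_0)
      thus ?thesis by simp
    next
      case False
      have "coeff p' (degree p) = 0" using lc dmt by (simp add: p'_def)
      moreover have "degree p' \<le> degree p" using dmt by (simp add: p'_def degree_diff_le)
      ultimately show ?thesis using False
        by (metis le_neq_implies_less leading_coeff_0_iff)
    qed
    hence "\<exists>q\<in>polys_over k. \<exists>r\<in>polys_over k. p' = m * q + r \<and> (r = 0 \<or> degree r < degree m)"
    proof
      assume "p' = 0" thus ?thesis by (intro bexI[of _ 0]) auto
    qed (use less.hyps p' in blast)
    then obtain q r where qr: "q \<in> polys_over k" "r \<in> polys_over k" "p' = m * q + r"
       "r = 0 \<or> degree r < degree m" by blast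
    show ?thesis
      by (intro bexI[of _ "q + t"] bexI[of _ r]) (use qr t in \<open>auto simp: p'_def algebra_simps intro: polys_over_add\<close>)
  qed
qed

lemma ex_minimal_poly:
  assumes "p \<in> polys_over k" "p \<noteq> 0" "poly p \<alpha> = 0"
  shows "\<exists>m. minimal_poly k \<alpha> m \<and> degree m \<le> degree p"
proof -
  define P where "P = (\<lambda>n. \<exists>g\<in>polys_over k. g \<noteq> 0 \<and> poly g \<alpha> = 0 \<and> degree g = n)"
  have "P (degree p)" using assms by (auto simp: P_def)
  from LeastI[of P, OF this] obtain g where g: "g \<in> polys_over k" "g \<noteq> 0" "poly g \<alpha> = 0"
    "degree g = (LEAST n. P n)" by (auto simp: P_def)
  have least: "degree g \<le> degree h" if "h \<in> polys_over k" "poly h \<alpha> = 0" "h \<noteq> 0" for h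
    using that g by (auto intro!: Least_le simp: P_def)
  define m where "m = smult (inverse (lead_coeff g)) g"
  have lc: "lead_coeff g \<noteq> 0" "lead_coeff g \<in> k" using g(1,2) by (auto dest: polys_overD)
  hence "m \<in> polys_over k" "lead_coeff m = 1" "degree m = degree g" "poly m \<alpha> = 0"
    using g(1,3) by (auto simp: m_def intro!: polys_over_smult)
  hence "minimal_poly k \<alpha> m" using least by (simp add: minimal_poly_def)
  moreover have "degree m \<le> degree p" using least[of p] assms g by (simp add: m_def)
  ultimately show ?thesis by blast
qed

lemma minimal_poly_dvd:
  assumes m: "minimal_poly k \<alpha> m" and g: "g \<in> polys_over k" "poly g \<alpha> = 0"
  shows "\<exists>q\<in>polys_over k. g = m * q"
proof -
  have m': "m \<in> polys_over k" "m \<noteq> 0" "poly m \<alpha> = 0" using m by (auto simp: minimal_poly_def)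
  from polys_over_division[OF m'(1,2) g(1)] obtain q r where qr: "q \<in> polys_over k" "r \<in> polys_over k"
    "g = m * q + r" "r = 0 \<or> degree r < degree m" by blast
  have "poly r \<alpha> = 0" using qr(3) m'(3) g(2) by simp
  hence "r = 0" using qr m by (auto simp: minimal_poly_def)
  thus ?thesis using qr by auto
qed

lemma minimal_poly_degree_pos: "minimal_poly k \<alpha> m \<Longrightarrow> degree m > 0"
  unfolding minimal_poly_def by (metis degree_eq_zeroE gr0I lead_coeff_pCons(2) mult_zero_right one_pCons
    pCons_0_0 add.right_neutral degree_pCons_0 coeff_pCons_0 poly_pCons poly_0 zero_neq_one)

lemma minimal_poly_eq_0:
  assumes "minimal_poly k \<alpha> m" "g \<in> polys_over k" "poly g \<alpha> = 0" "degree g < degree m"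
  shows "g = 0"
  using assms unfolding minimal_poly_def by (meson leD)

text \<open>Minimality passes to every conjugate, because a polynomial of smaller degree vanishing at
  one root would split off a proper factor.\<close>
lemma minimal_poly_conjugate:
  assumes m: "minimal_poly k \<alpha> m" and z: "poly m z = 0"
  shows "minimal_poly k z m"
proof -
  have m': "m \<in> polys_over k" "m \<noteq> 0" "poly m \<alpha> = 0" "lead_coeff m = 1"
    using m by (auto simp: minimal_poly_def)
  from ex_minimal_poly[OF m'(1,2) z] obtain n where n: "minimal_poly k z n" by blast
  from minimal_poly_dvd[OF n m'(1) z] obtain q where q: "q \<in> polys_over k" "m = n * q" by blast
  have n': "n \<in> polys_over k" "n \<noteq> 0" using n by (auto simp: minimal_poly_def)
  have q0: "q \<noteq> 0" using q m' by auto
  have deg: "degree m = degree n + degree q" using q q0 n' by (simp add: degree_mult_eq)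
  have "poly q \<alpha> \<noteq> 0"
  proof
    assume "poly q \<alpha> = 0"
    hence "degree m \<le> degree q" using m q q0 by (auto simp: minimal_poly_def)
    thus False using deg minimal_poly_degree_pos[OF n] by simp
  qed
  hence "poly n \<alpha> = 0" using q m' by auto
  hence "degree m \<le> degree n" using m n' by (auto simp: minimal_poly_def)
  thus ?thesis using m' z n unfolding minimal_poly_def by (meson le_trans)
qed

lemma minimal_poly_rsquarefree:
  assumes m: "minimal_poly k \<alpha> m"
  shows "rsquarefree m"
proof -
  have m': "m \<in> polys_over k" "m \<noteq> 0" "poly m \<alpha> = 0" "lead_coeff m = 1"
    using m by (auto simp: minimal_poly_def)
  have "\<not> (poly m z = 0 \<and> poly (pderiv m) z = 0)" for z
  proof
    assume z: "poly m z = 0 \<and> poly (pderiv m) z = 0"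
    have "pderiv m = 0"
      using minimal_poly_eq_0[OF minimal_poly_conjugate[OF m], of z "pderiv m"] z m'
        minimal_poly_degree_pos[OF m] by (auto simp: polys_over_pderiv degree_pderiv)
    thus False using minimal_poly_degree_pos[OF m] by (simp add: pderiv_eq_0_iff)
  qed
  thus ?thesis using m' by (auto simp: rsquarefree_roots)
qed

lemma minimal_poly_roots:
  assumes m: "minimal_poly k \<alpha> m"
  shows "finite {z. poly m z = 0}" "card {z. poly m z = 0} = degree m"
    "m = (\<Prod>z | poly m z = 0. [:-z, 1:])"
proof -
  have m': "m \<noteq> 0" "lead_coeff m = 1" using m by (auto simp: minimal_poly_def)
  show "finite {z. poly m z = 0}" using m' by (simp add: poly_roots_finite)
  show *: "m = (\<Prod>z | poly m z = 0. [:-z, 1:])"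
    using complex_poly_decompose_rsquarefree[OF minimal_poly_rsquarefree[OF m]] m' by simp
  have "degree m = degree (\<Prod>z | poly m z = 0. [:-z, 1:])" using * by simp
  also have "\<dots> = card {z. poly m z = 0}" by (subst degree_prod_sum_eq) auto
  finally show "card {z. poly m z = 0} = degree m" ..
qed

lemma minimal_poly_norm_coeff_0:
  assumes m: "minimal_poly k \<alpha> m" and root: "\<And>z. poly m z = 0 \<Longrightarrow> cmod z = t"
  shows "cmod (coeff m 0) = t ^ degree m"
proof -
  have "coeff m 0 = poly m 0" by (simp add: poly_0_coeff_0)
  also have "\<dots> = (\<Prod>z | poly m z = 0. - z)" by (subst minimal_poly_roots(3)[OF m]) (simp add: poly_prod)
  finally have "cmod (coeff m 0) = (\<Prod>z | poly m z = 0. cmod z)" by (simp add: prod_norm[symmetric])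
  also have "\<dots> = (\<Prod>z | poly m z = 0. t)" using root by (intro prod.cong) auto
  also have "\<dots> = t ^ degree m" using minimal_poly_roots(2)[OF m] by simp
  finally show ?thesis .
qed

lemma simple_ext_reduced:
  assumes m: "minimal_poly k \<alpha> m" and x: "x \<in> simple_ext k \<alpha>"
  shows "\<exists>p\<in>polys_over k. degree p < degree m \<and> x = poly p \<alpha>"
proof -
  from x obtain p where p: "p \<in> polys_over k" "x = poly p \<alpha>" by (auto simp: simple_ext_def)
  have m': "m \<in> polys_over k" "m \<noteq> 0" "poly m \<alpha> = 0" using m by (auto simp: minimal_poly_def)
  from polys_over_division[OF m'(1,2) p(1)] obtain q r where qr: "q \<in> polys_over k" "r \<in> polys_over k"
    "p = m * q + r" "r = 0 \<or> degree r < degree m" by blast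
  thus ?thesis using p m' minimal_poly_degree_pos[OF m] by (intro bexI[of _ r]) auto
qed

text \<open>Inverses are found by the Euclidean algorithm, run on the minimal polynomial.\<close>
lemma simple_ext_inverse:
  assumes m: "minimal_poly k \<alpha> m" and x: "x \<in> simple_ext k \<alpha>"
  shows "inverse x \<in> simple_ext k \<alpha>"
proof (cases "x = 0")
  case True
  thus ?thesis using x by simp
next
  case False
  have m': "m \<in> polys_over k" "m \<noteq> 0" "poly m \<alpha> = 0" using m by (auto simp: minimal_poly_def)
  have *: "inverse (poly p \<alpha>) \<in> simple_ext k \<alpha>"
    if "p \<in> polys_over k" "degree p < degree m" "p \<noteq> 0" for p
    using that
  proof (induction "degree p" arbitrary: p rule: less_induct)
    case less
    from polys_over_division[OF less.prems(1,3) m'(1)] obtain q r where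
      qr: "q \<in> polys_over k" "r \<in> polys_over k" "m = p * q + r" "r = 0 \<or> degree r < degree p" by blast
    have pa: "poly p \<alpha> \<noteq> 0" using minimal_poly_eq_0[OF m less.prems(1)] less.prems by auto
    show ?case
    proof (cases "r = 0")
      case True
      have q0: "q \<noteq> 0" using qr True m' by auto
      have "poly q \<alpha> = 0" using qr True pa m' by auto
      hence "degree m \<le> degree q" using m qr q0 by (auto simp: minimal_poly_def)
      hence "degree p = 0" using qr True q0 less.prems by (simp add: degree_mult_eq)
      then obtain c where c: "p = [:c:]" by (auto elim: degree_eq_zeroE)
      have "c \<in> k" using less.prems(1) polys_overD[of p k 0] c by simp
      thus ?thesis unfolding simple_ext_def using c
        by (intro image_eqI[of _ _ "[:inverse c:]"]) (auto intro!: polys_over_closed)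
    next
      case False
      hence "inverse (poly r \<alpha>) \<in> simple_ext k \<alpha>" using less.hyps[of r] qr less.prems by auto
      then obtain s where s: "s \<in> polys_over k" "inverse (poly r \<alpha>) = poly s \<alpha>"
        by (auto simp: simple_ext_def)
      have ra: "poly r \<alpha> \<noteq> 0" using minimal_poly_eq_0[OF m qr(2)] qr less.prems False by auto
      have "poly p \<alpha> * poly q \<alpha> = - poly r \<alpha>" using qr(3) m'(3)
        by (metis add.inverse_unique add.commute poly_add poly_mult)
      hence "inverse (poly p \<alpha>) = - poly q \<alpha> * inverse (poly r \<alpha>)"
        using pa ra by (simp add: field_simps)
      hence "inverse (poly p \<alpha>) = poly (- (q * s)) \<alpha>" using s by simp
      thus ?thesis unfolding simple_ext_def using qr s
        by (intro image_eqI[of _ _ "-(q*s)"]) (auto intro!: polys_over_closed)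
    qed
  qed
  from simple_ext_reduced[OF m x] obtain p where "p \<in> polys_over k" "degree p < degree m" "x = poly p \<alpha>"
    by blast
  thus ?thesis using *[of p] False by (metis poly_0)
qed

lemma simple_ext_superset: "k \<subseteq> simple_ext k \<alpha>"
proof
  fix x assume "x \<in> k" thus "x \<in> simple_ext k \<alpha>" unfolding simple_ext_def
    by (intro image_eqI[of _ _ "[:x:]"]) (auto intro!: polys_over_closed)
qed

lemma simple_ext_generator: "\<alpha> \<in> simple_ext k \<alpha>"
  unfolding simple_ext_def by (intro image_eqI[of _ _ "[:0,1:]"]) (auto intro!: polys_over_closed)

lemma simple_ext_subfield:
  assumes m: "minimal_poly k \<alpha> m"
  shows "complex_subfield (simple_ext k \<alpha>)"
proof
  show "1 \<in> simple_ext k \<alpha>" using simple_ext_superset by blast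
  show "x - y \<in> simple_ext k \<alpha>" if xy: "x \<in> simple_ext k \<alpha>" "y \<in> simple_ext k \<alpha>" for x y
  proof -
    from xy obtain p q where pq: "p \<in> polys_over k" "q \<in> polys_over k" "x = poly p \<alpha>" "y = poly q \<alpha>"
      by (auto simp: simple_ext_def)
    thus ?thesis unfolding simple_ext_def
      by (intro image_eqI[of _ _ "p - q"]) (auto intro!: polys_over_closed)
  qed
  show "x / y \<in> simple_ext k \<alpha>" if xy: "x \<in> simple_ext k \<alpha>" "y \<in> simple_ext k \<alpha>" for x y
  proof -
    from xy simple_ext_inverse[OF m xy(2)] obtain p q where
      pq: "p \<in> polys_over k" "q \<in> polys_over k" "x = poly p \<alpha>" "inverse y = poly q \<alpha>"
      by (auto simp: simple_ext_def)
    thus ?thesis unfolding simple_ext_def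
      by (intro image_eqI[of _ _ "p * q"]) (auto intro!: polys_over_closed simp: divide_inverse)
  qed
qed

lemma simple_ext_least:
  assumes "complex_subfield l" "k \<subseteq> l" "\<alpha> \<in> l"
  shows "simple_ext k \<alpha> \<subseteq> l"
  using complex_subfield.poly_mem[OF assms(1)] assms polys_over_mono[OF assms(2)]
  by (auto simp: simple_ext_def)

end

section \<open>Degrees over the rationals\<close>

lemma algebraic_iff_polys_over_Rats:
  "algebraic \<alpha> \<longleftrightarrow> (\<exists>p\<in>polys_over \<rat>. p \<noteq> 0 \<and> poly p \<alpha> = 0)"
  unfolding algebraic_altdef polys_over_def by auto

lemma algebraic_minimal_poly:
  "algebraic \<alpha> \<Longrightarrow> \<exists>m. minimal_poly \<rat> \<alpha> m"
  using complex_subfield.ex_minimal_poly[OF complex_subfield_Rats]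
  by (auto simp: algebraic_iff_polys_over_Rats)

lemma generate_field_eq_simple_ext:
  assumes m: "minimal_poly \<rat> \<alpha> m"
  shows "generate_field CC {\<alpha>} = simple_ext \<rat> \<alpha>"
proof
  interpret Q: complex_subfield \<rat> by (rule complex_subfield_Rats)
  have gen: "complex_subfield (generate_field CC {\<alpha>})"
    using field.generate_field_is_subfield[OF field_CC, of "{\<alpha>}"] by (simp add: subfield_CC_iff)
  have "\<alpha> \<in> generate_field CC {\<alpha>}" by (rule generate_field.incl) simp
  thus "simple_ext \<rat> \<alpha> \<subseteq> generate_field CC {\<alpha>}"
    using Q.simple_ext_least[OF gen] complex_subfield.Rats_subset[OF gen] by blast
  show "generate_field CC {\<alpha>} \<subseteq> simple_ext \<rat> \<alpha>"
    using field.generate_field_min_subfield1[OF field_CC, of "{\<alpha>}" "simple_ext \<rat> \<alpha>"]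
      Q.simple_ext_subfield[OF m] Q.simple_ext_generator[of \<alpha>] by (simp add: subfield_CC_iff)
qed

lemma field_degree_simple_ext:
  assumes m: "minimal_poly \<rat> \<alpha> m"
  shows "field_degree (simple_ext \<rat> \<alpha>) = degree m"
proof -
  interpret Q: complex_subfield \<rat> by (rule complex_subfield_Rats)
  interpret CR: ring CC by (rule ring_CC)
  have sf: "subfield \<rat> CC" by (simp add: subfield_CC_iff complex_subfield_Rats)
  define E where "E = (\<lambda>j. {poly p \<alpha> |p. p \<in> polys_over \<rat> \<and> (\<forall>i\<ge>j. coeff p i = 0)})"
  have E0: "E 0 = {0}"
  proof -
    have "p = 0" if "\<forall>i\<ge>0. coeff p i = 0" for p :: "complex poly" using that by (simp add: poly_eq_iff)
    hence "E 0 \<subseteq> {0}" unfolding E_def by fastforce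
    moreover have "0 \<in> E 0" unfolding E_def by (auto intro!: exI[of _ 0])
    ultimately show ?thesis by blast
  qed
  have notin: "\<alpha> ^ j \<notin> E j" if "j < degree m" for j
  proof
    assume "\<alpha> ^ j \<in> E j"
    then obtain p where p: "p \<in> polys_over \<rat>" "\<forall>i\<ge>j. coeff p i = 0" "\<alpha> ^ j = poly p \<alpha>" by (auto simp: E_def)
    define g where "g = monom 1 j - p"
    have "degree g \<le> j" using p(2) by (intro degree_le) (auto simp: g_def coeff_monom)
    hence "g = 0" using p that
      by (intro Q.minimal_poly_eq_0[OF m]) (auto simp: g_def poly_monom intro!: Q.polys_over_closed)
    moreover have "coeff g j = 1" using p by (simp add: g_def)
    ultimately show False by simp
  qed
  have step: "CR.line_extension \<rat> (\<alpha> ^ j) (E j) = E (Suc j)" for j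
  proof (intro equalityI subsetI)
    fix x assume "x \<in> CR.line_extension \<rat> (\<alpha> ^ j) (E j)"
    then obtain c y where "c \<in> \<rat>" "y \<in> E j" "x = c * \<alpha> ^ j + y" by (auto simp: CR.line_extension_mem_iff)
    then obtain p where p: "p \<in> polys_over \<rat>" "\<forall>i\<ge>j. coeff p i = 0" "x = c * \<alpha> ^ j + poly p \<alpha>" "c \<in> \<rat>"
      by (auto simp: E_def)
    thus "x \<in> E (Suc j)" unfolding E_def
      by (intro CollectI exI[of _ "monom c j + p"]) (auto simp: poly_monom coeff_monom intro!: Q.polys_over_closed)
  next
    fix x assume "x \<in> E (Suc j)"
    then obtain p where p: "p \<in> polys_over \<rat>" "\<forall>i\<ge>Suc j. coeff p i = 0" "x = poly p \<alpha>" by (auto simp: E_def)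
    define q where "q = p - monom (coeff p j) j"
    have c: "coeff p j \<in> \<rat>" using p(1) by (rule polys_overD)
    have "\<forall>i\<ge>j. coeff q i = 0" using p(2) by (auto simp: q_def coeff_monom Suc_le_eq)
    moreover have "q \<in> polys_over \<rat>" using p(1) c by (auto simp: q_def intro!: Q.polys_over_closed)
    ultimately have "poly q \<alpha> \<in> E j" by (auto simp: E_def)
    moreover have "x = coeff p j * \<alpha> ^ j + poly q \<alpha>" using p by (simp add: q_def poly_monom)
    ultimately show "x \<in> CR.line_extension \<rat> (\<alpha> ^ j) (E j)" using c
      by (auto simp: CR.line_extension_mem_iff)
  qed
  have "CR.dimension j \<rat> (E j)" if "j \<le> degree m" for j
    using that
  proof (induction j)
    case 0 show ?case using CR.zero_dim[of "\<rat>"] by (simp add: E0)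
  next
    case (Suc j)
    thus ?case using CR.Suc_dim[of "\<alpha> ^ j" "E j" j "\<rat>"] notin[of j] step[of j] by simp
  qed
  moreover have "E (degree m) = simple_ext \<rat> \<alpha>"
  proof (intro equalityI subsetI)
    fix x assume "x \<in> simple_ext \<rat> \<alpha>"
    from Q.simple_ext_reduced[OF m this] obtain p where "p \<in> polys_over \<rat>" "degree p < degree m" "x = poly p \<alpha>"
      by blast
    thus "x \<in> E (degree m)" by (auto simp: E_def coeff_eq_0)
  qed (auto simp: E_def simple_ext_def)
  ultimately have "CR.dimension (degree m) \<rat> (simple_ext \<rat> \<alpha>)" by (metis order_refl)
  thus ?thesis using CR.dimI[OF sf] by (simp add: field_degree_def over_def)
qed

interpretation ratvs: vector_space "\<lambda>(q::rat) (x::complex). of_rat q * x"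
  by unfold_locales (auto simp: algebra_simps of_rat_add of_rat_mult)

lemma Rats_subset_span: "\<rat> \<subseteq> ratvs.span {1}"
proof
  fix x :: complex assume "x \<in> \<rat>"
  then obtain q where "x = of_rat q * 1" by (auto elim: Rats_cases)
  thus "x \<in> ratvs.span {1}" by (metis ratvs.span_scale ratvs.span_base singletonI)
qed

lemma ratvs_dependent_poly:
  assumes "finite B" "\<And>i. x ^ i \<in> ratvs.span B"
  shows "\<exists>p\<in>polys_over \<rat>. p \<noteq> 0 \<and> degree p \<le> card B \<and> poly p x = 0"
proof -
  interpret Q: complex_subfield \<rat> by (rule complex_subfield_Rats)
  define S where "S = (\<lambda>i. x ^ i) ` {..card B}"
  show ?thesis
  proof (cases "inj_on (\<lambda>i. x ^ i) {..card B}")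
    case False
    then obtain i j where ij: "i \<le> card B" "j \<le> card B" "i \<noteq> j" "x ^ i = x ^ j" by (auto simp: inj_on_def)
    define p :: "complex poly" where "p = monom 1 i - monom 1 j"
    have "coeff p i = 1" using ij by (simp add: p_def)
    hence "p \<noteq> 0" by auto
    moreover have "degree p \<le> card B" using ij
      by (intro degree_le) (auto simp: p_def coeff_monom)
    ultimately show ?thesis using ij
      by (intro bexI[of _ p]) (auto simp: p_def poly_monom intro!: Q.polys_over_closed)
  next
    case True
    have "card S = Suc (card B)" using True by (simp add: S_def card_image)
    moreover have "S \<subseteq> ratvs.span B" using assms by (auto simp: S_def)
    ultimately have "ratvs.dependent S" using ratvs.independent_span_bound[OF assms(1), of S] by auto
    moreover have fS: "finite S" by (simp add: S_def)
    ultimately obtain u v where uv: "v \<in> S" "u v \<noteq> 0" "(\<Sum>v\<in>S. of_rat (u v) * v) = 0"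
      using ratvs.dependent_finite[OF fS] by auto
    define p :: "complex poly" where "p = (\<Sum>i\<le>card B. monom (of_rat (u (x ^ i))) i)"
    have cf: "coeff p i = (if i \<le> card B then of_rat (u (x ^ i)) else 0)" for i
      by (simp add: p_def coeff_sum coeff_monom)
    from uv(1) obtain i where "i \<le> card B" "v = x ^ i" by (auto simp: S_def)
    hence "coeff p i \<noteq> 0" using uv(2) by (simp add: cf)
    hence "p \<noteq> 0" by auto
    moreover have "degree p \<le> card B" by (intro degree_le) (auto simp: cf)
    moreover have "poly p x = 0"
    proof -
      have "poly p x = (\<Sum>i\<le>card B. of_rat (u (x ^ i)) * x ^ i)" by (simp add: p_def poly_sum poly_monom)
      also have "\<dots> = (\<Sum>v\<in>S. of_rat (u v) * v)" unfolding S_def by (subst sum.reindex[OF True]) simp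
      finally show ?thesis using uv by simp
    qed
    moreover have "p \<in> polys_over \<rat>" by (auto simp: polys_over_def cf)
    ultimately show ?thesis by blast
  qed
qed

lemma simple_ext_span:
  assumes k: "complex_subfield k" and m: "minimal_poly k \<alpha> m"
    and B: "finite B" "k \<subseteq> ratvs.span B"
  shows "\<exists>B'. finite B' \<and> simple_ext k \<alpha> \<subseteq> ratvs.span B' \<and> card B' \<le> degree m * card B"
proof -
  define B' where "B' = (\<lambda>(i,b). b * \<alpha> ^ i) ` ({..<degree m} \<times> B)"
  have "simple_ext k \<alpha> \<subseteq> ratvs.span B'"
  proof
    fix x assume "x \<in> simple_ext k \<alpha>"
    from complex_subfield.simple_ext_reduced[OF k m this] obtain p where
      p: "p \<in> polys_over k" "degree p < degree m" "x = poly p \<alpha>" by blast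
    have "c * \<alpha> ^ i \<in> ratvs.span B'" if "c \<in> k" "i < degree m" for c i
    proof -
      have "c \<in> ratvs.span B" using that B by auto
      thus ?thesis
      proof (induction rule: ratvs.span_induct_alt)
        case base thus ?case using ratvs.span_zero by simp
      next
        case (step r b y)
        have "b * \<alpha> ^ i \<in> B'" using that step by (auto simp: B'_def intro!: image_eqI[of _ _ "(i,b)"])
        hence "of_rat r * (b * \<alpha> ^ i) + y * \<alpha> ^ i \<in> ratvs.span B'"
          using step(2) by (intro ratvs.span_add[OF ratvs.span_scale[OF ratvs.span_base]])
        thus ?case by (simp add: algebra_simps)
      qed
    qed
    hence "(\<Sum>i\<le>degree p. coeff p i * \<alpha> ^ i) \<in> ratvs.span B'"
      using p polys_overD[OF p(1)] by (intro ratvs.span_sum) auto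
    thus "x \<in> ratvs.span B'" using p by (simp add: poly_altdef)
  qed
  moreover have "card B' \<le> degree m * card B" unfolding B'_def using B
    by (intro order.trans[OF card_image_le]) auto
  moreover have "finite B'" using B by (auto simp: B'_def)
  ultimately show ?thesis by blast
qed

section \<open>Absolute values and weak approximation\<close>

locale abs_value_field = complex_subfield F for F +
  fixes v :: "complex \<Rightarrow> real"
  assumes absolute_value: "absolute_value F v"
begin

lemma v_nonneg [simp]: "x \<in> F \<Longrightarrow> 0 \<le> v x"
  and v_eq_0_iff: "x \<in> F \<Longrightarrow> v x = 0 \<longleftrightarrow> x = 0"
  and v_mult: "x \<in> F \<Longrightarrow> y \<in> F \<Longrightarrow> v (x * y) = v x * v y"
  and v_add: "x \<in> F \<Longrightarrow> y \<in> F \<Longrightarrow> v (x + y) \<le> v x + v y"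
  using absolute_value by (auto simp: absolute_value_def)

lemma v_0 [simp]: "v 0 = 0"
  by (simp add: v_eq_0_iff)

lemma v_pos: "x \<in> F \<Longrightarrow> x \<noteq> 0 \<Longrightarrow> 0 < v x"
  using v_nonneg[of x] v_eq_0_iff[of x] by linarith

lemma v_1 [simp]: "v 1 = 1"
  using v_mult[of 1 1] v_eq_0_iff[of 1] by simp

lemma v_power: "x \<in> F \<Longrightarrow> v (x ^ n) = v x ^ n"
  by (induction n) (auto simp: v_mult power_mem)

lemma v_minus: assumes "x \<in> F" shows "v (- x) = v x"
proof -
  have "v (-1) ^ 2 = 1" using v_power[of "-1" 2] minus_mem[of 1] by simp
  moreover have "v (-1) \<ge> 0" using minus_mem[of 1] by simp
  ultimately have "v (-1) = 1" by (simp add: power2_eq_1_iff)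
  thus ?thesis using v_mult[of "-1" x] minus_mem[of 1] assms by simp
qed

lemma v_diff: "x \<in> F \<Longrightarrow> y \<in> F \<Longrightarrow> v (x - y) \<le> v x + v y"
  using v_add[of x "- y"] by (auto simp: v_minus)

lemma v_diff_commute: "x \<in> F \<Longrightarrow> y \<in> F \<Longrightarrow> v (x - y) = v (y - x)"
  using v_minus[of "x - y"] diff_mem[of x y] by simp

lemma v_diff_ge: "x \<in> F \<Longrightarrow> y \<in> F \<Longrightarrow> \<bar>v x - v y\<bar> \<le> v (x - y)"
  using v_add[of "x - y" y] v_add[of "y - x" x] v_diff_commute[of x y] by force

lemma v_inverse: assumes "x \<in> F" shows "v (inverse x) = inverse (v x)"
proof (cases "x = 0")
  case False
  hence "v x * v (inverse x) = 1" using v_mult[of x "inverse x"] assms inverse_mem by auto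
  thus ?thesis by (metis inverse_unique)
qed simp

lemma v_divide: "x \<in> F \<Longrightarrow> y \<in> F \<Longrightarrow> v (x / y) = v x / v y"
  using v_mult[of x "inverse y"] by (auto simp: v_inverse divide_inverse)

lemma v_sum: "(\<And>i. i \<in> A \<Longrightarrow> f i \<in> F) \<Longrightarrow> v (\<Sum>i\<in>A. f i) \<le> (\<Sum>i\<in>A. v (f i))"
proof (induction A rule: infinite_finite_induct)
  case (insert x A)
  have "v (f x + sum f A) \<le> v (f x) + v (sum f A)" using insert by (intro v_add sum_mem) auto
  thus ?case using insert by fastforce
qed auto

lemma power_int_mem: "x \<in> F \<Longrightarrow> x powi n \<in> F"
  by (cases n rule: int_cases4) (auto simp: power_int_minus)

lemma v_power_int: "x \<in> F \<Longrightarrow> v (x powi n) = v x powi n"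
  by (cases n rule: int_cases4) (auto simp: power_int_minus v_power v_inverse power_mem)

text \<open>Taking large powers removes the binomial coefficients that the triangle inequality
  leaves behind.\<close>
lemma ultrametric:
  assumes int: "\<And>n::nat. v (of_nat n) \<le> 1" and xy: "x \<in> F" "y \<in> F"
  shows "v (x + y) \<le> max (v x) (v y)"
proof -
  define M where "M = max (v x) (v y)"
  have M0: "M \<ge> 0" using v_nonneg[OF xy(1)] by (simp add: M_def)
  have bound: "v (x + y) ^ n \<le> real (Suc n) * M ^ n" for n
  proof -
    have "v (x + y) ^ n = v (\<Sum>i\<le>n. of_nat (n choose i) * x ^ i * y ^ (n - i))"
      using xy v_power[of "x + y" n] by (auto simp: binomial_ring add_mem)
    also have "\<dots> \<le> (\<Sum>i\<le>n. v (of_nat (n choose i) * x ^ i * y ^ (n - i)))"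
      using xy by (intro v_sum) auto
    also have "\<dots> \<le> (\<Sum>i\<le>n. M ^ n)"
    proof (intro sum_mono)
      fix i assume i: "i \<in> {..n}"
      have "v (of_nat (n choose i) * x ^ i * y ^ (n - i)) = v (of_nat (n choose i)) * (v x ^ i * v y ^ (n - i))"
        using xy by (simp add: v_mult v_power power_mem mult_mem)
      also have "\<dots> \<le> 1 * (M ^ i * M ^ (n - i))" using xy int M0
        by (intro mult_mono power_mono) (auto simp: M_def)
      also have "\<dots> = M ^ n" using i by (simp flip: power_add)
      finally show "v (of_nat (n choose i) * x ^ i * y ^ (n - i)) \<le> M ^ n" .
    qed
    finally show ?thesis by simp
  qed
  show ?thesis
  proof (rule ccontr)
    assume "\<not> ?thesis"
    hence gt: "v (x + y) > M" by (simp only: M_def not_le)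
    show False
    proof (cases "M = 0")
      case True
      thus False using bound[of 1] gt by simp
    next
      case False
      hence M: "M > 0" using M0 by simp
      define r where "r = M / v (x + y)"
      have r: "0 < r" "r < 1" using M gt by (auto simp: r_def)
      have ge: "1 \<le> real (Suc n) * r ^ n" for n
        using bound[of n] M gt by (simp add: r_def power_divide field_simps)
      have "(\<lambda>n. real n * r ^ n) \<longlonglongrightarrow> 0"
        using r by (intro powser_times_n_limit_0) auto
      moreover have "(\<lambda>n. r ^ n) \<longlonglongrightarrow> 0" using r by (intro LIMSEQ_power_zero) auto
      ultimately have "(\<lambda>n. real n * r ^ n + r ^ n) \<longlonglongrightarrow> 0 + 0" by (rule tendsto_add)
      hence "eventually (\<lambda>n. real n * r ^ n + r ^ n < 1) sequentially"
        by (simp add: order_tendsto_iff)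
      then obtain n where "real n * r ^ n + r ^ n < 1" by (auto simp: eventually_sequentially)
      thus False using ge[of n] by (simp add: algebra_simps)
    qed
  qed
qed

end

text \<open>Powers of a common large value can be inserted between two different values, so that two
  absolute values which agree on one such element are separated by the threshold 1.\<close>
lemma separate_two:
  assumes v: "abs_value_field F v" and w: "abs_value_field F w"
    and t: "t \<in> F" "v t = w t" "v t > 1" and x: "x \<in> F" "v x \<noteq> w x"
  shows "\<exists>y\<in>F. v y > 1 \<and> w y < 1"
proof -
  interpret v: abs_value_field F v by fact
  interpret w: abs_value_field F w by fact
  have x0: "x \<noteq> 0" using x by auto
  define a b where "a = ln (v x) / ln (v t)" and "b = ln (w x) / ln (v t)"
  have pos: "v x > 0" "w x > 0" using x0 x v.v_pos w.v_pos by auto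
  have lt: "ln (v t) > 0" using t by simp
  have "a \<noteq> b" using pos x lt by (simp add: a_def b_def)
  have key: "\<exists>y\<in>F. (v y > 1 \<and> w y < 1) \<or> (v y < 1 \<and> w y > 1)"
  proof -
    obtain q :: rat where q: "min a b < of_rat q" "of_rat q < max a b"
      using of_rat_dense[of "min a b" "max a b"] \<open>a \<noteq> b\<close> by fastforce
    obtain n d :: int where nd: "q = of_int n / of_int d" "d > 0"
      by (metis quotient_of_denom_pos quotient_of_div surj_pair)
    define y where "y = x powi d * t powi (-n)"
    have y: "y \<in> F" using x t v.power_int_mem by (auto simp: y_def)
    have ln_pi: "ln (r powi i) = of_int i * ln r" if "r > 0" for r :: real and i
      using that by (cases i rule: int_cases4) (auto simp: power_int_minus ln_inverse ln_realpow)
    have val: "ln (v y) = d * ln (v x) - n * ln (v t)" "ln (w y) = d * ln (w x) - n * ln (v t)"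
      using x t pos by (simp_all add: y_def v.v_mult v.power_int_mem v.v_power_int w.v_mult w.v_power_int
        ln_mult_pos ln_pi del: power_int_minus)
    have val': "ln (v y) = d * ln (v t) * (a - of_rat q)" "ln (w y) = d * ln (v t) * (b - of_rat q)"
    proof -
      have q': "real_of_rat q = of_int n / of_int d" using nd by (simp add: of_rat_divide)
      show "ln (v y) = d * ln (v t) * (a - of_rat q)" "ln (w y) = d * ln (v t) * (b - of_rat q)"
        unfolding q' using lt nd(2) by (simp_all add: val a_def b_def field_simps)
    qed
    have "t \<noteq> 0" using t(3) by auto
    hence y0: "v y > 0" "w y > 0" using y x0 t v.v_pos[of y] w.v_pos[of y] by (auto simp: y_def)
    have c: "real_of_int d * ln (v t) > 0" using nd lt by simp
    have "(ln (v y) > 0 \<and> ln (w y) < 0) \<or> (ln (v y) < 0 \<and> ln (w y) > 0)"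
    proof (cases "a < b")
      case True
      hence "a - of_rat q < 0" "b - of_rat q > 0" using q by auto
      thus ?thesis unfolding val' using c by (simp add: mult_less_0_iff)
    next
      case False
      hence "a - of_rat q > 0" "b - of_rat q < 0" using q by auto
      thus ?thesis unfolding val' using c by (simp add: mult_less_0_iff)
    qed
    thus ?thesis using y y0 by auto
  qed
  then obtain y where y: "y \<in> F" "(v y > 1 \<and> w y < 1) \<or> (v y < 1 \<and> w y > 1)" by blast
  show ?thesis
  proof (cases "v y > 1")
    case True thus ?thesis using y by auto
  next
    case False
    hence vw: "v y < 1" "w y > 1" using y by auto
    hence "y \<noteq> 0" by auto
    hence "v y > 0" using v.v_pos y by auto
    thus ?thesis using y vw by (intro bexI[of _ "inverse y"])
      (auto simp: v.v_inverse w.v_inverse one_less_inverse_iff inverse_less_1_iff)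
  qed
qed

text \<open>Induction on the number of places. An element that is good for all but the last place is
  corrected at the last one by an element separating two places.\<close>
theorem artin_whaples:
  assumes v: "abs_value_field F v" and S: "finite S" "\<And>w. w \<in> S \<Longrightarrow> abs_value_field F w"
    and t: "t \<in> F" "v t > 1" "\<And>w. w \<in> S \<Longrightarrow> w t = v t"
    and ne: "\<And>w. w \<in> S \<Longrightarrow> \<exists>x\<in>F. w x \<noteq> v x"
  shows "\<exists>x\<in>F. v x > 1 \<and> (\<forall>w\<in>S. w x < 1)"
  using S t(3) ne
proof (induction S rule: finite_induct)
  case empty
  thus ?case using t by auto
next
  case (insert w S)
  interpret v: abs_value_field F v by fact
  interpret w: abs_value_field F w using insert.prems by auto
  obtain x where x: "x \<in> F" "v x > 1" "\<forall>u\<in>S. u x < 1" using insert by auto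
  obtain y where y: "y \<in> F" "v y > 1" "w y < 1"
    using separate_two[OF v, of w t] insert.prems t by (metis insertI1)
  have avS: "abs_value_field F u" if "u \<in> S" for u using insert.prems that by auto
  have u_pow: "(\<lambda>n. u (x ^ n)) \<longlonglongrightarrow> 0" if "u \<in> S" for u
  proof -
    interpret u: abs_value_field F u using avS that by auto
    show ?thesis using x that u.v_nonneg[of x] by (simp add: u.v_power LIMSEQ_power_zero)
  qed
  consider "w x < 1" | "w x = 1" | "w x > 1" by linarith
  thus ?case
  proof cases
    case 1 thus ?thesis using x by auto
  next
    case 2
    have "eventually (\<lambda>n. u (x ^ n * y) < 1) sequentially" if "u \<in> S" for u
    proof -
      interpret u: abs_value_field F u using avS that by auto
      have "(\<lambda>n. u (x ^ n) * u y) \<longlonglongrightarrow> 0 * u y" by (intro tendsto_intros u_pow that)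
      hence "(\<lambda>n. u (x ^ n * y)) \<longlonglongrightarrow> 0" using x y by (simp add: u.v_mult v.power_mem)
      thus ?thesis by (rule order_tendstoD) simp
    qed
    hence "eventually (\<lambda>n. \<forall>u\<in>S. u (x ^ n * y) < 1) sequentially"
      using insert.hyps by (intro eventually_ball_finite) auto
    then obtain n where n: "\<forall>u\<in>S. u (x ^ n * y) < 1" by (auto simp: eventually_sequentially)
    have "v x ^ n \<ge> 1" using x by simp
    hence "1 * 1 < v x ^ n * v y" using y by (intro mult_le_less_imp_less) auto
    hence "v (x ^ n * y) > 1" using x y by (simp add: v.v_mult v.v_power v.power_mem)
    moreover have "w (x ^ n * y) < 1" using 2 x y by (simp add: w.v_mult w.v_power v.power_mem)
    ultimately show ?thesis using n x y by (intro bexI[of _ "x ^ n * y"]) auto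
  next
    case 3
    define z where "z = (\<lambda>n. x ^ n / (1 + x ^ n))"
    have zF: "z n \<in> F" for n using x by (auto simp: z_def)
    \<comment> \<open>The sequence \<open>x^n / (1 + x^n)\<close> tends to 1 where \<open>x\<close> is large and to 0 where \<open>x\<close> is small.\<close>
    have lim1: "(\<lambda>n. u (z n)) \<longlonglongrightarrow> 1" if u: "abs_value_field F u" "u x > 1" for u
    proof -
      interpret u: abs_value_field F u by fact
      have "(\<lambda>n. 1 / (u x ^ n - 1)) \<longlonglongrightarrow> 0" proof -
        have "(\<lambda>n. inverse (u x) ^ n / (1 - inverse (u x) ^ n)) \<longlonglongrightarrow> 0 / (1 - 0)"
          using u(2) by (intro tendsto_intros LIMSEQ_power_zero) (auto simp: inverse_less_1_iff)
        moreover have "inverse (u x) ^ n / (1 - inverse (u x) ^ n) = 1 / (u x ^ n - 1)" for n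
          using u(2) by (simp add: field_simps power_inverse)
        ultimately show ?thesis by simp
      qed
      moreover have "eventually (\<lambda>n. \<bar>u (z n) - 1\<bar> \<le> 1 / (u x ^ n - 1)) sequentially"
        using eventually_gt_at_top[of 0]
      proof eventually_elim
        case (elim n)
        have gt: "u x ^ n > 1" using u(2) elim by simp
        have ge: "u (1 + x ^ n) \<ge> u x ^ n - 1"
          using u.v_diff[of "1 + x ^ n" 1] x by (auto simp: u.v_power v.add_mem v.power_mem)
        hence nz: "1 + x ^ n \<noteq> 0" using gt by auto
        have "z n - 1 = - (1 / (1 + x ^ n))" using nz by (simp add: z_def field_simps)
        hence "u (z n - 1) = 1 / u (1 + x ^ n)" using x
          by (simp add: u.v_minus u.v_divide v.add_mem v.power_mem v.divide_mem)
        also have "\<dots> \<le> 1 / (u x ^ n - 1)" using ge gt by (intro divide_left_mono) (auto intro!: mult_pos_pos)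
        finally show ?case using u.v_diff_ge[OF zF[of n] v.one_mem] by simp
      qed
      ultimately have "(\<lambda>n. u (z n) - 1) \<longlonglongrightarrow> 0"
        by (elim tendsto_0_le[where K = 1]) (auto elim!: eventually_mono, smt (verit) divide_nonpos_pos zero_less_divide_iff divide_less_0_iff)
      thus ?thesis by (simp add: LIM_zero_iff)
    qed
    have "eventually (\<lambda>n. u (z n * y) < 1) sequentially" if "u \<in> S" for u
    proof -
      interpret u: abs_value_field F u using avS that by auto
      have lim: "(\<lambda>n. u x ^ n / (1 - u x ^ n) * u y) \<longlonglongrightarrow> 0 / (1 - 0) * u y"
        using x that u.v_nonneg[OF x(1)] by (intro tendsto_intros LIMSEQ_power_zero) auto
      hence "eventually (\<lambda>n. u x ^ n / (1 - u x ^ n) * u y < 1) sequentially"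
        by (intro order_tendstoD(2)[OF lim]) auto
      thus ?thesis using eventually_gt_at_top[of 0]
      proof eventually_elim
        case (elim n)
        have lt: "u x ^ n < 1" using x that u.v_nonneg[OF x(1)] elim(2) by (simp add: power_less_one_iff)
        have ge: "u (1 + x ^ n) \<ge> 1 - u x ^ n"
          using u.v_diff[of "1 + x ^ n" "x ^ n"] x by (auto simp: u.v_power v.add_mem v.power_mem)
        have "u (z n) = u x ^ n / u (1 + x ^ n)" using x
          by (simp add: z_def u.v_divide u.v_power v.add_mem v.power_mem)
        also have "\<dots> \<le> u x ^ n / (1 - u x ^ n)" using ge lt x
          by (intro divide_left_mono mult_pos_pos) auto
        finally have "u (z n) * u y \<le> u x ^ n / (1 - u x ^ n) * u y" using y
          by (intro mult_right_mono) auto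
        hence "u (z n * y) \<le> u x ^ n / (1 - u x ^ n) * u y" using y zF by (simp add: u.v_mult)
        thus ?case using elim(1) by simp
      qed
    qed
    hence e1: "eventually (\<lambda>n. \<forall>u\<in>S. u (z n * y) < 1) sequentially"
      using insert.hyps by (intro eventually_ball_finite) auto
    have "(\<lambda>n. v (z n) * v y) \<longlonglongrightarrow> 1 * v y" using x lim1[OF v] by (intro tendsto_intros) auto
    hence e2: "eventually (\<lambda>n. v (z n) * v y > 1) sequentially" using y by (intro order_tendstoD(1)) auto
    have "(\<lambda>n. w (z n) * w y) \<longlonglongrightarrow> 1 * w y"
      using 3 lim1[OF w.abs_value_field_axioms] by (intro tendsto_intros) auto
    hence e3: "eventually (\<lambda>n. w (z n) * w y < 1) sequentially" using y by (intro order_tendstoD(2)) auto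
    obtain n where "\<forall>u\<in>S. u (z n * y) < 1" "v (z n) * v y > 1" "w (z n) * w y < 1"
      using eventually_conj[OF e1 eventually_conj[OF e2 e3]] by (auto simp: eventually_sequentially)
    thus ?thesis using zF y by (intro bexI[of _ "z n * y"]) (auto simp: v.v_mult w.v_mult)
  qed
qed

section \<open>The p-adic absolute value on the rationals\<close>

lemma padic_abs_Fract:
  assumes p: "prime p" and ab: "a \<noteq> 0" "b \<noteq> 0"
  shows "padic_abs p (Rat.Fract a b) = real p powi (int (multiplicity (int p) b) - int (multiplicity (int p) a))"
proof -
  obtain n d where nd: "quotient_of (Rat.Fract a b) = (n, d)" by fastforce
  have d: "d > 0" using quotient_of_denom_pos[OF nd] .
  have eq: "Rat.Fract a b = of_int n / of_int d" using quotient_of_div[OF nd] .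
  have n: "n \<noteq> 0" using eq ab by (auto simp: Fract_of_int_quotient)
  have "of_int (n * b) = (of_int (a * d) :: rat)" using eq ab d by (simp add: Fract_of_int_quotient field_simps)
  hence "n * b = a * d" by (simp only: of_int_eq_iff)
  hence "multiplicity (int p) (n * b) = multiplicity (int p) (a * d)" by simp
  hence "multiplicity (int p) n + multiplicity (int p) b = multiplicity (int p) a + multiplicity (int p) d"
    using ab n d p by (subst (asm) (1 2) prime_elem_multiplicity_mult_distrib) auto
  hence "int (multiplicity (int p) d) - int (multiplicity (int p) n)
       = int (multiplicity (int p) b) - int (multiplicity (int p) a)" by linarith
  moreover have "Rat.Fract a b \<noteq> 0" using ab by (simp add: Fract_of_int_quotient)
  ultimately show ?thesis by (simp add: padic_abs_def nd)
qed

lemma padic_abs_0 [simp]: "padic_abs p 0 = 0"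
  by (simp add: padic_abs_def)

lemma padic_abs_of_int:
  assumes "prime p" "a \<noteq> 0"
  shows "padic_abs p (of_int a) = 1 / real p ^ multiplicity (int p) a"
  using padic_abs_Fract[OF assms(1), of a 1] assms
  by (simp add: Fract_of_int_eq[symmetric] power_int_minus inverse_eq_divide)

lemma padic_abs_nonneg: "padic_abs p x \<ge> 0"
  by (simp add: padic_abs_def)

lemma padic_abs_mult:
  assumes p: "prime p"
  shows "padic_abs p (x * y) = padic_abs p x * padic_abs p y"
proof (cases "x = 0 \<or> y = 0")
  case False
  obtain a b where x: "x = Rat.Fract a b" "b > 0" by (cases x) auto
  obtain c d where y: "y = Rat.Fract c d" "d > 0" by (cases y) auto
  have 0: "a \<noteq> 0" "c \<noteq> 0" using False x y by (auto simp: rat_number_collapse)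
  show ?thesis unfolding x(1) y(1) mult_rat using x y 0 p prime_gt_0_nat[OF p]
    by (simp add: padic_abs_Fract prime_elem_multiplicity_mult_distrib power_int_add[symmetric] algebra_simps)
qed auto

lemma padic_abs_1 [simp]: "prime p \<Longrightarrow> padic_abs p 1 = 1"
  using padic_abs_of_int[of p 1] by simp

lemma padic_abs_minus:
  assumes "prime p"
  shows "padic_abs p (- x) = padic_abs p x"
  using padic_abs_mult[OF assms, of "-1" x] padic_abs_of_int[OF assms, of "-1"] by simp

lemma padic_abs_ultrametric:
  assumes p: "prime p"
  shows "padic_abs p (x + y) \<le> max (padic_abs p x) (padic_abs p y)"
proof (cases "x = 0 \<or> y = 0 \<or> x + y = 0")
  case True
  thus ?thesis using padic_abs_nonneg[of p x] padic_abs_nonneg[of p y] by (auto simp: max_def)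
next
  case False
  obtain a b where x: "x = Rat.Fract a b" "b > 0" by (cases x) auto
  obtain c d where y: "y = Rat.Fract c d" "d > 0" by (cases y) auto
  have eq: "x = Rat.Fract (a * d) (b * d)" "y = Rat.Fract (c * b) (b * d)" "x + y = Rat.Fract (a * d + c * b) (b * d)"
    using x y by (auto simp: Fract_of_int_quotient field_simps)
  have 0: "a * d \<noteq> 0" "c * b \<noteq> 0" "b * d \<noteq> 0" "a * d + c * b \<noteq> 0"
    using False x y eq by (auto simp: rat_number_collapse)
  define k where "k = min (multiplicity (int p) (a * d)) (multiplicity (int p) (c * b))"
  have "int p ^ k dvd a * d + c * b"
    by (intro dvd_add) (auto simp: k_def multiplicity_dvd')
  hence "k \<le> multiplicity (int p) (a * d + c * b)" using 0 p
    by (intro multiplicity_geI) (auto simp: prime_elem_not_unit)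
  moreover have p1: "real p \<ge> 1" using prime_ge_1_nat[OF p] by simp
  ultimately have "real p powi (int (multiplicity (int p) (b * d)) - int (multiplicity (int p) (a * d + c * b)))
    \<le> real p powi (int (multiplicity (int p) (b * d)) - int k)"
    by (intro power_int_increasing) auto
  also have "\<dots> \<le> max (padic_abs p x) (padic_abs p y)"
    unfolding eq(1,2) using 0 p by (auto simp: padic_abs_Fract k_def min_def)
  finally show ?thesis unfolding eq(3) using 0 p by (simp add: padic_abs_Fract)
qed

lemma padic_abs_of_int_le_1: "prime p \<Longrightarrow> padic_abs p (of_int a) \<le> 1"
  using prime_ge_1_nat[of p] by (cases "a = 0") (auto simp: padic_abs_of_int)

lemma padic_abs_inverse_prime:
  assumes "prime p"
  shows "padic_abs p (1 / of_nat p) = real p"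
proof -
  have "padic_abs p (of_nat p) * padic_abs p (1 / of_nat p) = 1"
    using padic_abs_mult[OF assms, of "of_nat p" "1 / of_nat p"] assms prime_gt_0_nat[OF assms] by simp
  moreover have "padic_abs p (of_nat p) = 1 / real p"
    using padic_abs_of_int[OF assms, of "int p"] prime_gt_0_nat[OF assms] prime_gt_1_nat[OF assms]
      multiplicity_self[of "int p"] by (simp add: multiplicity_self)
  ultimately show ?thesis using prime_gt_0_nat[OF assms] by (simp add: field_simps)
qed

section \<open>The places of a number field\<close>

definition arch_places :: "complex set \<Rightarrow> (complex \<Rightarrow> real) set" where
  "arch_places F = {v \<in> places F. \<forall>q. v (of_rat q) = \<bar>of_rat q\<bar>}"

definition padic_places :: "nat \<Rightarrow> complex set \<Rightarrow> (complex \<Rightarrow> real) set" where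
  "padic_places p F = {v \<in> places F. \<forall>q. v (of_rat q) = padic_abs p q}"

lemma places_eq: "places F = arch_places F \<union> (\<Union>p\<in>{p. prime p}. padic_places p F)"
  by (auto simp: places_def arch_places_def padic_places_def)

lemma places_distinct:
  assumes "v \<in> places F" "w \<in> places F" "v \<noteq> w"
  shows "\<exists>x\<in>F. v x \<noteq> w x"
  using assms extensionalityI[of v F w] by (auto simp: places_def)

lemma places_abs_value_field: "complex_subfield F \<Longrightarrow> v \<in> places F \<Longrightarrow> abs_value_field F v"
  by (simp add: abs_value_field_def abs_value_field_axioms_def places_def)

lemma padic_place_ultrametric:
  assumes "complex_subfield F" "prime p" "v \<in> padic_places p F" "x \<in> F" "y \<in> F"
  shows "v (x + y) \<le> max (v x) (v y)"
proof (rule abs_value_field.ultrametric)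
  show "abs_value_field F v" using assms places_abs_value_field by (auto simp: padic_places_def)
  show "v (of_nat n) \<le> 1" for n
    using assms padic_abs_of_int_le_1[of p "int n"]
    by (auto simp: padic_places_def dest!: spec[of _ "of_nat n"])
qed fact+

lemma padic_place_sum:
  assumes F: "complex_subfield F" and "prime p" "v \<in> padic_places p F"
    and "finite A" "\<And>i. i \<in> A \<Longrightarrow> f i \<in> F" "\<And>i. i \<in> A \<Longrightarrow> v (f i) \<le> c" "0 \<le> c"
  shows "v (\<Sum>i\<in>A. f i) \<le> c"
  using assms(4-7)
proof (induction A rule: finite_induct)
  case empty
  thus ?case using abs_value_field.v_0[OF places_abs_value_field[OF F, of v]] assms(3,7) by (simp add: padic_places_def)
next
  case (insert x A)
  have "v (f x + sum f A) \<le> max (v (f x)) (v (sum f A))"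
    using insert complex_subfield.sum_mem[OF F, of A f]
    by (intro padic_place_ultrametric[OF F assms(2,3)]) auto
  thus ?case using insert by force
qed

text \<open>Elements separating the places over a prime are linearly independent over the rationals: at
  the place of the largest coefficient its term exceeds all the others.\<close>
lemma card_padic_places:
  assumes F: "complex_subfield F" and B: "finite B" "F \<subseteq> ratvs.span B"
    and p: "prime p"
    and S: "finite S" "S \<subseteq> padic_places p F"
  shows "card S \<le> card B"
proof -
  interpret complex_subfield F by fact
  have av: "abs_value_field F v" if "v \<in> S" for v
    using that S F by (auto simp: padic_places_def intro: places_abs_value_field)
  have rat: "v (of_rat q) = padic_abs p q" if "v \<in> S" for v q using that S by (auto simp: padic_places_def)
  have ex: "\<exists>x\<in>F. v x > 1 \<and> (\<forall>w\<in>S - {v}. w x < 1)" if v: "v \<in> S" for v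
  proof (rule artin_whaples[where t = "of_rat (1 / of_nat p)"])
    show "\<exists>x\<in>F. w x \<noteq> v x" if "w \<in> S - {v}" for w
      using that v S places_distinct[of w F v] by (auto simp: padic_places_def)
    show "v (of_rat (1 / rat_of_nat p)) > 1" using rat[OF v, of "1 / of_nat p"]
      prime_gt_1_nat[OF p] padic_abs_inverse_prime[OF p] by simp
    show "w (of_rat (1 / rat_of_nat p)) = v (of_rat (1 / rat_of_nat p))" if "w \<in> S - {v}" for w
    proof -
      have "w \<in> S" using that by simp
      thus ?thesis using rat[of w "1 / rat_of_nat p"] rat[OF v, of "1 / rat_of_nat p"] by simp
    qed
  qed (use S av v in auto)
  hence "\<forall>v\<in>S. \<exists>x. x \<in> F \<and> v x > 1 \<and> (\<forall>w\<in>S - {v}. w x < 1)" by blast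
  from bchoice[OF this] obtain sep where
    sep': "\<forall>v\<in>S. sep v \<in> F \<and> v (sep v) > 1 \<and> (\<forall>w\<in>S - {v}. w (sep v) < 1)" by blast
  have sep: "sep v \<in> F" "v (sep v) > 1" if "v \<in> S" for v
    using sep' that by auto
  have sep2: "w (sep v) < 1" if "v \<in> S" "w \<in> S" "w \<noteq> v" for v w
    using sep' that by auto
  have inj: "inj_on sep S"
  proof (rule inj_onI)
    fix v w assume "v \<in> S" "w \<in> S" "sep v = sep w"
    thus "v = w" using sep(2)[of v] sep2[of w v] by force
  qed
  have "ratvs.independent (sep ` S)"
  proof
    assume "ratvs.dependent (sep ` S)"
    moreover have "finite (sep ` S)" using S by auto
    ultimately obtain u x where ux: "x \<in> sep ` S" "u x \<noteq> 0" "(\<Sum>x\<in>sep ` S. of_rat (u x) * x) = 0"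
      using ratvs.dependent_finite[of "sep ` S"] by auto
    define c where "c = (\<lambda>v. u (sep v))"
    have sum0: "(\<Sum>v\<in>S. of_rat (c v) * sep v) = 0"
      using ux(3) by (simp add: sum.reindex[OF inj] c_def)
    have "\<exists>v\<in>S. c v \<noteq> 0" using ux by (auto simp: c_def)
    define M where "M = Max ((\<lambda>v. padic_abs p (c v)) ` S)"
    have "S \<noteq> {}" using \<open>\<exists>v\<in>S. c v \<noteq> 0\<close> by auto
    hence "M \<in> (\<lambda>v. padic_abs p (c v)) ` S" unfolding M_def using S by (intro Max_in) auto
    then obtain v where v: "v \<in> S" "M = padic_abs p (c v)" by auto
    have Mge: "padic_abs p (c w) \<le> M" if "w \<in> S" for w unfolding M_def using S that by auto
    have "M > 0"
    proof -
      obtain w where w: "w \<in> S" "c w \<noteq> 0" using \<open>\<exists>v\<in>S. c v \<noteq> 0\<close> by auto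
      have "padic_abs p (c w) > 0" using w prime_gt_0_nat[OF p] by (simp add: padic_abs_def)
      thus ?thesis using Mge[OF w(1)] by simp
    qed
    interpret v: abs_value_field F v using av v by auto
    have vS: "v \<in> padic_places p F" using v S by auto
    have "of_rat (c v) * sep v = - (\<Sum>w\<in>S - {v}. of_rat (c w) * sep w)"
      using sum0 S v by (subst (asm) sum.remove[of _ v]) (auto simp: add_eq_0_iff2)
    hence eq: "v (of_rat (c v) * sep v) = v (\<Sum>w\<in>S - {v}. of_rat (c w) * sep w)"
      using sep by (subst v.v_minus[symmetric]) (auto intro!: sum_mem)
    have "v (\<Sum>w\<in>S - {v}. of_rat (c w) * sep w) \<le> M"
    proof (rule padic_place_sum[OF F p vS])
      fix w assume w: "w \<in> S - {v}"
      have "v (of_rat (c w) * sep w) = padic_abs p (c w) * v (sep w)"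
        using w sep rat[OF v(1)] by (simp add: v.v_mult)
      also have "\<dots> \<le> M * 1" using w sep(1)[of w] sep2[of w v] v Mge[of w] \<open>M > 0\<close> by (intro mult_mono) auto
      finally show "v (of_rat (c w) * sep w) \<le> M" by simp
    qed (use S sep \<open>M > 0\<close> in auto)
    moreover have "v (of_rat (c v) * sep v) > M"
      using v sep \<open>M > 0\<close> rat[OF v(1)] by (simp add: v.v_mult)
    ultimately show False using eq by simp
  qed
  moreover have "sep ` S \<subseteq> ratvs.span B" using sep B by auto
  ultimately have "card (sep ` S) \<le> card B" using ratvs.independent_span_bound[OF B(1)] by auto
  thus ?thesis using inj by (simp add: card_image)
qed

lemma finite_padic_places:
  assumes "complex_subfield F" "finite B" "F \<subseteq> ratvs.span B" "prime p"
  shows "finite (padic_places p F)"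
proof (rule ccontr)
  assume "infinite (padic_places p F)"
  then obtain S where "S \<subseteq> padic_places p F" "finite S" "card S = Suc (card B)"
    using infinite_arbitrarily_large by metis
  thus False using card_padic_places[OF assms(1-4), of S] by auto
qed


subsection \<open>Conjugates and Archimedean places\<close>

lemma norm_of_rat: "cmod (of_rat q) = \<bar>of_rat q\<bar>"
  by (cases q) (simp add: of_rat_rat norm_divide)

text \<open>This is the embedding of \<open>\<rat>(\<alpha>)\<close> that sends \<open>\<alpha>\<close> to \<open>z\<close>, for a root \<open>z\<close> of the minimal
  polynomial; then the choice of \<open>p\<close> does not matter.\<close>
definition conj_map :: "complex \<Rightarrow> complex \<Rightarrow> complex \<Rightarrow> complex" where
  "conj_map \<alpha> z x = poly (SOME p. p \<in> polys_over \<rat> \<and> poly p \<alpha> = x) z"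

locale number_field =
  fixes \<alpha> :: complex and m :: "complex poly" and F :: "complex set"
  assumes minimal: "minimal_poly \<rat> \<alpha> m" and F_eq: "F = simple_ext \<rat> \<alpha>"
begin

sublocale Q: complex_subfield \<rat> by (rule complex_subfield_Rats)

sublocale complex_subfield F
  unfolding F_eq by (rule Q.simple_ext_subfield[OF minimal])

lemma m_props: "m \<in> polys_over \<rat>" "m \<noteq> 0" "poly m \<alpha> = 0" "lead_coeff m = 1"
  using minimal by (auto simp: minimal_poly_def)

lemma degree_pos: "degree m > 0"
  using minimal by (rule Q.minimal_poly_degree_pos)

lemma poly_in_F: "p \<in> polys_over \<rat> \<Longrightarrow> poly p \<alpha> \<in> F"
  by (auto simp: F_eq simple_ext_def)

lemma in_F_E: assumes "x \<in> F" obtains p where "p \<in> polys_over \<rat>" "x = poly p \<alpha>"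
  using assms by (auto simp: F_eq simple_ext_def)

lemma field_degree_F: "field_degree F = degree m"
  unfolding F_eq by (rule field_degree_simple_ext[OF minimal])

lemma ex_span: "\<exists>B. finite B \<and> card B \<le> degree m \<and> F \<subseteq> ratvs.span B"
  using simple_ext_span[OF complex_subfield_Rats minimal _ Rats_subset_span] by (auto simp: F_eq)

lemma conj_map_poly:
  assumes z: "poly m z = 0" and p: "p \<in> polys_over \<rat>"
  shows "conj_map \<alpha> z (poly p \<alpha>) = poly p z"
proof -
  define p' where "p' = (SOME p'. p' \<in> polys_over \<rat> \<and> poly p' \<alpha> = poly p \<alpha>)"
  have p': "p' \<in> polys_over \<rat> \<and> poly p' \<alpha> = poly p \<alpha>" unfolding p'_def using p by (intro someI) auto
  have "p' - p \<in> polys_over \<rat>" "poly (p' - p) \<alpha> = 0" using p p' by (auto intro: Q.polys_over_diff)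
  from Q.minimal_poly_dvd[OF minimal this] obtain q where "p' - p = m * q" by blast
  hence "poly (p' - p) z = 0" using z by simp
  thus ?thesis by (simp add: conj_map_def p'_def)
qed

definition conj_place :: "complex \<Rightarrow> complex \<Rightarrow> real" where
  "conj_place z = restrict (\<lambda>x. cmod (conj_map \<alpha> z x)) F"

lemma conj_place_poly:
  assumes "poly m z = 0" "p \<in> polys_over \<rat>"
  shows "conj_place z (poly p \<alpha>) = cmod (poly p z)"
  using assms by (simp add: conj_place_def poly_in_F conj_map_poly)

lemma conj_place_rat: assumes "poly m z = 0" shows "conj_place z (of_rat q) = \<bar>of_rat q\<bar>"
proof -
  have "conj_place z (poly [:of_rat q:] \<alpha>) = cmod (poly [:of_rat q:] z)"
    using assms by (intro conj_place_poly) (auto intro!: Q.polys_over_closed)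
  thus ?thesis by (simp add: norm_of_rat)
qed

lemma conj_place_arch:
  assumes z: "poly m z = 0"
  shows "conj_place z \<in> arch_places F"
proof -
  have "absolute_value F (conj_place z)"
    unfolding absolute_value_def
  proof (intro conjI ballI)
    fix x assume "x \<in> F"
    then obtain p where p: "p \<in> polys_over \<rat>" "x = poly p \<alpha>" by (rule in_F_E)
    show "0 \<le> conj_place z x" by (simp add: p conj_place_poly[OF z])
    show "conj_place z x = 0 \<longleftrightarrow> x = 0"
    proof
      assume "conj_place z x = 0"
      hence "poly p z = 0" by (simp add: p conj_place_poly[OF z])
      from Q.minimal_poly_dvd[OF Q.minimal_poly_conjugate[OF minimal z] p(1) this]
      show "x = 0" using p m_props by auto
    next
      assume "x = 0"
      thus "conj_place z x = 0" using conj_place_rat[OF z, of 0] by simp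
    qed
    fix y assume "y \<in> F"
    then obtain q where q: "q \<in> polys_over \<rat>" "y = poly q \<alpha>" by (rule in_F_E)
    show "conj_place z (x * y) = conj_place z x * conj_place z y"
      using conj_place_poly[OF z Q.polys_over_mult[OF p(1) q(1)]]
      by (simp add: p q conj_place_poly[OF z] norm_mult)
    show "conj_place z (x + y) \<le> conj_place z x + conj_place z y"
      using conj_place_poly[OF z Q.polys_over_add[OF p(1) q(1)]]
      by (simp add: p q conj_place_poly[OF z] norm_triangle_ineq)
  qed
  thus ?thesis using conj_place_rat[OF z] by (simp add: arch_places_def places_def conj_place_def)
qed

text \<open>The Lagrange basis bounds the coefficients of a polynomial of degree less than \<open>degree m\<close>
  by its values at the roots of \<open>m\<close>.\<close>
lemma value_bound_from_conjugates:
  assumes v: "abs_value_field F v" and rat: "\<And>q. v (of_rat q) = \<bar>of_rat q\<bar>"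
  shows "\<exists>C. \<forall>p\<in>polys_over \<rat>. (\<forall>z. poly m z = 0 \<longrightarrow> cmod (poly p z) \<le> 1) \<longrightarrow> v (poly p \<alpha>) \<le> C"
proof -
  interpret v: abs_value_field F v by fact
  define R where "R = {z. poly m z = 0}"
  have R: "finite R" "card R = degree m" using Q.minimal_poly_roots[OF minimal] by (auto simp: R_def)
  define L where "L = (\<lambda>z. \<Prod>w\<in>R - {z}. [:-w, 1:])"
  have Lz: "poly (L z) z \<noteq> 0" if "z \<in> R" for z using R by (auto simp: L_def poly_prod)
  have Lw: "poly (L z) w = 0" if "w \<in> R" "w \<noteq> z" for z w using R that by (auto simp: L_def poly_prod)
  have Ldeg: "degree (L z) < degree m" if "z \<in> R" for z
    using that R degree_pos by (simp add: L_def degree_prod_sum_eq card_Diff_singleton)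
  define c where "c = (\<lambda>i. \<Sum>z\<in>R. cmod (coeff (L z) i) / cmod (poly (L z) z))"
  define C where "C = (\<Sum>i<degree m. c i * v \<alpha> ^ i)"
  have "v (poly p \<alpha>) \<le> C" if p: "p \<in> polys_over \<rat>" "\<forall>z. poly m z = 0 \<longrightarrow> cmod (poly p z) \<le> 1" for p
  proof -
    from Q.polys_over_division[OF m_props(1,2) p(1)] obtain q r where
      qr: "q \<in> polys_over \<rat>" "r \<in> polys_over \<rat>" "p = m * q + r" "r = 0 \<or> degree r < degree m" by blast
    have rdeg: "degree r < degree m" using qr degree_pos by auto
    have pr: "poly p z = poly r z" if "poly m z = 0" for z using qr that by simp
    have rR: "cmod (poly r z) \<le> 1" if "z \<in> R" for z using p pr that by (auto simp: R_def)
    define r' where "r' = (\<Sum>z\<in>R. smult (poly r z / poly (L z) z) (L z))"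
    have "r = r'"
    proof (rule poly_eqI_degree[of R])
      fix z assume z: "z \<in> R"
      have "poly r' z = (\<Sum>w\<in>R. poly r w / poly (L w) w * poly (L w) z)" by (simp add: r'_def poly_sum)
      also have "\<dots> = (\<Sum>w\<in>R. if w = z then poly r z else 0)"
        using z Lz Lw by (intro sum.cong) auto
      finally show "poly r z = poly r' z" using z R by simp
    next
      show "degree r < card R" using rdeg R by simp
      have "degree r' \<le> degree m - 1" unfolding r'_def
      proof (rule degree_sum_le)
        fix z assume "z \<in> R"
        thus "degree (smult (poly r z / poly (L z) z) (L z)) \<le> degree m - 1"
          using Ldeg[of z] by (intro order.trans[OF degree_smult_le]) auto
      qed (use R in auto)
      thus "degree r' < card R" using R degree_pos by simp
    qed
    have cf: "v (coeff r i) \<le> c i" for i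
    proof -
      obtain s where s: "coeff r i = of_rat s" using polys_overD[OF qr(2)] by (auto elim: Rats_cases)
      hence "v (coeff r i) = cmod (coeff r i)" using rat by (simp add: norm_of_rat)
      also have "cmod (coeff r i) = cmod (\<Sum>z\<in>R. poly r z / poly (L z) z * coeff (L z) i)"
        by (subst \<open>r = r'\<close>) (simp add: r'_def coeff_sum)
      also have "\<dots> \<le> (\<Sum>z\<in>R. 1 / cmod (poly (L z) z) * cmod (coeff (L z) i))"
        using rR by (intro sum_norm_le) (auto simp: norm_mult norm_divide intro!: mult_left_le_one_le divide_right_mono)
      also have "\<dots> = c i" by (simp add: c_def)
      finally show ?thesis .
    qed
    have aF: "\<alpha> \<in> F" unfolding F_eq by (rule Q.simple_ext_generator)
    have rF: "coeff r i \<in> F" for i using polys_overD[OF qr(2), of i] Rats_subset by auto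
    have "poly p \<alpha> = poly r \<alpha>" using pr m_props by auto
    also have "\<dots> = (\<Sum>i<degree m. coeff r i * \<alpha> ^ i)"
      unfolding poly_altdef using rdeg by (intro sum.mono_neutral_left) (auto simp: coeff_eq_0)
    also have "v \<dots> \<le> (\<Sum>i<degree m. v (coeff r i * \<alpha> ^ i))" using aF rF by (intro v.v_sum) auto
    also have "\<dots> \<le> C" unfolding C_def using aF rF cf
      by (intro sum_mono) (auto simp: v.v_mult v.v_power power_mem intro!: mult_right_mono)
    finally show ?thesis .
  qed
  thus ?thesis by blast
qed

text \<open>Otherwise some element is large at the given place and small at all conjugate embeddings,
  although the values of its powers are bounded by those at the embeddings.\<close>
theorem arch_place_is_conj:
  assumes v: "v \<in> arch_places F"
  shows "\<exists>z. poly m z = 0 \<and> v = conj_place z"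
proof (rule ccontr)
  assume neg: "\<not> ?thesis"
  have pl: "v \<in> places F" and rat: "\<And>q. v (of_rat q) = \<bar>of_rat q\<bar>" using v by (auto simp: arch_places_def)
  have av: "abs_value_field F v" by (rule places_abs_value_field[OF complex_subfield_axioms pl])
  interpret v: abs_value_field F v by fact
  define S where "S = conj_place ` {z. poly m z = 0}"
  have "\<exists>x\<in>F. v x > 1 \<and> (\<forall>w\<in>S. w x < 1)"
  proof (rule artin_whaples[OF av, where t = "of_rat 2"])
    show "finite S" using Q.minimal_poly_roots(1)[OF minimal] by (simp add: S_def)
    show "v (of_rat 2) > 1" using rat[of 2] by simp
    fix w assume "w \<in> S"
    then obtain z where z: "poly m z = 0" "w = conj_place z" by (auto simp: S_def)
    have wp: "w \<in> places F" using conj_place_arch[OF z(1)] z by (auto simp: arch_places_def)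
    show "abs_value_field F w" by (rule places_abs_value_field[OF complex_subfield_axioms wp])
    show "w (of_rat 2) = v (of_rat 2)" using rat[of 2] conj_place_rat[OF z(1), of 2] z by simp
    show "\<exists>x\<in>F. w x \<noteq> v x" using places_distinct[OF wp pl] neg z by auto
  qed (rule of_rat_mem)
  then obtain x where x: "x \<in> F" "v x > 1" "\<forall>w\<in>S. w x < 1" by blast
  then obtain p where p: "p \<in> polys_over \<rat>" "x = poly p \<alpha>" using in_F_E by blast
  obtain C where C: "\<And>p. p \<in> polys_over \<rat> \<Longrightarrow> (\<And>z. poly m z = 0 \<Longrightarrow> cmod (poly p z) \<le> 1) \<Longrightarrow> v (poly p \<alpha>) \<le> C"
    using value_bound_from_conjugates[OF av rat] by blast
  have "v x ^ n \<le> C" for n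
  proof -
    have "v (poly (p ^ n) \<alpha>) \<le> C"
    proof (rule C)
      fix z assume z: "poly m z = 0"
      have "cmod (poly p z) < 1" using x(3) z p conj_place_poly[OF z p(1)] by (auto simp: S_def)
      thus "cmod (poly (p ^ n) z) \<le> 1" by (simp add: poly_power norm_power power_le_one)
    qed (use p Q.polys_over_power in auto)
    thus ?thesis using p x by (simp add: poly_power v.v_power)
  qed
  moreover obtain n where "C < v x ^ n" using real_arch_pow[OF x(2)] by blast
  ultimately show False by (meson leD)
qed

lemma arch_places_eq: "arch_places F = conj_place ` {z. poly m z = 0}"
  using arch_place_is_conj conj_place_arch by auto

lemma finite_arch_places: "finite (arch_places F)"
  and card_arch_places: "card (arch_places F) \<le> degree m"
  using Q.minimal_poly_roots(1,2)[OF minimal] card_image_le[of "{z. poly m z = 0}" conj_place]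
  by (auto simp: arch_places_eq)

end

section \<open>Local degrees\<close>

definition v_cauchy :: "(complex \<Rightarrow> real) \<Rightarrow> (nat \<Rightarrow> complex) \<Rightarrow> bool" where
  "v_cauchy v s \<longleftrightarrow> (\<forall>e>0. \<exists>N. \<forall>m\<ge>N. \<forall>n\<ge>N. v (s m - s n) < e)"

lemma cauchy_ring_simps [simp]:
  "s \<in> carrier (cauchy_ring F v) \<longleftrightarrow> range s \<subseteq> F \<and> v_cauchy v s"
  "s \<otimes>\<^bsub>cauchy_ring F v\<^esub> t = (\<lambda>n. s n * t n)"
  "s \<oplus>\<^bsub>cauchy_ring F v\<^esub> t = (\<lambda>n. s n + t n)"
  "\<one>\<^bsub>cauchy_ring F v\<^esub> = (\<lambda>n. 1)" "\<zero>\<^bsub>cauchy_ring F v\<^esub> = (\<lambda>n. 0)"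
  by (simp_all add: cauchy_ring_def v_cauchy_def)

context abs_value_field
begin

text \<open>All operations on Cauchy sequences, including termwise inversion and passing to coefficients
  of a linear combination, are controlled by this comparison.\<close>
lemma v_cauchy_diff_bound:
  assumes s: "v_cauchy v s" and t: "v_cauchy v t" and AB: "A \<ge> 0" "B \<ge> 0"
    and le: "\<And>m n. m \<ge> N0 \<Longrightarrow> n \<ge> N0 \<Longrightarrow> v (u m - u n) \<le> A * v (s m - s n) + B * v (t m - t n)"
  shows "v_cauchy v u"
  unfolding v_cauchy_def
proof (intro allI impI)
  fix e :: real assume e: "e > 0"
  define d where "d = e / (A + B + 1)"
  have d: "d > 0" using AB e by (simp add: d_def)
  obtain N1 where N1: "\<And>m n. m \<ge> N1 \<Longrightarrow> n \<ge> N1 \<Longrightarrow> v (s m - s n) < d" using s d unfolding v_cauchy_def by blast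
  obtain N2 where N2: "\<And>m n. m \<ge> N2 \<Longrightarrow> n \<ge> N2 \<Longrightarrow> v (t m - t n) < d" using t d unfolding v_cauchy_def by blast
  show "\<exists>N. \<forall>m\<ge>N. \<forall>n\<ge>N. v (u m - u n) < e"
  proof (intro exI[of _ "max N0 (max N1 N2)"] allI impI)
    fix m n assume mn: "m \<ge> max N0 (max N1 N2)" "n \<ge> max N0 (max N1 N2)"
    have "v (u m - u n) \<le> A * v (s m - s n) + B * v (t m - t n)" using mn by (intro le) auto
    also have "\<dots> \<le> A * d + B * d" using mn AB N1[of m n] N2[of m n] by (intro add_mono mult_left_mono) auto
    also have "\<dots> < (A + B + 1) * d" using d by (simp add: algebra_simps)
    also have "\<dots> = e" using AB by (simp add: d_def)
    finally show "v (u m - u n) < e" .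
  qed
qed

lemma v_cauchy_const: "v_cauchy v (\<lambda>n. c)"
  by (auto simp: v_cauchy_def)

lemma v_cauchy_bounded:
  assumes "range s \<subseteq> F" "v_cauchy v s"
  shows "\<exists>M>0. \<forall>n. v (s n) \<le> M"
proof -
  obtain N where N: "\<And>m n. m \<ge> N \<Longrightarrow> n \<ge> N \<Longrightarrow> v (s m - s n) < 1"
    using assms(2) unfolding v_cauchy_def by (metis zero_less_one)
  define M where "M = Max ((\<lambda>n. v (s n)) ` {..N}) + 1"
  have le: "v (s n) \<le> M - 1" if "n \<le> N" for n unfolding M_def using that by (simp add: Max_ge)
  have "v (s n) \<le> M" for n
  proof (cases "n \<le> N")
    case True thus ?thesis using le[of n] by simp
  next
    case False
    have "s n \<in> F" "s N \<in> F" using assms by auto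
    hence "\<bar>v (s n) - v (s N)\<bar> \<le> v (s n - s N)" by (rule v_diff_ge)
    thus ?thesis using N[of n N] le[of N] False by simp
  qed
  moreover have "M > 0" using le[of 0] v_nonneg[of "s 0"] assms(1) by fastforce
  ultimately show ?thesis by blast
qed

lemma v_cauchy_add:
  assumes "range s \<subseteq> F" "range t \<subseteq> F" "v_cauchy v s" "v_cauchy v t"
  shows "v_cauchy v (\<lambda>n. s n + t n)"
proof (rule v_cauchy_diff_bound[OF assms(3,4), of 1 1])
  fix m n
  have "s m \<in> F" "s n \<in> F" "t m \<in> F" "t n \<in> F" using assms(1,2) by auto
  hence "s m - s n \<in> F" "t m - t n \<in> F" by auto
  thus "v (s m + t m - (s n + t n)) \<le> 1 * v (s m - s n) + 1 * v (t m - t n)"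
    using v_add[of "s m - s n" "t m - t n"] by (simp add: algebra_simps)
qed auto

lemma v_cauchy_mult:
  assumes "range s \<subseteq> F" "range t \<subseteq> F" "v_cauchy v s" "v_cauchy v t"
  shows "v_cauchy v (\<lambda>n. s n * t n)"
proof -
  obtain A where A: "A > 0" "\<And>n. v (s n) \<le> A" using v_cauchy_bounded[OF assms(1,3)] by blast
  obtain B where B: "B > 0" "\<And>n. v (t n) \<le> B" using v_cauchy_bounded[OF assms(2,4)] by blast
  show ?thesis
  proof (rule v_cauchy_diff_bound[OF assms(3,4), of B A])
    fix m n
    have F: "s m \<in> F" "s n \<in> F" "t m \<in> F" "t n \<in> F" using assms(1,2) by auto
    have "s m * t m - s n * t n = t m * (s m - s n) + s n * (t m - t n)" by (simp add: algebra_simps)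
    hence "v (s m * t m - s n * t n) \<le> v (t m) * v (s m - s n) + v (s n) * v (t m - t n)"
      using F v_add[of "t m * (s m - s n)" "s n * (t m - t n)"] by (simp add: v_mult diff_mem mult_mem)
    also have "\<dots> \<le> B * v (s m - s n) + A * v (t m - t n)"
      using A B F by (intro add_mono mult_right_mono v_nonneg diff_mem) auto
    finally show "v (s m * t m - s n * t n) \<le> B * v (s m - s n) + A * v (t m - t n)" .
  qed (use A B in auto)
qed

lemma v_cauchy_uminus:
  assumes "range s \<subseteq> F" "v_cauchy v s"
  shows "v_cauchy v (\<lambda>n. - s n)"
proof -
  have "range (\<lambda>n. -1 :: complex) \<subseteq> F" by auto
  from v_cauchy_mult[OF this assms(1) v_cauchy_const assms(2)] show ?thesis by simp
qed

lemma cring_cauchy_ring: "cring (cauchy_ring F v)"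
proof (rule cringI)
  show "abelian_group (cauchy_ring F v)"
  proof (rule abelian_groupI)
    fix x assume x: "x \<in> carrier (cauchy_ring F v)"
    show "\<exists>y\<in>carrier (cauchy_ring F v). y \<oplus>\<^bsub>cauchy_ring F v\<^esub> x = \<zero>\<^bsub>cauchy_ring F v\<^esub>"
      using x by (intro bexI[of _ "\<lambda>n. - x n"]) (auto intro: v_cauchy_uminus)
  qed (auto intro: v_cauchy_const v_cauchy_add simp: algebra_simps)
  show "comm_monoid (cauchy_ring F v)"
    by (rule comm_monoidI) (auto intro: v_cauchy_const v_cauchy_mult simp: algebra_simps)
qed (auto simp: algebra_simps)

sublocale C: cring "cauchy_ring F v"
  by (rule cring_cauchy_ring)

lemma cauchy_ring_a_inv:
  assumes "s \<in> carrier (cauchy_ring F v)"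
  shows "\<ominus>\<^bsub>cauchy_ring F v\<^esub> s = (\<lambda>n. - s n)"
  using assms by (intro C.minus_equality) (auto intro: v_cauchy_uminus)

lemma null_ideal_iff:
  "s \<in> null_ideal F v \<longleftrightarrow> range s \<subseteq> F \<and> v_cauchy v s \<and> (\<lambda>n. v (s n)) \<longlonglongrightarrow> 0"
  by (auto simp: null_ideal_def)

lemma null_sequenceI:
  assumes "range s \<subseteq> F" "\<And>n. n \<ge> N \<Longrightarrow> v (s n) \<le> e n" "e \<longlonglongrightarrow> 0"
  shows "(\<lambda>n. v (s n)) \<longlonglongrightarrow> 0"
proof (rule real_tendsto_sandwich[OF _ _ tendsto_const assms(3)])
  show "eventually (\<lambda>n. 0 \<le> v (s n)) sequentially" using assms(1) by (intro always_eventually allI v_nonneg) auto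
  show "eventually (\<lambda>n. v (s n) \<le> e n) sequentially" using assms(2) by (auto simp: eventually_sequentially)
qed

lemma ideal_null_ideal: "ideal (null_ideal F v) (cauchy_ring F v)"
proof (rule idealI[OF C.ring_axioms])
  show "subgroup (null_ideal F v) (add_monoid (cauchy_ring F v))"
  proof (rule C.add.subgroupI)
    show "null_ideal F v \<subseteq> carrier (cauchy_ring F v)" by (auto simp: null_ideal_iff)
    have "(\<lambda>n. 0) \<in> null_ideal F v" by (auto simp: null_ideal_iff v_cauchy_const)
    thus "null_ideal F v \<noteq> {}" by blast
    fix a assume a: "a \<in> null_ideal F v"
    hence "\<And>n. a n \<in> F" by (auto simp: null_ideal_iff)
    thus "\<ominus>\<^bsub>cauchy_ring F v\<^esub> a \<in> null_ideal F v"
      using a by (subst cauchy_ring_a_inv) (auto simp: null_ideal_iff v_minus intro: v_cauchy_uminus)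
    fix b assume b: "b \<in> null_ideal F v"
    have F: "a n \<in> F" "b n \<in> F" for n using a b by (auto simp: null_ideal_iff)
    have "(\<lambda>n. v (a n) + v (b n)) \<longlonglongrightarrow> 0 + 0" using a b by (intro tendsto_add) (auto simp: null_ideal_iff)
    hence "(\<lambda>n. v (a n + b n)) \<longlonglongrightarrow> 0"
      using F v_add by (intro null_sequenceI[where N = 0 and e = "\<lambda>n. v (a n) + v (b n)"]) auto
    thus "a \<oplus>\<^bsub>cauchy_ring F v\<^esub> b \<in> null_ideal F v"
      using a b by (auto simp: null_ideal_iff intro: v_cauchy_add)
  qed
  show *: "x \<otimes>\<^bsub>cauchy_ring F v\<^esub> a \<in> null_ideal F v"
    if a: "a \<in> null_ideal F v" and x: "x \<in> carrier (cauchy_ring F v)" for a x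
  proof -
    obtain M where M: "M > 0" "\<And>n. v (x n) \<le> M" using v_cauchy_bounded[of x] x by auto
    have F: "a n \<in> F" "x n \<in> F" for n using a x by (auto simp: null_ideal_iff)
    have "(\<lambda>n. M * v (a n)) \<longlonglongrightarrow> M * 0" using a by (intro tendsto_intros) (auto simp: null_ideal_iff)
    hence "(\<lambda>n. v (x n * a n)) \<longlonglongrightarrow> 0"
      using F M by (intro null_sequenceI[where N = 0 and e = "\<lambda>n. M * v (a n)"]) (auto simp: v_mult intro!: mult_right_mono)
    thus ?thesis using a x by (auto simp: null_ideal_iff intro: v_cauchy_mult)
  qed
  show "a \<otimes>\<^bsub>cauchy_ring F v\<^esub> x \<in> null_ideal F v"
    if a: "a \<in> null_ideal F v" and x: "x \<in> carrier (cauchy_ring F v)" for a x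
    using *[OF that] by (simp add: mult.commute)
qed

sublocale I: ideal "null_ideal F v" "cauchy_ring F v"
  by (rule ideal_null_ideal)

sublocale Q: cring "completion F v"
  unfolding completion_def by (rule I.quotient_is_cring[OF cring_cauchy_ring])

definition v_class :: "(nat \<Rightarrow> complex) \<Rightarrow> (nat \<Rightarrow> complex) set" where
  "v_class s = null_ideal F v +>\<^bsub>cauchy_ring F v\<^esub> s"

lemma completion_carrier: "carrier (completion F v) = v_class ` carrier (cauchy_ring F v)"
  by (auto simp: completion_def FactRing_def A_RCOSETS_def' v_class_def)

lemma v_class_mult:
  "s \<in> carrier (cauchy_ring F v) \<Longrightarrow> t \<in> carrier (cauchy_ring F v) \<Longrightarrow>
     v_class s \<otimes>\<^bsub>completion F v\<^esub> v_class t = v_class (\<lambda>n. s n * t n)"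
  using I.rcoset_mult_add[of s t] by (simp add: completion_def FactRing_def v_class_def)

lemma v_class_add:
  "s \<in> carrier (cauchy_ring F v) \<Longrightarrow> t \<in> carrier (cauchy_ring F v) \<Longrightarrow>
     v_class s \<oplus>\<^bsub>completion F v\<^esub> v_class t = v_class (\<lambda>n. s n + t n)"
  using I.a_rcos_sum[of s t] by (simp add: completion_def FactRing_def v_class_def)

lemma completion_one: "\<one>\<^bsub>completion F v\<^esub> = v_class (\<lambda>n. 1)"
  by (simp add: completion_def FactRing_def v_class_def)

lemma v_class_eq_iff:
  assumes s: "s \<in> carrier (cauchy_ring F v)" and t: "t \<in> carrier (cauchy_ring F v)"
  shows "v_class s = v_class t \<longleftrightarrow> (\<lambda>n. v (s n - t n)) \<longlonglongrightarrow> 0"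
proof -
  have ca: "v_cauchy v (\<lambda>n. s n + - t n)"
    using s t v_cauchy_uminus[of t] by (intro v_cauchy_add) auto
  have "s \<ominus>\<^bsub>cauchy_ring F v\<^esub> t = (\<lambda>n. s n - t n)"
    using t by (simp add: a_minus_def cauchy_ring_a_inv)
  moreover have "(\<lambda>n. s n - t n) \<in> null_ideal F v \<longleftrightarrow> (\<lambda>n. v (s n - t n)) \<longlonglongrightarrow> 0"
    using s t ca by (auto simp: null_ideal_iff)
  ultimately show ?thesis
    using C.quotient_eq_iff_same_a_r_cos[OF ideal_null_ideal s t] by (simp add: v_class_def)
qed

lemma completion_zero: "\<zero>\<^bsub>completion F v\<^esub> = v_class (\<lambda>n. 0)"
proof -
  have "v_class (\<lambda>n. 0) \<oplus>\<^bsub>completion F v\<^esub> v_class (\<lambda>n. 0) = v_class (\<lambda>n. 0)"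
    by (subst v_class_add) (auto simp: v_cauchy_const)
  moreover have "v_class (\<lambda>n. 0) \<in> carrier (completion F v)"
    unfolding completion_carrier by (auto simp: v_cauchy_const intro!: imageI)
  ultimately show ?thesis using Q.add.r_cancel_one by fastforce
qed

lemma rat_carrier: "s \<in> carrier (cauchy_ring \<rat> v) \<Longrightarrow> s \<in> carrier (cauchy_ring F v)"
  using Rats_subset by auto

lemma rat_completion_eq: "rat_completion F v = v_class ` carrier (cauchy_ring \<rat> v)"
  by (simp add: rat_completion_def v_class_def)

text \<open>A rational Cauchy sequence that is not null is eventually bounded away from zero, so its
  termwise inverse is again Cauchy.\<close>
lemma rat_completion_inverse:
  assumes s: "s \<in> carrier (cauchy_ring \<rat> v)" and nz: "v_class s \<noteq> \<zero>\<^bsub>completion F v\<^esub>"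
  shows "\<exists>t\<in>carrier (cauchy_ring \<rat> v). v_class s \<otimes>\<^bsub>completion F v\<^esub> v_class t = \<one>\<^bsub>completion F v\<^esub>"
proof -
  have sC: "s \<in> carrier (cauchy_ring F v)" by (rule rat_carrier[OF s])
  have sF: "s n \<in> F" for n using sC by auto
  have 0: "(\<lambda>n. 0) \<in> carrier (cauchy_ring F v)" "(\<lambda>n. 1) \<in> carrier (cauchy_ring F v)"
    by (auto simp: v_cauchy_const)
  have "\<not> (\<lambda>n. v (s n)) \<longlonglongrightarrow> 0"
    using nz v_class_eq_iff[OF sC 0(1)] by (simp add: completion_zero)
  then obtain e where e: "e > 0" "\<And>N. \<exists>n\<ge>N. v (s n) \<ge> e"
    using sF by (auto simp: LIMSEQ_iff not_less)
  obtain N where N: "\<And>m n. m \<ge> N \<Longrightarrow> n \<ge> N \<Longrightarrow> v (s m - s n) < e / 2"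
    using s e(1) unfolding cauchy_ring_simps v_cauchy_def by (metis half_gt_zero)
  obtain n0 where n0: "n0 \<ge> N" "v (s n0) \<ge> e" using e(2) by blast
  have ge: "v (s n) \<ge> e / 2" if "n \<ge> N" for n
    using N[OF that n0(1)] v_diff_ge[OF sF[of n] sF[of n0]] n0 by linarith
  have nz': "s n \<noteq> 0" if "n \<ge> N" for n using ge[OF that] e(1) by auto
  define t where "t = (\<lambda>n. inverse (s n))"
  have "v_cauchy v t"
  proof (rule v_cauchy_diff_bound[where s = s and t = s and A = "4 / e^2" and B = 0 and ?N0.0 = N])
    fix m n assume mn: "m \<ge> N" "n \<ge> N"
    have "t m - t n = (s n - s m) / (s m * s n)" using nz' mn by (simp add: t_def field_simps)
    hence "v (t m - t n) = v (s m - s n) / (v (s m) * v (s n))"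
      using sF by (simp add: v_divide v_mult mult_mem diff_mem v_diff_commute[of "s n" "s m"])
    also have "\<dots> \<le> v (s m - s n) / (e / 2 * (e / 2))"
    proof (rule divide_left_mono)
      show "e / 2 * (e / 2) \<le> v (s m) * v (s n)" using ge mn e sF by (intro mult_mono) auto
      have "0 < v (s m) * v (s n)" using ge[OF mn(1)] ge[OF mn(2)] e(1) by (intro mult_pos_pos) linarith+
      thus "0 < v (s m) * v (s n) * (e / 2 * (e / 2))" using e(1) by simp
    qed (use sF diff_mem in auto)
    also have "\<dots> = 4 / e^2 * v (s m - s n) + 0 * v (s m - s n)" by (simp add: power2_eq_square)
    finally show "v (t m - t n) \<le> 4 / e^2 * v (s m - s n) + 0 * v (s m - s n)" .
  qed (use s in auto)
  moreover have "range t \<subseteq> \<rat>" using s by (auto simp: t_def)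
  ultimately have t: "t \<in> carrier (cauchy_ring \<rat> v)" by simp
  have tC: "t \<in> carrier (cauchy_ring F v)" by (rule rat_carrier[OF t])
  have "(\<lambda>n. v (s n * t n - 1)) \<longlonglongrightarrow> 0"
    using nz' by (intro tendsto_eventually) (auto simp: eventually_sequentially t_def intro!: exI[of _ N])
  hence "v_class (\<lambda>n. s n * t n) = v_class (\<lambda>n. 1)"
    using C.m_closed[OF sC tC] 0 by (subst v_class_eq_iff) auto
  thus ?thesis using t v_class_mult[OF sC tC] by (auto simp: completion_one)
qed


lemma subfield_rat_completion: "subfield (rat_completion F v) (completion F v)"
proof -
  define K where "K = rat_completion F v"
  have KI: "v_class s \<in> K" if "range s \<subseteq> \<rat>" "v_cauchy v s" for s
    using that by (auto simp: K_def rat_completion_eq)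
  have KE: "\<exists>s. range s \<subseteq> \<rat> \<and> v_cauchy v s \<and> x = v_class s" if "x \<in> K" for x
  proof -
    from that obtain s where "s \<in> carrier (cauchy_ring \<rat> v)" "x = v_class s"
      unfolding K_def rat_completion_eq by (rule imageE)
    thus ?thesis by (intro exI[of _ s]) simp
  qed
  have RF: "range s \<subseteq> F" if "range s \<subseteq> \<rat>" for s :: "nat \<Rightarrow> complex" using that Rats_subset by auto
  have sub: "K \<subseteq> carrier (completion F v)"
    using rat_carrier by (auto simp: K_def rat_completion_eq completion_carrier)
  have ring: "subring K (completion F v)"
  proof (rule Q.subringI[OF sub])
    show "\<one>\<^bsub>completion F v\<^esub> \<in> K" unfolding completion_one by (intro KI) (auto simp: v_cauchy_const)
  next
    fix x assume x: "x \<in> K"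
    then obtain s where s: "range s \<subseteq> \<rat>" "v_cauchy v s" "x = v_class s" using KE by blast
    have um: "range (\<lambda>n. - s n) \<subseteq> \<rat>" "v_cauchy v (\<lambda>n. - s n)"
      using s RF[of s] by (auto intro: v_cauchy_uminus)
    have "v_class (\<lambda>n. - s n) \<oplus>\<^bsub>completion F v\<^esub> x = \<zero>\<^bsub>completion F v\<^esub>"
      unfolding s(3) using s(1,2) um RF[OF s(1)] RF[OF um(1)] by (subst v_class_add) (simp_all add: completion_zero)
    hence "\<ominus>\<^bsub>completion F v\<^esub> x = v_class (\<lambda>n. - s n)"
      using sub x KI[OF um] by (intro Q.minus_equality) auto
    thus "\<ominus>\<^bsub>completion F v\<^esub> x \<in> K" using KI[OF um] by simp
  next
    fix x y assume xy: "x \<in> K" "y \<in> K"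
    obtain s where s: "range s \<subseteq> \<rat>" "v_cauchy v s" "x = v_class s" using KE xy by blast
    obtain t where t: "range t \<subseteq> \<rat>" "v_cauchy v t" "y = v_class t" using KE xy by blast
    have st: "s n \<in> \<rat>" "t n \<in> \<rat>" for n using s t by auto
    have "v_class (\<lambda>n. s n * t n) \<in> K" "v_class (\<lambda>n. s n + t n) \<in> K"
      using st by (auto intro!: KI v_cauchy_mult v_cauchy_add RF s t)
    thus "x \<otimes>\<^bsub>completion F v\<^esub> y \<in> K" "x \<oplus>\<^bsub>completion F v\<^esub> y \<in> K"
      unfolding s(3) t(3) using s(1,2) t(1,2) RF[OF s(1)] RF[OF t(1)] by (simp_all add: v_class_mult v_class_add)
  qed
  have nz: "\<one>\<^bsub>completion F v\<^esub> \<noteq> \<zero>\<^bsub>completion F v\<^esub>"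
    unfolding completion_one completion_zero
    by (subst v_class_eq_iff) (auto simp: v_cauchy_const LIMSEQ_const_iff)
  have "subfield K (completion F v)"
  proof (rule Q.subfieldI[OF Q.subcringI'[OF ring]])
    show "Units (completion F v\<lparr>carrier := K\<rparr>) = K - {\<zero>\<^bsub>completion F v\<^esub>}"
    proof (intro equalityI subsetI)
      fix x assume "x \<in> Units (completion F v\<lparr>carrier := K\<rparr>)"
      then obtain y where y: "x \<in> K" "y \<in> K" "x \<otimes>\<^bsub>completion F v\<^esub> y = \<one>\<^bsub>completion F v\<^esub>"
        by (auto simp: Units_def)
      have "y \<in> carrier (completion F v)" using y(2) sub by blast
      hence "x \<noteq> \<zero>\<^bsub>completion F v\<^esub>" using y(3) nz Q.l_null[of y] by metis
      thus "x \<in> K - {\<zero>\<^bsub>completion F v\<^esub>}" using y by simp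
    next
      fix x assume x: "x \<in> K - {\<zero>\<^bsub>completion F v\<^esub>}"
      then obtain s where s: "range s \<subseteq> \<rat>" "v_cauchy v s" "x = v_class s" using KE by blast
      have "s \<in> carrier (cauchy_ring \<rat> v)" "v_class s \<noteq> \<zero>\<^bsub>completion F v\<^esub>" using s x by simp_all
      from rat_completion_inverse[OF this] obtain t where t0: "t \<in> carrier (cauchy_ring \<rat> v)"
        "v_class s \<otimes>\<^bsub>completion F v\<^esub> v_class t = \<one>\<^bsub>completion F v\<^esub>" by (rule bexE)
      hence t: "range t \<subseteq> \<rat>" "v_cauchy v t"
        "x \<otimes>\<^bsub>completion F v\<^esub> v_class t = \<one>\<^bsub>completion F v\<^esub>" using s(3) by simp_all
      have tK: "v_class t \<in> K" using t(1,2) by (rule KI)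
      hence "v_class t \<otimes>\<^bsub>completion F v\<^esub> x = \<one>\<^bsub>completion F v\<^esub>"
        using x t(3) sub Q.m_comm[of x "v_class t"] by (simp add: subset_iff)
      thus "x \<in> Units (completion F v\<lparr>carrier := K\<rparr>)"
        unfolding Units_def using x t(3) tK by simp blast
    qed
  qed
  thus ?thesis by (simp add: K_def)
qed

subsection \<open>Families independent at a place\<close>

text \<open>A family is independent over the completed rationals iff the coefficients of its rational
  combinations are controlled by the value of the combination.\<close>
definition v_independent :: "nat \<Rightarrow> (nat \<Rightarrow> complex) \<Rightarrow> bool" where
  "v_independent r w \<longleftrightarrow> (\<forall>i<r. w i \<in> F) \<and>
     (\<exists>C\<ge>0. \<forall>a. (\<forall>i<r. a i \<in> \<rat>) \<longrightarrow> (\<forall>i<r. v (a i) \<le> C * v (\<Sum>i<r. a i * w i)))"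

lemma v_independentE:
  assumes "v_independent r w"
  obtains C where "C \<ge> 0" "\<And>a i. (\<And>i. i < r \<Longrightarrow> a i \<in> \<rat>) \<Longrightarrow> i < r \<Longrightarrow> v (a i) \<le> C * v (\<Sum>i<r. a i * w i)"
  using assms unfolding v_independent_def by metis

lemma v_independent_card:
  assumes B: "finite B" "F \<subseteq> ratvs.span B" and w: "v_independent r w"
  shows "r \<le> card B"
proof -
  obtain C where C: "C \<ge> 0" "\<And>a i. (\<And>i. i < r \<Longrightarrow> a i \<in> \<rat>) \<Longrightarrow> i < r \<Longrightarrow> v (a i) \<le> C * v (\<Sum>i<r. a i * w i)"
    using w by (rule v_independentE) blast
  have zero: "a i = 0" if "\<And>i. i < r \<Longrightarrow> a i \<in> \<rat>" "(\<Sum>i<r. a i * w i) = 0" "i < r" for a i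
  proof -
    have "v (a i) \<le> 0" using C(2)[of a i, OF that(1) that(3)] that(2) by simp
    moreover have "a i \<in> F" using that(1)[OF that(3)] Rats_subset by blast
    ultimately show ?thesis using v_pos[of "a i"] by linarith
  qed
  have inj: "inj_on w {..<r}"
  proof (rule inj_onI, rule ccontr)
    fix i j assume ij: "i \<in> {..<r}" "j \<in> {..<r}" "w i = w j" "i \<noteq> j"
    define a where "a = (\<lambda>l. if l = i then 1 else if l = j then -1 else 0 :: complex)"
    have "(\<Sum>l<r. a l * w l) = (\<Sum>l\<in>{i,j}. a l * w l)"
      using ij by (intro sum.mono_neutral_right) (auto simp: a_def)
    also have "\<dots> = 0" using ij by (simp add: a_def)
    finally have "a i = 0" using ij by (intro zero[of a i]) (simp_all add: a_def)
    thus False by (simp add: a_def)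
  qed
  have "ratvs.independent (w ` {..<r})"
  proof
    assume "ratvs.dependent (w ` {..<r})"
    then obtain u x where ux: "x \<in> w ` {..<r}" "u x \<noteq> 0" "(\<Sum>x\<in>w ` {..<r}. of_rat (u x) * x) = 0"
      using ratvs.dependent_finite[of "w ` {..<r}"] by auto
    from ux(1) obtain i where i: "i < r" "x = w i" by auto
    have "of_rat (u (w i)) = (0::complex)"
      using ux(3) i by (intro zero[of "\<lambda>i. of_rat (u (w i))" i]) (simp_all add: sum.reindex[OF inj])
    thus False using ux i by simp
  qed
  moreover have "w ` {..<r} \<subseteq> ratvs.span B" using w B by (auto simp: v_independent_def)
  ultimately have "card (w ` {..<r}) \<le> card B" using ratvs.independent_span_bound[OF B(1)] by auto
  thus ?thesis using inj by (simp add: card_image)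
qed

text \<open>The positive distance to the span bounds the new coefficient, and subtracting the new term
  reduces the other coefficients to the old family.\<close>
lemma v_independent_extend:
  assumes w: "v_independent r w" and x: "x \<in> F" and e: "e > 0"
    and far: "\<And>a. (\<And>i. i < r \<Longrightarrow> a i \<in> \<rat>) \<Longrightarrow> v (x - (\<Sum>i<r. a i * w i)) \<ge> e"
  shows "v_independent (Suc r) (w(r := x))"
proof -
  obtain C where C: "C \<ge> 0" "\<And>a i. (\<And>i. i < r \<Longrightarrow> a i \<in> \<rat>) \<Longrightarrow> i < r \<Longrightarrow> v (a i) \<le> C * v (\<Sum>i<r. a i * w i)"
    using w by (rule v_independentE) blast
  have wF: "w i \<in> F" if "i < r" for i using w that by (auto simp: v_independent_def)
  define D where "D = 1 / e + C * (1 + v x / e)"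
  have D: "D \<ge> 0" using C e x by (simp add: D_def)
  have "v (a i) \<le> D * v (\<Sum>i<Suc r. a i * (w(r := x)) i)" if a: "\<forall>i<Suc r. a i \<in> \<rat>" and i: "i < Suc r" for a i
  proof -
    have aF: "a i \<in> F" if "i < Suc r" for i using a that Rats_subset by blast
    define T where "T = (\<Sum>i<r. a i * w i)"
    have T: "T \<in> F" unfolding T_def by (intro sum_mem mult_mem aF wF) simp_all
    define U where "U = T + a r * x"
    have U: "U \<in> F" unfolding U_def using T aF[of r] x by (intro add_mem mult_mem) simp_all
    have Usum: "(\<Sum>i<Suc r. a i * (w(r := x)) i) = U" by (simp add: U_def T_def)
    have r: "v (a r) * e \<le> v U"
    proof (cases "a r = 0")
      case True thus ?thesis using U by simp
    next
      case False
      have "(\<Sum>i<r. (- a i / a r) * w i) = - (1 / a r) * T"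
        unfolding T_def sum_distrib_left by (intro sum.cong) auto
      hence "U = a r * (x - (\<Sum>i<r. (- a i / a r) * w i))"
        using False by (simp add: U_def field_simps)
      moreover have "v (x - (\<Sum>i<r. (- a i / a r) * w i)) \<ge> e" using a by (intro far Rats_divide Rats_minus_iff[THEN iffD2]) simp_all
      moreover have "x - (\<Sum>i<r. (- a i / a r) * w i) \<in> F"
        by (intro diff_mem sum_mem mult_mem divide_mem minus_mem x aF wF) simp_all
      ultimately show ?thesis using aF[of r] by (simp add: v_mult mult_left_mono)
    qed
    hence ar: "v (a r) \<le> v U / e" using e by (simp add: field_simps)
    show "v (a i) \<le> D * v (\<Sum>i<Suc r. a i * (w(r := x)) i)"
    proof (cases "i = r")
      case True
      have "1 / e \<le> D" using C(1) e x by (simp add: D_def)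
      hence "1 / e * v U \<le> D * v U" using U by (intro mult_right_mono) auto
      hence "v U / e \<le> D * v U" by simp
      thus ?thesis using ar True Usum by simp
    next
      case False
      hence "v (a i) \<le> C * v T" unfolding T_def using a i by (intro C(2)) simp_all
      also have "T = U - a r * x" by (simp add: U_def)
      also have "C * v (U - a r * x) \<le> C * (v U + v (a r) * v x)"
        using C(1) v_diff[of U "a r * x"] U aF[of r] x by (intro mult_left_mono) (auto simp: v_mult)
      also have "\<dots> \<le> C * (v U + (v U / e) * v x)" using C(1) ar x by (intro mult_left_mono add_left_mono mult_right_mono) simp_all
      also have "\<dots> = C * (1 + v x / e) * v U" by (simp add: algebra_simps)
      also have "\<dots> \<le> D * v U" using U e by (intro mult_right_mono) (auto simp: D_def)
      finally show ?thesis by (simp only: Usum)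
    qed
  qed
  moreover have "(w(r := x)) i \<in> F" if "i < Suc r" for i using wF[of i] x that by (cases "i = r") simp_all
  ultimately show ?thesis unfolding v_independent_def using D by blast
qed

text \<open>The rational span of a maximal independent family is dense in \<open>F\<close>, and independence makes the
  coefficients of approximating combinations Cauchy. So the classes of the family form a basis of
  the completion.\<close>
theorem local_degree_v_independent:
  assumes B: "finite B" "F \<subseteq> ratvs.span B"
  shows "\<exists>w. v_independent (local_degree F v) w \<and> local_degree F v > 0"
proof -
  define P where "P = (\<lambda>r. \<exists>w. v_independent r w)"
  define r where "r = Greatest P"
  have P1: "P 1" unfolding P_def v_independent_def
    by (intro exI[of _ "\<lambda>_. 1"] conjI exI[of _ 1]) auto
  have bound: "s \<le> card B" if "P s" for s using that v_independent_card[OF B] by (auto simp: P_def)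
  have Pr: "P r" unfolding r_def using P1 bound by (rule GreatestI_nat)
  have rge: "s \<le> r" if "P s" for s unfolding r_def using that bound by (rule Greatest_le_nat)
  have r0: "r > 0" using rge[OF P1] by simp
  obtain w where w: "v_independent r w" using Pr by (auto simp: P_def)
  obtain C where C: "C \<ge> 0" "\<And>a i. (\<And>i. i < r \<Longrightarrow> a i \<in> \<rat>) \<Longrightarrow> i < r \<Longrightarrow> v (a i) \<le> C * v (\<Sum>i<r. a i * w i)"
    using w by (rule v_independentE) blast
  have wF: "w i \<in> F" if "i < r" for i using w that by (auto simp: v_independent_def)
  have dense: "\<exists>a. (\<forall>i<r. a i \<in> \<rat>) \<and> v (x - (\<Sum>i<r. a i * w i)) < e" if "x \<in> F" "e > 0" for x e
  proof (rule ccontr)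
    assume "\<not> ?thesis"
    hence "v_independent (Suc r) (w(r := x))"
      using that by (intro v_independent_extend[OF w]) (auto simp: not_less)
    hence "Suc r \<le> r" by (intro rge) (auto simp: P_def)
    thus False by simp
  qed
  define comb where "comb = (\<lambda>j (a :: nat \<Rightarrow> nat \<Rightarrow> complex) n. \<Sum>i<j. a i n * w i)"
  define adm where "adm = (\<lambda>(j::nat) a. \<forall>i<j. a i \<in> carrier (cauchy_ring \<rat> v))"
  have cw: "(\<lambda>n. w i) \<in> carrier (cauchy_ring F v)" if "i < r" for i
    using wF[OF that] by (auto simp: v_cauchy_const)
  have comb_in: "comb j a \<in> carrier (cauchy_ring F v)" if "j \<le> r" "adm j a" for j a
    using that
  proof (induction j)
    case 0 show ?case by (simp add: comb_def v_cauchy_const)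
  next
    case (Suc j)
    have "a j \<in> carrier (cauchy_ring F v)" using Suc.prems rat_carrier by (auto simp: adm_def)
    hence "(\<lambda>n. comb j a n + a j n * w j) \<in> carrier (cauchy_ring F v)"
      using C.a_closed[OF Suc.IH C.m_closed[OF _ cw[of j]]] Suc.prems by (auto simp: adm_def)
    thus ?case by (simp add: comb_def)
  qed
  define E where "E = (\<lambda>j. {v_class (comb j a) |a. adm j a})"
  have E0: "E 0 = {\<zero>\<^bsub>completion F v\<^esub>}" by (auto simp: E_def comb_def adm_def completion_zero)
  have wC: "v_class (\<lambda>n. w j) \<in> carrier (completion F v)" if "j < r" for j
    using cw[OF that] by (auto simp: completion_carrier)
  have notin: "v_class (\<lambda>n. w j) \<notin> E j" if j: "j < r" for j
  proof
    assume "v_class (\<lambda>n. w j) \<in> E j"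
    then obtain a where a: "adm j a" "v_class (\<lambda>n. w j) = v_class (comb j a)" by (auto simp: E_def)
    hence lim: "(\<lambda>n. v (w j - comb j a n)) \<longlonglongrightarrow> 0"
      using v_class_eq_iff[OF cw[OF j] comb_in[OF _ a(1)]] j by simp
    have "1 \<le> C * v (w j - comb j a n)" for n
    proof -
      define b where "b = (\<lambda>i. if i = j then 1 else if i < j then - a i n else 0)"
      have "b i \<in> \<rat>" if "i < r" for i using a(1) by (auto simp: b_def adm_def)
      hence "v (b j) \<le> C * v (\<Sum>i<r. b i * w i)" using j by (intro C(2)) auto
      also have "(\<Sum>i<r. b i * w i) = (\<Sum>i<Suc j. b i * w i)"
        using j by (intro sum.mono_neutral_right) (auto simp: b_def)
      also have "\<dots> = w j - comb j a n" by (simp add: b_def comb_def sum_negf)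
      finally show ?thesis by (simp add: b_def)
    qed
    moreover have "(\<lambda>n. C * v (w j - comb j a n)) \<longlonglongrightarrow> C * 0" by (intro tendsto_intros lim)
    ultimately have "1 \<le> C * 0" by (intro tendsto_lowerbound[of _ "C*0" sequentially]) auto
    thus False by simp
  qed
  have step: "Q.line_extension (rat_completion F v) (v_class (\<lambda>n. w j)) (E j) = E (Suc j)" if j: "j < r" for j
  proof (intro equalityI subsetI)
    fix x assume "x \<in> Q.line_extension (rat_completion F v) (v_class (\<lambda>n. w j)) (E j)"
    then obtain s a where s: "s \<in> carrier (cauchy_ring \<rat> v)" "adm j a"
      "x = v_class s \<otimes>\<^bsub>completion F v\<^esub> v_class (\<lambda>n. w j) \<oplus>\<^bsub>completion F v\<^esub> v_class (comb j a)"
      by (auto simp: Q.line_extension_mem_iff E_def rat_completion_eq)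
    have sC: "s \<in> carrier (cauchy_ring F v)" by (rule rat_carrier[OF s(1)])
    have "x = v_class (\<lambda>n. s n * w j) \<oplus>\<^bsub>completion F v\<^esub> v_class (comb j a)"
      unfolding s(3) by (simp only: v_class_mult[OF sC cw[OF j]])
    also have "\<dots> = v_class (\<lambda>n. s n * w j + comb j a n)"
      using C.m_closed[OF sC cw[OF j]] comb_in[OF _ s(2)] j by (intro v_class_add) auto
    also have "(\<lambda>n. s n * w j + comb j a n) = comb (Suc j) (a(j := s))" by (simp add: comb_def add.commute)
    finally have "x = v_class (comb (Suc j) (a(j := s)))" .
    moreover have "adm (Suc j) (a(j := s))"
      unfolding adm_def
    proof (intro allI impI)
      fix i assume "i < Suc j"
      thus "(a(j := s)) i \<in> carrier (cauchy_ring \<rat> v)"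
        using s(1,2) by (cases "i = j") (simp_all add: adm_def)
    qed
    ultimately show "x \<in> E (Suc j)" unfolding E_def by blast
  next
    fix x assume "x \<in> E (Suc j)"
    then obtain a where a: "adm (Suc j) a" "x = v_class (comb (Suc j) a)" by (auto simp: E_def)
    have a': "adm j a" "a j \<in> carrier (cauchy_ring \<rat> v)" using a(1) by (auto simp: adm_def)
    have aC: "a j \<in> carrier (cauchy_ring F v)" by (rule rat_carrier[OF a'(2)])
    have "x = v_class (\<lambda>n. a j n * w j + comb j a n)" using a(2) by (simp add: comb_def add.commute)
    also have "\<dots> = v_class (\<lambda>n. a j n * w j) \<oplus>\<^bsub>completion F v\<^esub> v_class (comb j a)"
      using C.m_closed[OF aC cw[OF j]] comb_in[OF _ a'(1)] j by (intro v_class_add[symmetric]) auto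
    also have "\<dots> = v_class (a j) \<otimes>\<^bsub>completion F v\<^esub> v_class (\<lambda>n. w j) \<oplus>\<^bsub>completion F v\<^esub> v_class (comb j a)"
      by (simp only: v_class_mult[OF aC cw[OF j]])
    finally show "x \<in> Q.line_extension (rat_completion F v) (v_class (\<lambda>n. w j)) (E j)"
      using a' unfolding Q.line_extension_mem_iff E_def rat_completion_eq by blast
  qed
  have dims: "Q.dimension j (rat_completion F v) (E j)" if "j \<le> r" for j
    using that
  proof (induction j)
    case 0 show ?case unfolding E0 by (rule Q.zero_dim)
  next
    case (Suc j)
    thus ?case using Q.Suc_dim[OF wC notin, of j j "rat_completion F v"] step[of j] by simp
  qed
  have "E r = carrier (completion F v)"
  proof (intro equalityI subsetI)
    fix x assume "x \<in> E r"
    thus "x \<in> carrier (completion F v)" using comb_in by (auto simp: E_def completion_carrier)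
  next
    fix x assume "x \<in> carrier (completion F v)"
    then obtain s where s: "s \<in> carrier (cauchy_ring F v)" "x = v_class s" by (auto simp: completion_carrier)
    have sF: "s n \<in> F" for n using s by auto
    have "\<forall>n. \<exists>a. (\<forall>i<r. a i \<in> \<rat>) \<and> v (s n - (\<Sum>i<r. a i * w i)) < 1 / real (Suc n)"
      using dense sF by (simp add: sF)
    then obtain b where b: "\<And>n i. i < r \<Longrightarrow> b n i \<in> \<rat>" "\<And>n. v (s n - (\<Sum>i<r. b n i * w i)) < 1 / real (Suc n)"
      by metis
    define a where "a = (\<lambda>i n. b n i)"
    define d where "d = (\<lambda>n. s n - comb r a n)"
    have combF: "comb r a n \<in> F" for n
      using b(1) wF Rats_subset by (auto simp: comb_def a_def intro!: sum_mem mult_mem)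
    have dF: "d n \<in> F" for n using combF sF by (auto simp: d_def)
    have dle: "v (d n) \<le> 1 / real (Suc n)" for n using b(2)[of n] by (simp add: d_def comb_def a_def)
    have "(\<lambda>n. v (d n)) \<longlonglongrightarrow> 0"
      using dF dle LIMSEQ_inverse_real_of_nat
      by (intro null_sequenceI[where N = 0 and e = "\<lambda>n. inverse (real (Suc n))"]) (auto simp: inverse_eq_divide)
    have "v_cauchy v d"
      unfolding v_cauchy_def
    proof (intro allI impI)
      fix e :: real assume "e > 0"
      hence "eventually (\<lambda>n. v (d n) < e / 2) sequentially"
        using \<open>(\<lambda>n. v (d n)) \<longlonglongrightarrow> 0\<close> by (intro order_tendstoD(2)) auto
      then obtain N where N: "\<And>n. n \<ge> N \<Longrightarrow> v (d n) < e / 2" by (auto simp: eventually_sequentially)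
      show "\<exists>N. \<forall>m\<ge>N. \<forall>n\<ge>N. v (d m - d n) < e"
      proof (intro exI[of _ N] allI impI)
        fix m n assume "m \<ge> N" "n \<ge> N"
        thus "v (d m - d n) < e" using v_diff[OF dF[of m] dF[of n]] N[of m] N[of n] by linarith
      qed
    qed
    have "adm r a"
      unfolding adm_def
    proof (intro allI impI)
      fix i assume i: "i < r"
      have "v_cauchy v (a i)"
      proof (rule v_cauchy_diff_bound[where s = s and t = d and A = C and B = C and ?N0.0 = 0])
        fix m n
        have "v (a i m - a i n) \<le> C * v (\<Sum>i<r. (a i m - a i n) * w i)"
          using i b(1) by (intro C(2)) (auto simp: a_def)
        also have "(\<Sum>i<r. (a i m - a i n) * w i) = comb r a m - comb r a n"
          by (simp add: comb_def algebra_simps sum_subtractf)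
        also have "\<dots> = (s m - s n) - (d m - d n)" by (simp add: d_def)
        also have "C * v \<dots> \<le> C * (v (s m - s n) + v (d m - d n))"
          using C(1) sF dF by (intro mult_left_mono v_diff diff_mem) auto
        finally show "v (a i m - a i n) \<le> C * v (s m - s n) + C * v (d m - d n)" by (simp add: algebra_simps)
      qed (use s C \<open>v_cauchy v d\<close> in auto)
      thus "a i \<in> carrier (cauchy_ring \<rat> v)" using b(1) i by (auto simp: a_def)
    qed
    moreover have "v_class s = v_class (comb r a)"
      using v_class_eq_iff[OF s(1) comb_in[OF order_refl \<open>adm r a\<close>]] \<open>(\<lambda>n. v (d n)) \<longlonglongrightarrow> 0\<close>
      by (simp add: d_def)
    ultimately show "x \<in> E r" using s(2) by (auto simp: E_def)
  qed
  hence "Q.dimension r (rat_completion F v) (carrier (completion F v))" using dims[of r] by simp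
  hence "local_degree F v = r"
    using Q.dimI[OF subfield_rat_completion] by (simp add: local_degree_def over_def)
  thus ?thesis using w r0 by blast
qed

end

subsection \<open>Local degrees at Archimedean places\<close>

lemma three_complex_dependent:
  fixes u0 u1 u2 :: complex
  obtains b0 b1 b2 :: real where "b0 * u0 + b1 * u1 + b2 * u2 = 0" "b0 \<noteq> 0 \<or> b1 \<noteq> 0 \<or> b2 \<noteq> 0"
proof -
  consider "u0 = 0" | "u0 \<noteq> 0" "Im (u1 / u0) = 0" | "u0 \<noteq> 0" "Im (u1 / u0) \<noteq> 0" by blast
  thus ?thesis
  proof cases
    case 1
    thus ?thesis using that[of 1 0 0] by simp
  next
    case 2
    have "complex_of_real (Re (u1 / u0)) = u1 / u0" using 2 by (simp add: complex_eq_iff)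
    hence "u1 = complex_of_real (Re (u1 / u0)) * u0" using 2 by simp
    thus ?thesis using that[of "- Re (u1 / u0)" 1 0] by simp
  next
    case 3
    obtain t s where ts: "t = u1 / u0" "s = u2 / u0" by blast
    define y where "y = Im s / Im t"
    define x where "x = Re s - y * Re t"
    have "complex_of_real x + complex_of_real y * (u1 / u0) = u2 / u0"
      using 3(2) unfolding ts[symmetric] by (intro complex_eqI) (simp_all add: x_def y_def)
    hence "(complex_of_real x + complex_of_real y * (u1 / u0)) * u0 = u2" using 3 by simp
    moreover have "(complex_of_real x + complex_of_real y * (u1 / u0)) * u0
        = complex_of_real x * u0 + complex_of_real y * u1"
      using 3(1) by (simp add: distrib_right)
    ultimately show ?thesis using that[of x y "-1"] by simp
  qed
qed

context number_field
begin

lemma abs_value_field_place: "v \<in> places F \<Longrightarrow> abs_value_field F v"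
  by (rule places_abs_value_field[OF complex_subfield_axioms])

lemma local_degree_pos:
  assumes "v \<in> places F"
  shows "local_degree F v > 0"
proof -
  obtain B where B: "finite B" "F \<subseteq> ratvs.span B" using ex_span by blast
  show ?thesis
    using abs_value_field.local_degree_v_independent[OF abs_value_field_place[OF assms] B] by (elim exE conjE)
qed

text \<open>Rational approximations to a real linear relation between three complex numbers contradict
  independence.\<close>
lemma local_degree_arch:
  assumes v: "v \<in> arch_places F"
  shows "local_degree F v \<le> 2"
proof (rule ccontr)
  assume "\<not> ?thesis"
  hence r: "local_degree F v \<ge> 3" by simp
  have pl: "v \<in> places F" using v by (auto simp: arch_places_def)
  interpret v: abs_value_field F v by (rule abs_value_field_place[OF pl])
  obtain B where B: "finite B" "F \<subseteq> ratvs.span B" using ex_span by blast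
  obtain w where w: "v.v_independent (local_degree F v) w" using v.local_degree_v_independent[OF B] by blast
  define r where "r = local_degree F v"
  have wF: "w i \<in> F" if "i < r" for i using w that by (auto simp: v.v_independent_def r_def)
  obtain C where C: "C \<ge> 0" "\<And>a i. (\<And>i. i < r \<Longrightarrow> a i \<in> \<rat>) \<Longrightarrow> i < r \<Longrightarrow> v (a i) \<le> C * v (\<Sum>i<r. a i * w i)"
    using v.v_independentE[OF w] unfolding r_def by blast
  obtain z where z: "poly m z = 0" "v = conj_place z" using arch_place_is_conj[OF v] by blast
  have "\<forall>i<r. \<exists>p. p \<in> polys_over \<rat> \<and> w i = poly p \<alpha>" using wF in_F_E by metis
  then obtain p where p: "\<And>i. i < r \<Longrightarrow> p i \<in> polys_over \<rat>" "\<And>i. i < r \<Longrightarrow> w i = poly (p i) \<alpha>" by metis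
  define u where "u = (\<lambda>i. poly (p i) z)"
  have val: "\<bar>of_rat (a i)\<bar> \<le> C * cmod (\<Sum>i<3. of_rat (a i) * u i)" if "i < 3" for i and a :: "nat \<Rightarrow> rat"
  proof -
    define a' :: "nat \<Rightarrow> complex" where "a' = (\<lambda>i. if i < 3 then of_rat (a i) else 0)"
    define g where "g = (\<Sum>i<3. smult (of_rat (a i)) (p i))"
    have g: "g \<in> polys_over \<rat>" unfolding g_def using p r
      by (intro Q.polys_over_sum Q.polys_over_smult) (auto simp: r_def)
    have "(\<Sum>i<r. a' i * w i) = (\<Sum>i<3. a' i * w i)"
      using r by (intro sum.mono_neutral_right) (auto simp: a'_def r_def)
    also have "\<dots> = poly g \<alpha>" using p r by (auto simp: a'_def g_def poly_sum r_def intro!: sum.cong)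
    finally have "v (\<Sum>i<r. a' i * w i) = cmod (poly g z)" using conj_place_poly[OF z(1) g] z by simp
    also have "poly g z = (\<Sum>i<3. of_rat (a i) * u i)" by (simp add: g_def poly_sum u_def)
    finally have "v (a' i) \<le> C * cmod (\<Sum>i<3. of_rat (a i) * u i)"
      using C(2)[of a' i] that r by (auto simp: a'_def r_def)
    thus ?thesis using that conj_place_rat[OF z(1)] z by (simp add: a'_def)
  qed
  obtain b0 b1 b2 :: real where b: "complex_of_real b0 * u 0 + b1 * u 1 + b2 * u 2 = 0" "b0 \<noteq> 0 \<or> b1 \<noteq> 0 \<or> b2 \<noteq> 0"
    by (rule three_complex_dependent[of "u 0" "u 1" "u 2"])
  define b where "b = (\<lambda>i::nat. if i = 0 then b0 else if i = 1 then b1 else b2)"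
  have bsum: "(\<Sum>i<3. complex_of_real (b i) * u i) = 0" using b(1) by (simp add: b_def eval_nat_numeral)
  define M where "M = (\<Sum>i<3. cmod (u i))"
  have M: "M \<ge> 0" by (auto simp: M_def intro: sum_nonneg)
  have small: "\<bar>b i\<bar> \<le> (1 + C * M) * e" if e: "e > 0" and i: "i < 3" for i e
  proof -
    have "\<forall>j. \<exists>q::rat. b j < of_rat q \<and> of_rat q < b j + e" using e of_rat_dense by (metis less_add_same_cancel1)
    then obtain a :: "nat \<Rightarrow> rat" where a: "\<And>j. b j < of_rat (a j)" "\<And>j. of_rat (a j) < b j + e" by metis
    have ab: "\<bar>of_rat (a j) - b j\<bar> \<le> e" for j using a[of j] by simp
    have cr: "(of_rat (a j) :: complex) = complex_of_real (of_rat (a j))" for j by (cases "a j") (simp add: of_rat_rat)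
    have "(\<Sum>i<3. of_rat (a i) * u i) = (\<Sum>i<3. complex_of_real (of_rat (a i) - b i) * u i)"
      using bsum by (simp add: cr algebra_simps sum_subtractf)
    also have "cmod \<dots> \<le> (\<Sum>i<3. e * cmod (u i))"
      using ab by (intro sum_norm_le) (auto simp: norm_mult simp flip: of_real_diff intro!: mult_right_mono)
    also have "\<dots> = e * M" by (simp add: M_def sum_distrib_left)
    finally have "\<bar>of_rat (a i)\<bar> \<le> C * (e * M)" using val[OF i, of a] C(1) by (meson mult_left_mono order_trans)
    moreover have "(1 + C * M) * e = e + C * (e * M)" by (simp add: algebra_simps)
    ultimately show ?thesis using ab[of i] by linarith
  qed
  have "b i = 0" if "i < 3" for i
  proof (rule ccontr)
    assume "b i \<noteq> 0"
    define e where "e = \<bar>b i\<bar> / (2 * (1 + C * M))"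
    have pos: "1 + C * M > 0" using C M by (smt (verit) mult_nonneg_nonneg)
    have "e > 0" using pos \<open>b i \<noteq> 0\<close> by (simp add: e_def)
    have "q * (\<bar>b i\<bar> / (2 * q)) = \<bar>b i\<bar> / 2" if "q > 0" for q :: real using that by simp
    from small[OF \<open>e > 0\<close> that] this[OF pos] have "\<bar>b i\<bar> \<le> \<bar>b i\<bar> / 2" by (simp only: e_def)
    thus False using \<open>b i \<noteq> 0\<close> by simp
  qed
  from this[of 0] this[of 1] this[of 2] show False using b(2) by (auto simp: b_def)
qed

end

section \<open>Extending p-adic absolute values\<close>

lemma le_mult_of_le_mult_add:
  fixes a b c :: real
  assumes "\<And>e. e > 0 \<Longrightarrow> c \<le> (a + e) * (b + e)"
  shows "c \<le> a * b"
proof -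
  have "((\<lambda>e. (a + e) * (b + e)) \<longlongrightarrow> (a + 0) * (b + 0)) (at_right 0)" by (intro tendsto_intros)
  moreover have "eventually (\<lambda>e. c \<le> (a + e) * (b + e)) (at_right 0)"
    using eventually_at_right_less by (rule eventually_mono) (rule assms)
  ultimately have "c \<le> (a + 0) * (b + 0)" by (rule tendsto_lowerbound) simp
  thus ?thesis by simp
qed

text \<open>An upper bound on the rationals implies equality there, since a number and its inverse are both
  bounded. Stated in this form the conditions are stable under infima of chains.\<close>
locale padic_seminorm = complex_subfield F for F +
  fixes p :: nat and \<nu> :: "complex \<Rightarrow> real"
  assumes prime: "prime p"
    and nonneg: "x \<in> F \<Longrightarrow> 0 \<le> \<nu> x"
    and ultra: "x \<in> F \<Longrightarrow> y \<in> F \<Longrightarrow> \<nu> (x + y) \<le> max (\<nu> x) (\<nu> y)"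
    and submult: "x \<in> F \<Longrightarrow> y \<in> F \<Longrightarrow> \<nu> (x * y) \<le> \<nu> x * \<nu> y"
    and one: "\<nu> 1 = 1"
    and rat_le: "\<nu> (of_rat q) \<le> padic_abs p q"
begin

lemma zero: "\<nu> 0 = 0"
  using rat_le[of 0] nonneg[of 0] by simp

lemma power_le: "x \<in> F \<Longrightarrow> \<nu> (x ^ n) \<le> \<nu> x ^ n"
proof (induction n)
  case (Suc n)
  have "\<nu> (x * x ^ n) \<le> \<nu> x * \<nu> (x ^ n)" using Suc.prems by (intro submult) auto
  also have "\<dots> \<le> \<nu> x * \<nu> x ^ n" using Suc nonneg by (intro mult_left_mono) auto
  finally show ?case by simp
qed (simp add: one)

lemma pos: assumes "x \<in> F" "x \<noteq> 0" shows "0 < \<nu> x"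
proof -
  have "1 \<le> \<nu> x * \<nu> (inverse x)" using submult[of x "inverse x"] assms one by auto
  thus ?thesis using nonneg[of x] nonneg[of "inverse x"] assms
    by (metis inverse_mem less_le mult_zero_left not_one_le_zero)
qed

lemma rat_eq: "\<nu> (of_rat q) = padic_abs p q"
proof (cases "q = 0")
  case False
  have "1 \<le> \<nu> (of_rat q) * \<nu> (of_rat (inverse q))"
    using submult[of "of_rat q" "of_rat (inverse q)"] one False by (simp flip: of_rat_mult)
  also have "\<dots> \<le> \<nu> (of_rat q) * padic_abs p (inverse q)"
    by (intro mult_left_mono rat_le nonneg) auto
  finally have "padic_abs p q * 1 \<le> padic_abs p q * (\<nu> (of_rat q) * padic_abs p (inverse q))"
    by (intro mult_left_mono padic_abs_nonneg)
  also have "\<dots> = \<nu> (of_rat q) * padic_abs p (q * inverse q)"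
    by (simp add: padic_abs_mult[OF prime])
  finally show ?thesis using rat_le[of q] False by (simp add: padic_abs_1[OF prime])
qed (simp add: zero)

lemma of_nat_le: "\<nu> (of_nat n) \<le> 1"
  using rat_le[of "of_nat n"] padic_abs_of_int_le_1[OF prime, of "int n"] by simp

lemma sum_le:
  assumes "finite A" "\<And>i. i \<in> A \<Longrightarrow> f i \<in> F" "\<And>i. i \<in> A \<Longrightarrow> \<nu> (f i) \<le> c" "0 \<le> c"
  shows "\<nu> (\<Sum>i\<in>A. f i) \<le> c"
  using assms
proof (induction A rule: finite_induct)
  case (insert x A)
  have "\<nu> (f x + sum f A) \<le> max (\<nu> (f x)) (\<nu> (sum f A))" using insert by (intro ultra sum_mem) auto
  thus ?case using insert by force
qed (simp add: zero)

text \<open>The infimum of these rates is the spectral radius \<open>lim \<nu> (x^n)^{1/n}\<close>, defined without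
  reference to the existence of the limit.\<close>
definition growth_rates :: "complex \<Rightarrow> real set" where
  "growth_rates x = {r. r > 0 \<and> (\<exists>C. \<forall>n. \<nu> (x ^ n) \<le> C * r ^ n)}"

definition spectral :: "complex \<Rightarrow> real" where
  "spectral x = Inf (growth_rates x)"

lemma growth_ratesI: "x \<in> F \<Longrightarrow> r > 0 \<Longrightarrow> \<nu> x \<le> r \<Longrightarrow> r \<in> growth_rates x"
  unfolding growth_rates_def using nonneg
  by (auto intro!: exI[of _ 1] order.trans[OF power_le power_mono])

lemma growth_rates_bdd: "bdd_below (growth_rates x)"
  by (auto simp: growth_rates_def intro!: bdd_belowI[of _ 0] less_imp_le)

lemma growth_rates_nonempty: "x \<in> F \<Longrightarrow> growth_rates x \<noteq> {}"
  using growth_ratesI[of x "\<nu> x + 1"] nonneg[of x] by force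

lemma spectral_le: "r \<in> growth_rates x \<Longrightarrow> spectral x \<le> r"
  unfolding spectral_def by (rule cInf_lower[OF _ growth_rates_bdd])

lemma spectral_nonneg: "x \<in> F \<Longrightarrow> 0 \<le> spectral x"
  unfolding spectral_def using growth_rates_nonempty
  by (intro cInf_greatest) (auto simp: growth_rates_def)

lemma spectral_less:
  assumes x: "x \<in> F" and s: "spectral x < s"
  shows "s \<in> growth_rates x"
proof -
  obtain r where r: "r \<in> growth_rates x" "r < s"
    using s growth_rates_nonempty[OF x] unfolding spectral_def by (meson cInf_lessD)
  then obtain C where C: "\<And>n. \<nu> (x ^ n) \<le> C * r ^ n" "r > 0" by (auto simp: growth_rates_def)
  have "C \<ge> 1" using C(1)[of 0] one by simp
  have "\<nu> (x ^ n) \<le> C * s ^ n" for n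
    using C(1)[of n] \<open>C \<ge> 1\<close> r C(2)
    by (meson less_imp_le mult_left_mono order_trans power_mono zero_le_one)
  thus ?thesis using C(2) r(2) by (auto simp: growth_rates_def)
qed

lemma spectral_le_self: "x \<in> F \<Longrightarrow> spectral x \<le> \<nu> x"
  using spectral_le[OF growth_ratesI] nonneg[of x]
  by (metis add_nonneg_pos field_le_epsilon less_add_same_cancel1 less_eq_real_def)

lemma spectral_padic_seminorm: "padic_seminorm F p spectral"
proof
  show "prime p" by (rule prime)
  show "0 \<le> spectral x" if "x \<in> F" for x using that by (rule spectral_nonneg)
  show "spectral (of_rat q) \<le> padic_abs p q" for q
    using spectral_le_self[of "of_rat q"] rat_le[of q] by simp
  show "spectral (x + y) \<le> max (spectral x) (spectral y)" if xy: "x \<in> F" "y \<in> F" for x y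
  proof (rule dense_ge)
    fix s assume "max (spectral x) (spectral y) < s"
    hence s: "s \<in> growth_rates x" "s \<in> growth_rates y" using xy by (auto intro: spectral_less)
    then obtain C D where C: "\<And>n. \<nu> (x ^ n) \<le> C * s ^ n" and D: "\<And>n. \<nu> (y ^ n) \<le> D * s ^ n" and s0: "s > 0"
      by (auto simp: growth_rates_def)
    have CD: "C \<ge> 1" "D \<ge> 1" using C[of 0] D[of 0] one by auto
    have "\<nu> ((x + y) ^ n) \<le> C * D * s ^ n" for n
      unfolding binomial_ring
    proof (rule sum_le)
      fix i assume i: "i \<in> {..n}"
      have "\<nu> (of_nat (n choose i) * x ^ i * y ^ (n - i)) \<le> \<nu> (of_nat (n choose i)) * \<nu> (x ^ i * y ^ (n - i))"
        using xy by (subst mult.assoc, intro submult) auto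
      also have "\<dots> \<le> 1 * (\<nu> (x ^ i) * \<nu> (y ^ (n - i)))"
        using xy by (intro mult_mono of_nat_le submult nonneg mult_mem power_mem) auto
      also have "\<dots> \<le> 1 * ((C * s ^ i) * (D * s ^ (n - i)))"
        using xy C D CD s0 by (intro mult_left_mono mult_mono nonneg power_mem) auto
      also have "\<dots> = C * D * (s ^ i * s ^ (n - i))" by simp
      also have "s ^ i * s ^ (n - i) = s ^ n" using i by (simp flip: power_add)
      finally show "\<nu> (of_nat (n choose i) * x ^ i * y ^ (n - i)) \<le> C * D * s ^ n" .
    qed (use xy CD s0 in auto)
    thus "spectral (x + y) \<le> s" using s0 by (intro spectral_le) (auto simp: growth_rates_def)
  qed
  show "spectral (x * y) \<le> spectral x * spectral y" if xy: "x \<in> F" "y \<in> F" for x y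
  proof -
    have le: "spectral (x * y) \<le> s * t" if st: "s > spectral x" "t > spectral y" for s t
    proof -
      have st': "s \<in> growth_rates x" "t \<in> growth_rates y" using xy st by (auto intro: spectral_less)
      then obtain C D where C: "\<And>n. \<nu> (x ^ n) \<le> C * s ^ n" and D: "\<And>n. \<nu> (y ^ n) \<le> D * t ^ n"
        and s0: "s > 0" "t > 0" by (auto simp: growth_rates_def)
      have CD: "C \<ge> 1" "D \<ge> 1" using C[of 0] D[of 0] one by auto
      have "\<nu> ((x * y) ^ n) \<le> C * D * (s * t) ^ n" for n
      proof -
        have "\<nu> ((x * y) ^ n) \<le> \<nu> (x ^ n) * \<nu> (y ^ n)" using xy by (subst power_mult_distrib, intro submult) auto
        also have "\<dots> \<le> (C * s ^ n) * (D * t ^ n)"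
          using xy C D CD s0 by (intro mult_mono nonneg power_mem) auto
        finally show ?thesis by (simp add: power_mult_distrib algebra_simps)
      qed
      thus ?thesis using s0 by (intro spectral_le) (auto simp: growth_rates_def)
    qed
    show ?thesis by (rule le_mult_of_le_mult_add) (intro le, auto)
  qed
  show "spectral 1 = 1"
  proof (rule antisym)
    show "spectral 1 \<le> 1" using spectral_le_self[of 1] one by simp
    show "1 \<le> spectral 1" unfolding spectral_def
    proof (rule cInf_greatest)
      show "growth_rates 1 \<noteq> {}" by (rule growth_rates_nonempty) simp
      fix r assume "r \<in> growth_rates 1"
      then obtain C where C: "r > 0" "\<And>n. 1 \<le> C * r ^ n" by (auto simp: growth_rates_def one)
      show "1 \<le> r"
      proof (rule ccontr)
        assume "\<not> 1 \<le> r"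
        hence "(\<lambda>n. C * r ^ n) \<longlonglongrightarrow> C * 0" using C(1) by (intro tendsto_intros LIMSEQ_power_zero) auto
        hence "1 \<le> C * 0" by (rule tendsto_lowerbound) (use C(2) in auto)
        thus False by simp
      qed
    qed
  qed
qed

lemma spectral_square: assumes x: "x \<in> F" shows "spectral x ^ 2 \<le> spectral (x ^ 2)"
proof (rule dense_ge)
  fix s assume s: "spectral (x ^ 2) < s"
  have s0: "s > 0" using s spectral_nonneg[of "x^2"] x by (auto simp: power_mem)
  have "s \<in> growth_rates (x ^ 2)" using s x by (intro spectral_less) auto
  then obtain C where C: "\<And>n. \<nu> ((x ^ 2) ^ n) \<le> C * s ^ n" by (auto simp: growth_rates_def)
  have C1: "C \<ge> 1" using C[of 0] one by simp
  define D where "D = C * (1 + \<nu> x / sqrt s)"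
  have nx: "\<nu> x / sqrt s \<ge> 0" using nonneg[OF x] s0 by simp
  have "\<nu> (x ^ n) \<le> D * sqrt s ^ n" for n
  proof (cases "even n")
    case True
    then obtain k where k: "n = 2 * k" by (elim evenE)
    have sp: "s ^ k = sqrt s ^ n" using s0 by (simp add: k power_mult)
    have "\<nu> (x ^ n) \<le> C * sqrt s ^ n" using C[of k] by (simp add: k power_mult sp[unfolded k])
    also have "\<dots> \<le> D * sqrt s ^ n" unfolding D_def using C1 nx s0 by (intro mult_right_mono) auto
    finally show ?thesis .
  next
    case False
    then obtain k where k: "n = Suc (2 * k)" by (elim oddE) simp
    have sp: "s ^ k = sqrt s ^ (2 * k)" using s0 by (simp add: power_mult)
    have "x ^ n = x * (x ^ 2) ^ k" by (simp add: k power_mult)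
    hence "\<nu> (x ^ n) \<le> \<nu> x * \<nu> ((x ^ 2) ^ k)" using x by (auto intro!: submult)
    also have "\<dots> \<le> \<nu> x * (C * s ^ k)" using C nonneg[OF x] by (intro mult_left_mono) auto
    also have "\<dots> = C * (\<nu> x / sqrt s) * sqrt s ^ n" using s0 by (simp add: k sp)
    also have "\<dots> \<le> D * sqrt s ^ n" unfolding D_def using C1 nx s0 by (intro mult_right_mono mult_left_mono) auto
    finally show ?thesis .
  qed
  hence "sqrt s \<in> growth_rates x" using s0 by (auto simp: growth_rates_def)
  hence "spectral x \<le> sqrt s" by (rule spectral_le)
  hence "spectral x ^ 2 \<le> sqrt s ^ 2" using spectral_nonneg[OF x] by (intro power_mono) auto
  thus "spectral x ^ 2 \<le> s" using s0 by simp
qed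

text \<open>Once powers are preserved, the values \<open>\<nu> (x * f^n) / \<nu> f^n\<close> decrease to another seminorm.\<close>
lemma twisted_seminorm:
  assumes sq: "\<And>x. x \<in> F \<Longrightarrow> \<nu> (x ^ 2) = \<nu> x ^ 2" and f: "f \<in> F" "f \<noteq> 0"
  shows "\<exists>\<mu>. padic_seminorm F p \<mu> \<and> (\<forall>x\<in>F. \<mu> x \<le> \<nu> x \<and> \<mu> x \<le> \<nu> (x * f) / \<nu> f)"
proof -
  have fp: "\<nu> f > 0" using pos f by auto
  have pow2: "\<nu> (f ^ (2 ^ k)) = \<nu> f ^ (2 ^ k)" for k
  proof (induction k)
    case (Suc k)
    have "\<nu> ((f ^ (2 ^ k)) ^ 2) = \<nu> (f ^ (2 ^ k)) ^ 2" using f by (intro sq) auto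
    thus ?case using Suc by (simp flip: power_mult add: mult.commute)
  qed simp
  \<comment> \<open>Other exponents follow from submultiplicativity, by comparison with the exponent \<open>2^n\<close>.\<close>
  have pow: "\<nu> (f ^ n) = \<nu> f ^ n" for n
  proof (rule antisym)
    show "\<nu> (f ^ n) \<le> \<nu> f ^ n" using f by (intro power_le)
    have n: "n \<le> 2 ^ n" by (simp add: less_imp_le)
    have "\<nu> f ^ n * \<nu> f ^ (2 ^ n - n) = \<nu> (f ^ n * f ^ (2 ^ n - n))"
      using pow2[of n] n by (simp flip: power_add)
    also have "\<dots> \<le> \<nu> (f ^ n) * \<nu> (f ^ (2 ^ n - n))" using f by (intro submult) auto
    also have "\<dots> \<le> \<nu> (f ^ n) * \<nu> f ^ (2 ^ n - n)" using f by (intro mult_left_mono power_le nonneg) auto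
    finally show "\<nu> f ^ n \<le> \<nu> (f ^ n)" using fp by (simp add: mult_le_cancel_right)
  qed
  define a where "a = (\<lambda>x n. \<nu> (x * f ^ n) / \<nu> f ^ n)"
  have a0: "0 \<le> a x n" if "x \<in> F" for x n unfolding a_def using that f fp
    by (intro divide_nonneg_pos nonneg mult_mem power_mem zero_less_power)
  have dec: "decseq (a x)" if "x \<in> F" for x
  proof (rule decseq_SucI)
    fix n
    have "\<nu> (x * f ^ Suc n) \<le> \<nu> (x * f ^ n) * \<nu> f"
      using submult[of "x * f ^ n" f] that f by (auto simp: algebra_simps)
    hence "\<nu> (x * f ^ Suc n) / \<nu> f ^ Suc n \<le> \<nu> (x * f ^ n) * \<nu> f / \<nu> f ^ Suc n"
      using fp by (intro divide_right_mono) auto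
    thus "a x (Suc n) \<le> a x n" using fp by (simp add: a_def)
  qed
  have "\<exists>L. a x \<longlonglongrightarrow> L \<and> (\<forall>n. L \<le> a x n)" if "x \<in> F" for x
    using decseq_convergent[OF dec[OF that], of 0] a0[OF that] by metis
  then obtain \<mu> where \<mu>: "\<And>x. x \<in> F \<Longrightarrow> a x \<longlonglongrightarrow> \<mu> x" "\<And>x n. x \<in> F \<Longrightarrow> \<mu> x \<le> a x n" by metis
  have le: "\<mu> x \<le> \<nu> x" if "x \<in> F" for x using \<mu>(2)[OF that, of 0] by (simp add: a_def)
  have "padic_seminorm F p \<mu>"
  proof
    show "prime p" by (rule prime)
    show "\<mu> (of_rat q) \<le> padic_abs p q" for q using le[of "of_rat q"] rat_le[of q] by simp
    have "a 1 = (\<lambda>n. 1)" using fp by (simp add: a_def pow)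
    thus "\<mu> 1 = 1" using \<mu>(1)[of 1] LIMSEQ_unique[of "\<lambda>n. 1" 1 "\<mu> 1"] by simp
    show "0 \<le> \<mu> x" if "x \<in> F" for x using \<mu>(1)[OF that] a0[OF that] by (intro LIMSEQ_le_const) auto
    fix x y assume xy: "x \<in> F" "y \<in> F"
    show "\<mu> (x + y) \<le> max (\<mu> x) (\<mu> y)"
    proof (rule LIMSEQ_le)
      show "a (x + y) \<longlonglongrightarrow> \<mu> (x + y)" using xy by (intro \<mu>) auto
      show "(\<lambda>n. max (a x n) (a y n)) \<longlonglongrightarrow> max (\<mu> x) (\<mu> y)" using xy by (intro tendsto_max \<mu>)
      have "a (x + y) n \<le> max (a x n) (a y n)" for n
      proof -
        have "\<nu> ((x + y) * f ^ n) \<le> max (\<nu> (x * f ^ n)) (\<nu> (y * f ^ n))"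
          unfolding distrib_right using xy f by (intro ultra) auto
        hence "a (x + y) n \<le> max (\<nu> (x * f ^ n)) (\<nu> (y * f ^ n)) / \<nu> f ^ n"
          unfolding a_def using fp by (intro divide_right_mono) auto
        also have "\<dots> = max (a x n) (a y n)" using fp by (simp add: a_def max_divide_distrib_right)
        finally show ?thesis .
      qed
      thus "\<exists>N. \<forall>n\<ge>N. a (x + y) n \<le> max (a x n) (a y n)" by blast
    qed
    show "\<mu> (x * y) \<le> \<mu> x * \<mu> y"
    proof (rule LIMSEQ_le)
      have "strict_mono (\<lambda>n::nat. 2 * n)" by (auto simp: strict_mono_def)
      thus "(\<lambda>n. a (x * y) (2 * n)) \<longlonglongrightarrow> \<mu> (x * y)"
        using LIMSEQ_subseq_LIMSEQ[OF \<mu>(1)[of "x * y"], of "\<lambda>n. 2 * n"] xy by (auto simp: o_def)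
      show "(\<lambda>n. a x n * a y n) \<longlonglongrightarrow> \<mu> x * \<mu> y" using xy by (intro tendsto_mult \<mu>)
      have "a (x * y) (2 * n) \<le> a x n * a y n" for n
      proof -
        have "(x * y) * f ^ (2 * n) = (x * f ^ n) * (y * f ^ n)" by (simp add: mult_2 power_add)
        hence "\<nu> ((x * y) * f ^ (2 * n)) \<le> \<nu> (x * f ^ n) * \<nu> (y * f ^ n)" 
          using submult[of "x * f ^ n" "y * f ^ n"] xy f by (simp only: mult_mem power_mem)
        hence "\<nu> ((x * y) * f ^ (2 * n)) / \<nu> f ^ (2 * n) \<le> \<nu> (x * f ^ n) * \<nu> (y * f ^ n) / \<nu> f ^ (2 * n)"
          using fp by (intro divide_right_mono) auto
        thus ?thesis by (simp add: a_def mult_2 power_add)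
      qed
      thus "\<exists>N. \<forall>n\<ge>N. a (x * y) (2 * n) \<le> a x n * a y n" by blast
    qed
  qed
  moreover have "\<mu> x \<le> \<nu> (x * f) / \<nu> f" if "x \<in> F" for x using \<mu>(2)[OF that, of 1] by (simp add: a_def)
  ultimately show ?thesis using le by blast
qed

end

text \<open>A minimal seminorm equals its spectral seminorm, hence preserves squares, and then equals
  each of its twists, hence is multiplicative.\<close>
lemma minimal_seminorm_multiplicative:
  assumes \<nu>: "padic_seminorm F p \<nu>"
    and min: "\<And>\<mu>. padic_seminorm F p \<mu> \<Longrightarrow> (\<And>x. x \<in> F \<Longrightarrow> \<mu> x \<le> \<nu> x) \<Longrightarrow> (\<And>x. x \<in> F \<Longrightarrow> \<mu> x = \<nu> x)"
    and xy: "x \<in> F" "y \<in> F"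
  shows "\<nu> (x * y) = \<nu> x * \<nu> y"
proof -
  interpret padic_seminorm F p \<nu> by fact
  have sp: "spectral x = \<nu> x" if "x \<in> F" for x
    using min[OF spectral_padic_seminorm spectral_le_self that] .
  have sq: "\<nu> (x ^ 2) = \<nu> x ^ 2" if "x \<in> F" for x
    using spectral_square[OF that] power_le[OF that, of 2] sp[OF that] sp[OF power_mem[OF that, of 2]] by simp
  show ?thesis
  proof (cases "y = 0")
    case False
    from twisted_seminorm[OF sq xy(2) False] obtain \<mu> where
      \<mu>: "padic_seminorm F p \<mu>" "\<And>x. x \<in> F \<Longrightarrow> \<mu> x \<le> \<nu> x" "\<And>x. x \<in> F \<Longrightarrow> \<mu> x \<le> \<nu> (x * y) / \<nu> y" by blast
    have "\<nu> x \<le> \<nu> (x * y) / \<nu> y" using min[OF \<mu>(1,2) xy(1)] \<mu>(3)[OF xy(1)] by simp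
    hence "\<nu> x * \<nu> y \<le> \<nu> (x * y)" using pos[OF xy(2) False] by (simp add: field_simps)
    thus ?thesis using submult[OF xy] by simp
  qed (simp add: zero)
qed

text \<open>By Zorn's lemma there is a minimal seminorm below the given one. Restricting all functions to
  \<open>F\<close> makes the pointwise order antisymmetric.\<close>
theorem padic_place_below_seminorm:
  assumes \<nu>0: "padic_seminorm F p \<nu>0"
  shows "\<exists>v\<in>padic_places p F. \<forall>x\<in>F. v x \<le> \<nu>0 x"
proof -
  interpret S0: padic_seminorm F p \<nu>0 by fact
  define A where "A = {\<nu> \<in> extensional F. padic_seminorm F p \<nu> \<and> (\<forall>x\<in>F. \<nu> x \<le> \<nu>0 x)}"
  define P where "P = (\<lambda>a b :: complex \<Rightarrow> real. \<forall>x\<in>F. b x \<le> a x)"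
  have restr: "padic_seminorm F p (restrict \<nu> F)" if "padic_seminorm F p \<nu>" for \<nu>
  proof -
    interpret N: padic_seminorm F p \<nu> by fact
    show ?thesis using N.prime N.nonneg N.ultra N.submult N.one N.rat_le
      by unfold_locales auto
  qed
  have "\<exists>\<nu>\<in>A. \<forall>a\<in>A. P \<nu> a \<longrightarrow> a = \<nu>"
  proof (rule predicate_Zorn)
    show "partial_order_on A (relation_of P A)"
    proof (rule partial_order_on_relation_ofI)
      show "P a a" for a by (simp add: P_def)
      show "P a c" if "P a b" "P b c" for a b c using that by (auto simp: P_def intro: order.trans)
      show "a = b" if "a \<in> A" "b \<in> A" "P a b" "P b a" for a b
        using that by (intro extensionalityI[of a F b]) (auto simp: A_def P_def intro: antisym)
    qed
    fix C assume C: "C \<in> Chains (relation_of P A)"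
    have CA: "C \<subseteq> A" using C by (auto simp: Chains_def relation_of_def)
    have chain: "P a b \<or> P b a" if "a \<in> C" "b \<in> C" for a b using C that by (auto simp: Chains_def relation_of_def)
    show "\<exists>u\<in>A. \<forall>a\<in>C. P a u"
    proof (cases "C = {}")
      case True
      have "restrict \<nu>0 F \<in> A" using restr[OF \<nu>0] by (auto simp: A_def)
      thus ?thesis using True by auto
    next
      case False
      define u where "u = restrict (\<lambda>x. INF a\<in>C. a x) F"
      have semi: "padic_seminorm F p a" if "a \<in> C" for a using that CA by (auto simp: A_def)
      have nn: "0 \<le> a x" if "a \<in> C" "x \<in> F" for a x using padic_seminorm.nonneg[OF semi] that by auto
      have bdd: "bdd_below ((\<lambda>a. a x) ` C)" if "x \<in> F" for x using nn that by (intro bdd_belowI[of _ 0]) auto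
      have ule: "u x \<le> a x" if "a \<in> C" "x \<in> F" for a x
        using cINF_lower[OF bdd[OF that(2)] that(1)] that by (simp add: u_def)
      have ug: "c \<le> u x" if "x \<in> F" "\<And>a. a \<in> C \<Longrightarrow> c \<le> a x" for c x
        using cINF_greatest[OF False that(2)] that(1) by (simp add: u_def)
      have ul: "\<exists>a\<in>C. a x < s" if "x \<in> F" "u x < s" for x s
        using that ug[of x s] by (meson not_le)
      \<comment> \<open>Along a chain finitely many approximations of the infimum can be chosen at once.\<close>
      have ul2: "\<exists>a\<in>C. a x < s \<and> a y < t" if xy: "x \<in> F" "y \<in> F" "u x < s" "u y < t" for x y s t
      proof -
        obtain a b where ab: "a \<in> C" "a x < s" "b \<in> C" "b y < t"
          using ul[OF xy(1,3)] ul[OF xy(2,4)] by blast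
        from chain[OF ab(1,3)] show ?thesis
        proof
          assume "P a b"
          hence "b x \<le> a x" using xy by (auto simp: P_def)
          thus ?thesis using ab by (intro bexI[of _ b]) auto
        next
          assume "P b a"
          hence "a y \<le> b y" using xy by (auto simp: P_def)
          thus ?thesis using ab by (intro bexI[of _ a]) auto
        qed
      qed
      obtain a0 where a0: "a0 \<in> C" using False by blast
      have u0: "0 \<le> u x" if "x \<in> F" for x by (rule ug[OF that]) (rule nn[OF _ that])
      have "padic_seminorm F p u"
      proof
        show "prime p" by (rule S0.prime)
        show "0 \<le> u x" if "x \<in> F" for x using u0[OF that] .
        show "u (of_rat q) \<le> padic_abs p q" for q
          using ule[OF a0, of "of_rat q"] padic_seminorm.rat_le[OF semi[OF a0], of q] by simp
        have "1 \<le> u 1" by (rule ug) (simp_all add: padic_seminorm.one[OF semi])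
        moreover have "u 1 \<le> 1" using ule[OF a0, of 1] padic_seminorm.one[OF semi[OF a0]] by simp
        ultimately show "u 1 = 1" by simp
        show "u (x + y) \<le> max (u x) (u y)" if xy: "x \<in> F" "y \<in> F" for x y
        proof (rule dense_ge)
          fix s assume "max (u x) (u y) < s"
          then obtain a where a: "a \<in> C" "a x < s" "a y < s" using ul2[OF xy, of s s] by auto
          have "u (x + y) \<le> a (x + y)" using ule[OF a(1)] xy by auto
          also have "\<dots> \<le> max (a x) (a y)" by (rule padic_seminorm.ultra[OF semi[OF a(1)] xy])
          finally show "u (x + y) \<le> s" using a by simp
        qed
        show "u (x * y) \<le> u x * u y" if xy: "x \<in> F" "y \<in> F" for x y
        proof -
          have le: "u (x * y) \<le> (u x + e) * (u y + e)" if "e > 0" for e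
          proof -
            obtain a where a: "a \<in> C" "a x < u x + e" "a y < u y + e"
              using ul2[OF xy, of "u x + e" "u y + e"] \<open>e > 0\<close> by auto
            have "u (x * y) \<le> a (x * y)" using ule[OF a(1)] xy by auto
            also have "\<dots> \<le> a x * a y" by (rule padic_seminorm.submult[OF semi[OF a(1)] xy])
            also have "\<dots> \<le> (u x + e) * (u y + e)"
              using a nn[OF a(1)] xy u0[OF xy(1)] \<open>e > 0\<close> by (intro mult_mono) auto
            finally show ?thesis .
          qed
          thus ?thesis by (rule le_mult_of_le_mult_add)
        qed
      qed
      moreover have "u x \<le> \<nu>0 x" if "x \<in> F" for x
        using ule[OF a0 that] a0 CA that unfolding A_def by force
      ultimately have "u \<in> A" by (auto simp: A_def u_def)
      thus ?thesis using ule by (auto simp: P_def)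
    qed
  qed
  then obtain \<nu> where \<nu>: "\<nu> \<in> A" and min: "\<And>a. a \<in> A \<Longrightarrow> P \<nu> a \<Longrightarrow> a = \<nu>" by blast
  have sn: "padic_seminorm F p \<nu>" and ext: "\<nu> \<in> extensional F" and below: "\<And>x. x \<in> F \<Longrightarrow> \<nu> x \<le> \<nu>0 x"
    using \<nu> by (auto simp: A_def)
  interpret N: padic_seminorm F p \<nu> by fact
  have min': "\<mu> x = \<nu> x" if "padic_seminorm F p \<mu>" "\<And>x. x \<in> F \<Longrightarrow> \<mu> x \<le> \<nu> x" "x \<in> F" for \<mu> x
  proof -
    have "restrict \<mu> F \<in> A" using restr[OF that(1)] that(2) below by (force simp: A_def)
    moreover have "P \<nu> (restrict \<mu> F)" using that(2) by (simp add: P_def)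
    ultimately have "restrict \<mu> F = \<nu>" by (rule min)
    thus ?thesis using that(3) by (metis restrict_apply')
  qed
  have mult: "\<nu> (x * y) = \<nu> x * \<nu> y" if "x \<in> F" "y \<in> F" for x y
    by (rule minimal_seminorm_multiplicative[OF sn _ that]) (rule min')
  have "absolute_value F \<nu>" unfolding absolute_value_def
  proof (intro conjI ballI)
    fix x assume x: "x \<in> F"
    show "0 \<le> \<nu> x" by (rule N.nonneg[OF x])
    show "\<nu> x = 0 \<longleftrightarrow> x = 0" using N.pos[OF x] N.zero by force
    fix y assume y: "y \<in> F"
    show "\<nu> (x * y) = \<nu> x * \<nu> y" by (rule mult[OF x y])
    show "\<nu> (x + y) \<le> \<nu> x + \<nu> y" using N.ultra[OF x y] N.nonneg[OF x] N.nonneg[OF y] by simp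
  qed
  hence "\<nu> \<in> padic_places p F" using N.rat_eq N.prime ext by (auto simp: padic_places_def places_def)
  thus ?thesis using below by blast
qed

section \<open>Gauss norms\<close>

lemma map_poly_of_rat_add: "map_poly of_rat (g + h) = (map_poly of_rat g + map_poly of_rat h :: complex poly)"
  by (rule poly_eqI) (simp add: coeff_map_poly of_rat_add)

lemma map_poly_of_rat_mult: "map_poly of_rat (g * h) = (map_poly of_rat g * map_poly of_rat h :: complex poly)"
  by (rule poly_eqI) (simp add: coeff_map_poly coeff_mult of_rat_sum of_rat_mult)

lemma map_poly_of_rat_minus: "map_poly of_rat (- g) = (- map_poly of_rat g :: complex poly)"
  by (rule poly_eqI) (simp add: coeff_map_poly of_rat_minus)

lemma polys_over_Rats_eq: "polys_over \<rat> = range (map_poly of_rat)"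
proof (intro equalityI subsetI)
  fix q :: "complex poly" assume q: "q \<in> polys_over \<rat>"
  define r where "r = (\<lambda>z::complex. SOME s::rat. of_rat s = z)"
  have r: "of_rat (r z) = z" if "z \<in> \<rat>" for z
    unfolding r_def by (rule someI_ex) (use that in \<open>auto elim: Rats_cases\<close>)
  have r0: "r 0 = 0" using r[of 0] by simp
  have "map_poly of_rat (map_poly r q) = q"
    using r r0 polys_overD[OF q] by (intro poly_eqI) (simp add: coeff_map_poly)
  thus "q \<in> range (map_poly of_rat)" by (metis rangeI)
qed (auto simp: polys_over_def coeff_map_poly)

definition gauss_weight :: "nat \<Rightarrow> real \<Rightarrow> rat poly \<Rightarrow> nat \<Rightarrow> real" where
  "gauss_weight p s g i = padic_abs p (coeff g i) * s ^ i"

definition gauss_norm :: "nat \<Rightarrow> real \<Rightarrow> rat poly \<Rightarrow> real" where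
  "gauss_norm p s g = Max (gauss_weight p s g ` {..degree g})"

context
  fixes p :: nat and s :: real
  assumes p: "prime p" and s: "s > 0"
begin

lemma gauss_weight_nonneg: "0 \<le> gauss_weight p s g i"
  using s by (simp add: gauss_weight_def padic_abs_nonneg)

lemma gauss_norm_attained: "\<exists>i\<le>degree g. gauss_norm p s g = gauss_weight p s g i"
proof -
  have "gauss_norm p s g \<in> gauss_weight p s g ` {..degree g}"
    unfolding gauss_norm_def by (intro Max_in) auto
  thus ?thesis by auto
qed

lemma gauss_norm_nonneg: "0 \<le> gauss_norm p s g"
  using gauss_norm_attained[of g] gauss_weight_nonneg[of g] by metis

lemma gauss_weight_le: "gauss_weight p s g i \<le> gauss_norm p s g"
proof (cases "i \<le> degree g")
  case True
  thus ?thesis unfolding gauss_norm_def by (intro Max_ge) auto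
next
  case False
  hence "gauss_weight p s g i = 0" by (simp add: gauss_weight_def coeff_eq_0)
  thus ?thesis using gauss_norm_nonneg[of g] by simp
qed

lemma gauss_norm_le: "(\<And>i. gauss_weight p s g i \<le> B) \<Longrightarrow> gauss_norm p s g \<le> B"
  using gauss_norm_attained[of g] by metis

lemma gauss_norm_pos: assumes "g \<noteq> 0" shows "0 < gauss_norm p s g"
proof -
  have "padic_abs p (lead_coeff g) > 0" using assms prime_gt_0_nat[OF p] by (simp add: padic_abs_def)
  hence "gauss_weight p s g (degree g) > 0" using s by (simp add: gauss_weight_def)
  thus ?thesis using gauss_weight_le[of g "degree g"] by simp
qed

lemma padic_abs_sum_le:
  assumes "finite A" "\<And>i. i \<in> A \<Longrightarrow> padic_abs p (f i) \<le> c" "0 \<le> c"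
  shows "padic_abs p (\<Sum>i\<in>A. f i) \<le> c"
  using assms
proof (induction A rule: finite_induct)
  case (insert x A)
  have "padic_abs p (f x + sum f A) \<le> max (padic_abs p (f x)) (padic_abs p (sum f A))"
    by (rule padic_abs_ultrametric[OF p])
  thus ?case using insert by force
qed simp

lemma padic_abs_sum_less:
  assumes "finite A" "\<And>i. i \<in> A \<Longrightarrow> padic_abs p (f i) < c" "0 < c"
  shows "padic_abs p (\<Sum>i\<in>A. f i) < c"
  using assms
proof (induction A rule: finite_induct)
  case (insert x A)
  have "padic_abs p (f x + sum f A) \<le> max (padic_abs p (f x)) (padic_abs p (sum f A))"
    by (rule padic_abs_ultrametric[OF p])
  thus ?case using insert by force
qed simp

lemma gauss_norm_add: "gauss_norm p s (g + h) \<le> max (gauss_norm p s g) (gauss_norm p s h)"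
proof (rule gauss_norm_le)
  fix i
  have "gauss_weight p s (g + h) i \<le> max (padic_abs p (coeff g i)) (padic_abs p (coeff h i)) * s ^ i"
    unfolding gauss_weight_def using s padic_abs_ultrametric[OF p] by (intro mult_right_mono) auto
  also have "\<dots> = max (gauss_weight p s g i) (gauss_weight p s h i)"
    using s by (simp add: gauss_weight_def max_mult_distrib_right)
  also have "\<dots> \<le> max (gauss_norm p s g) (gauss_norm p s h)"
    using gauss_weight_le by (intro max.mono) auto
  finally show "gauss_weight p s (g + h) i \<le> max (gauss_norm p s g) (gauss_norm p s h)" .
qed

lemma gauss_norm_mult: "gauss_norm p s (g * h) \<le> gauss_norm p s g * gauss_norm p s h"
proof (rule gauss_norm_le)
  fix n
  have "padic_abs p (coeff (g * h) n) \<le> gauss_norm p s g * gauss_norm p s h / s ^ n"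
    unfolding coeff_mult
  proof (rule padic_abs_sum_le)
    fix i assume i: "i \<in> {..n}"
    have "padic_abs p (coeff g i * coeff h (n - i)) * s ^ n
        = gauss_weight p s g i * gauss_weight p s h (n - i)"
    proof -
      have "s ^ n = s ^ i * s ^ (n - i)" using i by (simp flip: power_add)
      thus ?thesis by (simp add: gauss_weight_def padic_abs_mult[OF p])
    qed
    also have "\<dots> \<le> gauss_norm p s g * gauss_norm p s h"
      by (intro mult_mono gauss_weight_le gauss_norm_nonneg gauss_weight_nonneg)
    finally show "padic_abs p (coeff g i * coeff h (n - i)) \<le> gauss_norm p s g * gauss_norm p s h / s ^ n"
      using s by (simp add: field_simps)
  qed (use s gauss_norm_nonneg in auto)
  thus "gauss_weight p s (g * h) n \<le> gauss_norm p s g * gauss_norm p s h"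
    using s by (simp add: gauss_weight_def field_simps)
qed

text \<open>The first index where the Gauss norm is attained is additive under multiplication. If it
  is not the leading one for \<open>f\<close>, it is not the leading one for any multiple of \<open>f\<close>.\<close>
lemma gauss_weight_multiple:
  assumes f: "f \<noteq> 0" and h: "h \<noteq> 0"
    and j: "j < degree f" "gauss_weight p s f j \<ge> gauss_weight p s f (degree f)"
  shows "\<exists>l<degree f + degree h. gauss_weight p s (f * h) l \<ge> gauss_weight p s (f * h) (degree f + degree h)"
proof -
  define first where "first = (\<lambda>g. LEAST i. gauss_weight p s g i = gauss_norm p s g)"
  have first: "gauss_weight p s g (first g) = gauss_norm p s g" for g
    unfolding first_def using gauss_norm_attained[of g] by (metis (mono_tags, lifting) LeastI)
  have first_less: "gauss_weight p s g i < gauss_norm p s g" if "i < first g" for g i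
    using not_less_Least[OF that[unfolded first_def]] gauss_weight_le[of g i] by simp
  have first_le: "first g \<le> i" if "gauss_weight p s g i = gauss_norm p s g" for g i
    unfolding first_def using that by (rule Least_le)
  have ff: "first f < degree f"
  proof -
    obtain i where i: "i \<le> degree f" "gauss_norm p s f = gauss_weight p s f i" using gauss_norm_attained by blast
    show ?thesis
    proof (cases "i = degree f")
      case True
      hence "gauss_weight p s f j = gauss_norm p s f" using i j gauss_weight_le[of f j] by simp
      thus ?thesis using first_le j by fastforce
    next
      case False
      thus ?thesis using first_le[of f i] i by simp
    qed
  qed
  have fh: "first h \<le> degree h" using gauss_norm_attained[of h] first_le[of h] by (metis order.trans)
  define l where "l = first f + first h"
  define W where "W = gauss_norm p s f * gauss_norm p s h"
  have W: "W > 0" using gauss_norm_pos f h by (simp add: W_def)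
  have weights: "padic_abs p (coeff f i * coeff h (l - i)) * s ^ l = gauss_weight p s f i * gauss_weight p s h (l - i)"
    if "i \<le> l" for i
  proof -
    have "s ^ l = s ^ i * s ^ (l - i)" using that by (simp flip: power_add)
    thus ?thesis by (simp add: gauss_weight_def padic_abs_mult[OF p])
  qed
  define rest where "rest = (\<Sum>i\<in>{..l} - {first f}. coeff f i * coeff h (l - i))"
  have cf: "coeff (f * h) l = coeff f (first f) * coeff h (first h) + rest"
    unfolding coeff_mult rest_def by (subst sum.remove[of _ "first f"]) (auto simp: l_def)
  have "padic_abs p rest < W / s ^ l"
    unfolding rest_def
  proof (rule padic_abs_sum_less)
    fix i assume i: "i \<in> {..l} - {first f}"
    have "gauss_weight p s f i * gauss_weight p s h (l - i) < W"
    proof (cases "i < first f")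
      case True
      have "gauss_weight p s f i * gauss_weight p s h (l - i) \<le> gauss_weight p s f i * gauss_norm p s h"
        by (intro mult_left_mono gauss_weight_le gauss_weight_nonneg)
      also have "\<dots> < W" unfolding W_def using first_less[OF True] gauss_norm_pos[OF h] by simp
      finally show ?thesis .
    next
      case False
      hence "l - i < first h" using i by (auto simp: l_def)
      have "gauss_weight p s f i * gauss_weight p s h (l - i) \<le> gauss_norm p s f * gauss_weight p s h (l - i)"
        by (intro mult_right_mono gauss_weight_le gauss_weight_nonneg)
      also have "\<dots> < W" unfolding W_def using first_less[OF \<open>l - i < first h\<close>] gauss_norm_pos[OF f] by simp
      finally show ?thesis .
    qed
    thus "padic_abs p (coeff f i * coeff h (l - i)) < W / s ^ l"
      using weights[of i] i s by (simp add: field_simps)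
  qed (use s W in auto)
  moreover have "padic_abs p (coeff f (first f) * coeff h (first h)) = W / s ^ l"
    using weights[of "first f"] first s by (simp add: l_def W_def field_simps)
  moreover have "padic_abs p (coeff f (first f) * coeff h (first h)) \<le> max (padic_abs p (coeff (f * h) l)) (padic_abs p rest)"
    using padic_abs_ultrametric[OF p, of "coeff (f * h) l" "- rest"] cf by (simp add: padic_abs_minus[OF p])
  ultimately have "padic_abs p (coeff (f * h) l) \<ge> W / s ^ l" by simp
  hence "gauss_weight p s (f * h) l \<ge> W" using s by (simp add: gauss_weight_def field_simps)
  moreover have "gauss_weight p s (f * h) i \<le> W" for i
    unfolding W_def using gauss_weight_le gauss_norm_mult order.trans by blast
  moreover have "l < degree f + degree h" using ff fh by (simp add: l_def)
  ultimately show ?thesis by (meson order.trans)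
qed

end

section \<open>Places where an algebraic number is large\<close>

text \<open>This is the norm on \<open>\<rat>(\<beta>)\<close> induced by the Gauss norm on polynomials in \<open>\<beta>\<close>. It is used for
  \<open>\<beta> = 1 / \<alpha>\<close> with a weight below 1, to make \<open>\<alpha>\<close> large.\<close>
definition quotient_norm :: "nat \<Rightarrow> real \<Rightarrow> complex \<Rightarrow> complex \<Rightarrow> real" where
  "quotient_norm p s \<beta> x = Inf {gauss_norm p s g |g. poly (map_poly of_rat g) \<beta> = x}"

context
  fixes p :: nat and s :: real and \<beta> :: complex and F :: "complex set"
  assumes p: "prime p" and s: "s > 0"
    and F: "complex_subfield F" "F = simple_ext \<rat> \<beta>"
    and unit: "\<And>g. poly (map_poly of_rat g) \<beta> = 1 \<Longrightarrow> gauss_norm p s g \<ge> 1"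
begin

lemma quotient_norm_set:
  "bdd_below {gauss_norm p s g |g. poly (map_poly of_rat g) \<beta> = x}"
  "x \<in> F \<Longrightarrow> {gauss_norm p s g |g. poly (map_poly of_rat g) \<beta> = x} \<noteq> {}"
proof -
  show "bdd_below {gauss_norm p s g |g. poly (map_poly of_rat g) \<beta> = x}"
    using gauss_norm_nonneg[OF p s] by (intro bdd_belowI[of _ 0]) auto
  assume "x \<in> F"
  then obtain q where "q \<in> polys_over \<rat>" "x = poly q \<beta>" by (auto simp: F(2) simple_ext_def)
  thus "{gauss_norm p s g |g. poly (map_poly of_rat g) \<beta> = x} \<noteq> {}" by (auto simp: polys_over_Rats_eq)
qed

lemma quotient_norm_le: "quotient_norm p s \<beta> (poly (map_poly of_rat g) \<beta>) \<le> gauss_norm p s g"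
  unfolding quotient_norm_def by (rule cInf_lower[OF _ quotient_norm_set(1)]) auto

lemma quotient_norm_less:
  assumes "x \<in> F" "quotient_norm p s \<beta> x < t"
  shows "\<exists>g. poly (map_poly of_rat g) \<beta> = x \<and> gauss_norm p s g < t"
  using cInf_lessD[OF quotient_norm_set(2)[OF assms(1)], of t] assms(2) by (auto simp: quotient_norm_def)

lemma quotient_norm_ge:
  assumes "x \<in> F" "\<And>g. poly (map_poly of_rat g) \<beta> = x \<Longrightarrow> c \<le> gauss_norm p s g"
  shows "c \<le> quotient_norm p s \<beta> x"
  unfolding quotient_norm_def using quotient_norm_set(2)[OF assms(1)] assms(2) by (intro cInf_greatest) auto

lemma quotient_norm_seminorm: "padic_seminorm F p (quotient_norm p s \<beta>)"
proof -
  interpret complex_subfield F by fact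
  have const: "gauss_norm p s [:q:] = padic_abs p q" for q by (simp add: gauss_norm_def gauss_weight_def)
  have nn: "0 \<le> quotient_norm p s \<beta> x" if "x \<in> F" for x
    using gauss_norm_nonneg[OF p s] that by (intro quotient_norm_ge) auto
  have rat: "quotient_norm p s \<beta> (of_rat q) \<le> padic_abs p q" for q
    using quotient_norm_le[of "[:q:]"] const[of q] by (simp add: map_poly_pCons)
  show ?thesis
  proof
    show "prime p" by (rule p)
    show "0 \<le> quotient_norm p s \<beta> x" if "x \<in> F" for x using nn[OF that] .
    show "quotient_norm p s \<beta> (of_rat q) \<le> padic_abs p q" for q by (rule rat)
    show "quotient_norm p s \<beta> 1 = 1"
    proof (rule antisym)
      show "quotient_norm p s \<beta> 1 \<le> 1" using rat[of 1] padic_abs_1[OF p] by simp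
      show "1 \<le> quotient_norm p s \<beta> 1" using unit by (intro quotient_norm_ge) auto
    qed
    fix x y assume xy: "x \<in> F" "y \<in> F"
    show "quotient_norm p s \<beta> (x + y) \<le> max (quotient_norm p s \<beta> x) (quotient_norm p s \<beta> y)"
    proof (rule dense_ge)
      fix t assume t: "max (quotient_norm p s \<beta> x) (quotient_norm p s \<beta> y) < t"
      obtain g h where gh: "poly (map_poly of_rat g) \<beta> = x" "gauss_norm p s g < t"
        "poly (map_poly of_rat h) \<beta> = y" "gauss_norm p s h < t"
        using quotient_norm_less[OF xy(1), of t] quotient_norm_less[OF xy(2), of t] t by auto
      have "quotient_norm p s \<beta> (x + y) \<le> gauss_norm p s (g + h)"
        using quotient_norm_le[of "g + h"] gh by (simp add: map_poly_of_rat_add)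
      thus "quotient_norm p s \<beta> (x + y) \<le> t" using gauss_norm_add[OF p s, of g h] gh by simp
    qed
    show "quotient_norm p s \<beta> (x * y) \<le> quotient_norm p s \<beta> x * quotient_norm p s \<beta> y"
    proof -
      let ?a = "quotient_norm p s \<beta> x" and ?b = "quotient_norm p s \<beta> y"
      have le: "quotient_norm p s \<beta> (x * y) \<le> (?a + e) * (?b + e)" if "e > 0" for e
      proof -
        have "?a < ?a + e" "?b < ?b + e" using that by simp_all
        from quotient_norm_less[OF xy(1) this(1)] quotient_norm_less[OF xy(2) this(2)]
        obtain g h where gh: "poly (map_poly of_rat g) \<beta> = x" "gauss_norm p s g < ?a + e"
          "poly (map_poly of_rat h) \<beta> = y" "gauss_norm p s h < ?b + e" by blast
        have "quotient_norm p s \<beta> (x * y) \<le> gauss_norm p s (g * h)"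
          using quotient_norm_le[of "g * h"] gh by (simp add: map_poly_of_rat_mult)
        also have "\<dots> \<le> gauss_norm p s g * gauss_norm p s h" by (rule gauss_norm_mult[OF p s])
        also have "\<dots> \<le> (?a + e) * (?b + e)"
          using gh nn[OF xy(1)] that by (intro mult_mono gauss_norm_nonneg[OF p s]) auto
        finally show ?thesis .
      qed
      thus ?thesis by (rule le_mult_of_le_mult_add)
    qed
  qed
qed

end

text \<open>Give \<open>1 / \<alpha>\<close> the weight \<open>s = p^{-k/d}\<close> in the Gauss norm. The quotient norm of 1 stays 1: a
  representation of 1 by a polynomial of norm less than 1 would give, after reversal, a multiple of
  \<open>f\<close> whose leading term strictly dominates for the weight \<open>1 / s\<close>. For \<open>f\<close> itself the leading term
  does not dominate strictly, because it has weight at most 1 and some lower coefficient is prime to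
  \<open>p\<close>. A place below the quotient norm is at most \<open>s\<close> at \<open>1 / \<alpha>\<close>.\<close>
theorem ex_padic_place_large:
  fixes f :: "int poly"
  assumes \<alpha>: "number_field \<alpha> m F" "\<alpha> \<noteq> 0"
    and f: "content f = 1" "degree f = degree m"
      "map_poly of_int f = smult (of_int (lead_coeff f)) m"
    and p: "prime p" and k: "int p ^ k dvd lead_coeff f" "k > 0"
  shows "\<exists>v\<in>padic_places p F. v \<alpha> ^ degree m \<ge> real p ^ k"
proof -
  interpret number_field \<alpha> m F by fact
  define d where "d = degree m"
  have d: "d > 0" using degree_pos by (simp add: d_def)
  define r where "r = root d (real p ^ k)"
  have p1: "real p > 1" using prime_gt_1_nat[OF p] by simp
  have r1: "r \<ge> 1" using p1 d by (simp add: r_def)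
  have rd: "r ^ d = real p ^ k" using p1 d by (simp add: r_def real_root_pow_pos2)
  define s where "s = 1 / r"
  have s: "s > 0" "s \<le> 1" using r1 by (auto simp: s_def)
  define \<beta> where "\<beta> = inverse \<alpha>"
  define fq :: "rat poly" where "fq = map_poly of_int f"
  have fq: "degree fq = d" "map_poly of_rat fq = smult (of_int (lead_coeff f)) m" "fq \<noteq> 0"
  proof -
    have cf: "coeff fq i = of_int (coeff f i)" for i by (simp add: fq_def coeff_map_poly)
    show "degree fq = d" unfolding fq_def d_def f(2)[symmetric] by (rule degree_map_poly) auto
    have "map_poly of_rat fq = (map_poly of_int f :: complex poly)"
      by (rule poly_eqI) (simp add: coeff_map_poly cf)
    thus "map_poly of_rat fq = smult (of_int (lead_coeff f)) m" using f(3) by simp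
    show "fq \<noteq> 0" using \<open>degree fq = d\<close> d by auto
  qed
  have "\<beta> \<in> F" unfolding \<beta>_def by (rule inverse_mem) (simp add: F_eq Q.simple_ext_generator)
  have "algebraic \<alpha>" using m_props by (auto simp: algebraic_iff_polys_over_Rats)
  hence "algebraic \<beta>" by (auto simp: \<beta>_def)
  then obtain n where n: "minimal_poly \<rat> \<beta> n" using algebraic_minimal_poly by blast
  interpret B: complex_subfield "simple_ext \<rat> \<beta>" by (rule Q.simple_ext_subfield[OF n])
  have FB: "F = simple_ext \<rat> \<beta>"
  proof
    have "inverse \<beta> \<in> simple_ext \<rat> \<beta>" by (rule B.inverse_mem[OF Q.simple_ext_generator])
    thus "F \<subseteq> simple_ext \<rat> \<beta>" unfolding F_eq
      by (intro Q.simple_ext_least B.complex_subfield_axioms B.Rats_subset) (simp add: \<beta>_def)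
    show "simple_ext \<rat> \<beta> \<subseteq> F"
      by (intro Q.simple_ext_least complex_subfield_axioms Rats_subset \<open>\<beta> \<in> F\<close>)
  qed
  \<comment> \<open>The norm of 1 does not drop in the quotient.\<close>
  have unit: "gauss_norm p s g \<ge> 1" if g: "poly (map_poly of_rat g) \<beta> = 1" for g
  proof (rule ccontr)
    assume "\<not> ?thesis"
    hence small: "gauss_weight p s g i < 1" for i using gauss_weight_le[OF p s(1), of g i] by simp
    define e where "e = 1 + - g"
    have e0: "padic_abs p (coeff e 0) = 1"
    proof (rule antisym)
      have "padic_abs p (- coeff g 0) = padic_abs p (coeff g 0)" by (rule padic_abs_minus[OF p])
      moreover have "padic_abs p (coeff g 0) < 1" using small[of 0] by (simp add: gauss_weight_def)
      moreover have ce: "coeff e 0 = 1 + - coeff g 0" by (simp add: e_def)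
      ultimately show "padic_abs p (coeff e 0) \<le> 1"
        using padic_abs_ultrametric[OF p, of 1 "- coeff g 0"] padic_abs_1[OF p] by simp
      have "padic_abs p (coeff e 0 + coeff g 0) \<le> max (padic_abs p (coeff e 0)) (padic_abs p (coeff g 0))"
        by (rule padic_abs_ultrametric[OF p])
      thus "1 \<le> padic_abs p (coeff e 0)" using \<open>padic_abs p (coeff g 0) < 1\<close> ce padic_abs_1[OF p] by simp
    qed
    have ei: "gauss_weight p s e i < 1" if "i > 0" for i
    proof -
      have "coeff e i = - coeff g i" using that by (simp add: e_def coeff_1)
      hence "padic_abs p (coeff e i) = padic_abs p (coeff g i)" by (simp add: padic_abs_minus[OF p])
      thus ?thesis using small[of i] by (simp add: gauss_weight_def)
    qed
    have c0: "coeff e 0 \<noteq> 0" using e0 by auto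
    define G where "G = reflect_poly e"
    define N where "N = degree e"
    have degG: "degree G = N" using c0 by (simp add: G_def N_def)
    have G0: "G \<noteq> 0" using c0 by (auto simp: G_def)
    have e\<beta>: "poly (map_poly of_rat e) \<beta> = 0"
      using g unfolding e_def map_poly_of_rat_add map_poly_of_rat_minus by simp
    have "map_poly of_rat G = reflect_poly (map_poly of_rat e :: complex poly)"
      by (rule poly_eqI) (simp add: G_def coeff_map_poly coeff_reflect_poly degree_map_poly)
    hence "poly (map_poly of_rat G) \<alpha> = 0"
      using poly_reflect_poly_nz[OF \<alpha>(2), of "map_poly of_rat e"] e\<beta> by (simp add: \<beta>_def)
    moreover have "map_poly of_rat G \<in> polys_over \<rat>" by (auto simp: polys_over_Rats_eq)
    ultimately obtain q where q: "q \<in> polys_over \<rat>" "map_poly of_rat G = m * q"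
      using Q.minimal_poly_dvd[OF minimal] by blast
    have "f \<noteq> 0" using f(1) by auto
    hence lc: "lead_coeff f \<noteq> 0" by simp
    have "smult (inverse (of_int (lead_coeff f))) q \<in> polys_over \<rat>"
      using q by (intro Q.polys_over_smult) auto
    then obtain h where h: "smult (inverse (of_int (lead_coeff f))) q = map_poly of_rat h"
      by (auto simp: polys_over_Rats_eq)
    have "map_poly of_rat (fq * h) = (map_poly of_rat G :: complex poly)"
      unfolding map_poly_of_rat_mult fq(2) h[symmetric] q(2) using lc by simp
    hence Gfh: "G = fq * h" by (metis coeff_map_poly of_rat_0 of_rat_eq_iff poly_eqI)
    have h0: "h \<noteq> 0" using Gfh G0 by auto
    have Ndeg: "N = degree fq + degree h" using degG Gfh h0 fq by (simp add: degree_mult_eq)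
    obtain j where j: "j < degree fq" "gauss_weight p r fq j \<ge> gauss_weight p r fq (degree fq)"
    proof -
      have pl: "int p dvd lead_coeff f" using k by (meson dvd_power dvd_trans)
      have "\<exists>j. \<not> int p dvd coeff f j"
      proof (rule ccontr)
        assume "\<not> ?thesis"
        hence "[:int p:] dvd f" by (simp add: const_poly_dvd_iff)
        hence "int p dvd 1" using f(1) by (simp add: const_poly_dvd_iff_dvd_content)
        thus False using prime_gt_1_nat[OF p] by simp
      qed
      then obtain j where j: "\<not> int p dvd coeff f j" by blast
      have "j \<noteq> degree f" using j pl by auto
      moreover have "j \<le> degree f" using j by (metis coeff_eq_0 dvd_0_right not_le)
      ultimately have jd: "j < degree fq" using f(2) fq(1) by (simp add: d_def)
      have "coeff f j \<noteq> 0" using j by auto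
      hence "padic_abs p (coeff fq j) = 1"
        using padic_abs_of_int[OF p, of "coeff f j"] j
        by (auto simp: fq_def coeff_map_poly not_dvd_imp_multiplicity_0)
      hence "gauss_weight p r fq j \<ge> 1" using r1 by (simp add: gauss_weight_def)
      moreover have "gauss_weight p r fq (degree fq) \<le> 1"
      proof -
        have "k \<le> multiplicity (int p) (lead_coeff f)" using k lc p
          by (intro multiplicity_geI) (auto simp: prime_elem_not_unit)
        hence "real p ^ k \<le> real p ^ multiplicity (int p) (lead_coeff f)" using p1 by (intro power_increasing) auto
        moreover have "coeff fq (degree fq) = of_int (lead_coeff f)"
          unfolding fq(1) d_def f(2)[symmetric] by (simp add: fq_def coeff_map_poly)
        moreover have "gauss_weight p r fq (degree fq) = padic_abs p (coeff fq (degree fq)) * real p ^ k"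
          unfolding gauss_weight_def fq(1) rd ..
        ultimately have "gauss_weight p r fq (degree fq)
            = real p ^ k / real p ^ multiplicity (int p) (lead_coeff f)"
          using padic_abs_of_int[OF p lc] by simp
        moreover have "real p ^ k / real p ^ multiplicity (int p) (lead_coeff f) \<le> 1"
          using \<open>real p ^ k \<le> real p ^ multiplicity (int p) (lead_coeff f)\<close> p1 by (simp add: divide_le_eq_1)
        ultimately show ?thesis by simp
      qed
      ultimately show ?thesis using that[OF jd] by simp
    qed
    obtain l where l: "l < N" "gauss_weight p r G l \<ge> gauss_weight p r G N"
      using gauss_weight_multiple[OF p _ fq(3) h0 j] r1 Ndeg Gfh by auto
    have cG: "coeff G i = coeff e (N - i)" if "i \<le> N" for i using that by (simp add: G_def N_def coeff_reflect_poly)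
    have "gauss_weight p r G N = r ^ N" using e0 cG[of N] by (simp add: gauss_weight_def)
    moreover have "gauss_weight p r G l = gauss_weight p s e (N - l) * r ^ N"
    proof -
      have "r ^ N = r ^ (N - l) * r ^ l" using l by (simp flip: power_add)
      hence "s ^ (N - l) * r ^ N = r ^ l" using r1 by (simp add: s_def power_divide)
      thus ?thesis using cG[of l] l by (simp add: gauss_weight_def mult.assoc)
    qed
    moreover have "gauss_weight p s e (N - l) * r ^ N < 1 * r ^ N" using ei[of "N - l"] l r1
      by (intro mult_strict_right_mono) auto
    ultimately show False using l by simp
  qed
  have "padic_seminorm F p (quotient_norm p s \<beta>)"
    by (rule quotient_norm_seminorm[OF p s(1) complex_subfield_axioms FB unit])
  from padic_place_below_seminorm[OF this] obtain v where
    v: "v \<in> padic_places p F" "\<And>x. x \<in> F \<Longrightarrow> v x \<le> quotient_norm p s \<beta> x" by blast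
  have pl: "v \<in> places F" using v(1) by (auto simp: padic_places_def)
  interpret v: abs_value_field F v by (rule abs_value_field_place[OF pl])
  have "v \<beta> \<le> quotient_norm p s \<beta> \<beta>" by (rule v(2)[OF \<open>\<beta> \<in> F\<close>])
  also have "\<dots> \<le> gauss_norm p s [:0, 1:]"
    using quotient_norm_le[OF p s(1) complex_subfield_axioms FB unit, of "[:0, 1:]"] by (simp add: map_poly_pCons)
  also have "\<dots> \<le> s"
    using s p by (intro gauss_norm_le[OF p s(1)]) (auto simp: gauss_weight_def coeff_pCons split: nat.splits)
  finally have "v \<beta> \<le> s" .
  moreover have aF: "\<alpha> \<in> F" using Q.simple_ext_generator[of \<alpha>] by (simp add: F_eq)
  ultimately have "inverse (v \<alpha>) \<le> 1 / r" by (simp add: \<beta>_def v.v_inverse s_def)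
  hence "r \<le> v \<alpha>" using r1 v.v_pos[OF aF \<alpha>(2)] by (simp add: field_simps)
  hence "r ^ d \<le> v \<alpha> ^ d" using r1 by (intro power_mono) auto
  thus ?thesis using v(1) rd by (auto simp: d_def)
qed

section \<open>Bounds for the Weil height\<close>

lemma ex_primitive_int_poly:
  assumes m: "minimal_poly \<rat> \<alpha> m"
  shows "\<exists>f::int poly. content f = 1 \<and> degree f = degree m \<and>
    map_poly of_int f = smult (of_int (lead_coeff f)) m"
proof -
  have m': "m \<in> polys_over \<rat>" "lead_coeff m = 1" using m by (auto simp: minimal_poly_def)
  from m'(1) obtain g where g: "m = map_poly of_rat g" by (auto simp: polys_over_Rats_eq)
  have cm: "coeff m i = of_rat (coeff g i)" for i by (simp add: g coeff_map_poly)
  define D where "D = (\<Prod>i\<le>degree m. snd (quotient_of (coeff g i)))"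
  have D: "D \<noteq> 0"
    using quotient_of_denom_pos' by (auto simp: D_def) (metis less_irrefl)
  have "\<exists>n. of_int n = (of_int D * coeff m i :: complex)" for i
  proof (cases "i \<le> degree m")
    case True
    obtain a b where ab: "quotient_of (coeff g i) = (a, b)" by fastforce
    have "b dvd D" unfolding D_def using True ab by (metis atMost_iff dvd_prodI finite_atMost snd_conv)
    then obtain c where "D = b * c" by (elim dvdE)
    moreover have "b \<noteq> 0" using quotient_of_denom_pos[OF ab] by simp
    moreover have "coeff g i = of_int a / of_int b" using quotient_of_div[OF ab] .
    ultimately have "of_int (c * a) = (of_int D * coeff m i :: complex)"
      by (simp add: cm of_rat_divide)
    thus ?thesis by blast
  next
    case False
    thus ?thesis by (intro exI[of _ 0]) (simp add: coeff_eq_0)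
  qed
  then obtain n where n: "\<And>i. of_int (n i) = (of_int D * coeff m i :: complex)" by metis
  define f0 where "f0 = (\<Sum>i\<le>degree m. monom (n i) i)"
  have "n i = 0" if "i > degree m" for i using n[of i] that by (simp add: coeff_eq_0)
  hence cf0: "coeff f0 i = n i" for i by (simp add: f0_def coeff_sum coeff_monom)
  define c where "c = content f0"
  define f where "f = primitive_part f0"
  have f0: "f0 = smult c f" by (simp add: c_def f_def)
  have nd: "n (degree m) = D" using n[of "degree m"] m'(2) by simp
  hence "f0 \<noteq> 0" using cf0[of "degree m"] D by auto
  hence c: "c \<noteq> 0" by (simp add: c_def)
  have cf: "of_int (coeff f i) = (of_int D / of_int c * coeff m i :: complex)" for i
  proof -
    have "n i = c * coeff f i" using cf0[of i] f0 by simp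
    hence "of_int c * of_int (coeff f i) = (of_int D * coeff m i :: complex)" using n[of i] by simp
    thus ?thesis using c by (simp add: field_simps)
  qed
  have "degree f = degree m"
  proof (rule antisym)
    show "degree f \<le> degree m"
    proof (rule degree_le, intro allI impI)
      fix i assume "degree m < i"
      hence "of_int (coeff f i) = (0::complex)" by (simp add: cf coeff_eq_0)
      thus "coeff f i = 0" by simp
    qed
    have "of_int (coeff f (degree m)) \<noteq> (0::complex)" using cf[of "degree m"] m'(2) D c by simp
    thus "degree m \<le> degree f" by (intro le_degree) simp
  qed
  moreover have "content f = 1" using \<open>f0 \<noteq> 0\<close> by (simp add: f_def)
  moreover have "map_poly of_int f = smult (of_int (lead_coeff f)) m"
    using calculation(1) cf[of "degree m"] m'(2) by (intro poly_eqI) (simp add: coeff_map_poly cf)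
  ultimately show ?thesis by blast
qed

lemma number_field_simple_ext: "minimal_poly \<rat> \<alpha> m \<Longrightarrow> number_field \<alpha> m (simple_ext \<rat> \<alpha>)"
  by (simp add: number_field_def)

context number_field
begin

lemma generator_mem: "\<alpha> \<in> F"
  by (simp add: F_eq Q.simple_ext_generator)

lemma weil_height_eq:
  "real (degree m) * weil_height \<alpha> = (\<Sum>\<^sub>\<infinity>v\<in>places F. real (local_degree F v) * ln (max 1 (v \<alpha>)))"
  using degree_pos generate_field_eq_simple_ext[OF minimal] field_degree_F
  by (simp add: weil_height_def height_in_def F_eq)

text \<open>Hence only the finitely many primes dividing the leading coefficient contribute to the height.\<close>
lemma padic_integral:
  fixes f :: "int poly"
  assumes f: "degree f = degree m" "map_poly of_int f = smult (of_int (lead_coeff f)) m"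
    and p: "prime p" "\<not> int p dvd lead_coeff f" and v: "v \<in> padic_places p F"
  shows "v \<alpha> \<le> 1"
proof (rule ccontr)
  assume "\<not> ?thesis"
  hence gt: "v \<alpha> > 1" by simp
  have pl: "v \<in> places F" using v by (auto simp: padic_places_def)
  interpret v: abs_value_field F v by (rule abs_value_field_place[OF pl])
  have vint: "v (of_int n) = padic_abs p (of_int n)" for n
    using v by (auto simp: padic_places_def dest!: spec[of _ "of_int n"])
  define d where "d = degree m"
  have d: "d > 0" using degree_pos by (simp add: d_def)
  have "f \<noteq> 0" using f(1) d by (auto simp: d_def)
  hence lc: "lead_coeff f \<noteq> 0" by simp
  have dmap: "degree (map_poly of_int f :: complex poly) = d"
    unfolding f(2) using lc by (simp add: d_def)
  have "0 = poly (map_poly of_int f) \<alpha>" unfolding f(2) using m_props by simp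
  also have "\<dots> = (\<Sum>i\<le>d. of_int (coeff f i) * \<alpha> ^ i)" by (simp add: poly_altdef dmap coeff_map_poly)
  also have "\<dots> = of_int (lead_coeff f) * \<alpha> ^ d + (\<Sum>i<d. of_int (coeff f i) * \<alpha> ^ i)"
    using f(1) by (simp add: lessThan_Suc_atMost[symmetric] d_def)
  finally have eq: "of_int (lead_coeff f) * \<alpha> ^ d = - (\<Sum>i<d. of_int (coeff f i) * \<alpha> ^ i)"
    by (simp add: add_eq_0_iff2)
  have mem: "of_int (coeff f i) * \<alpha> ^ i \<in> F" for i using generator_mem by auto
  have "v \<alpha> ^ d = v (of_int (lead_coeff f) * \<alpha> ^ d)"
    using generator_mem padic_abs_of_int[OF p(1) lc] p(2)
    by (simp add: v.v_mult v.v_power power_mem vint not_dvd_imp_multiplicity_0)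
  also have "\<dots> = v (\<Sum>i<d. of_int (coeff f i) * \<alpha> ^ i)"
    unfolding eq by (rule v.v_minus) (rule sum_mem, rule mem)
  also have "\<dots> \<le> v \<alpha> ^ (d - 1)"
  proof (rule padic_place_sum[OF complex_subfield_axioms p(1) v])
    fix i assume i: "i \<in> {..<d}"
    have "v (of_int (coeff f i) * \<alpha> ^ i) = padic_abs p (of_int (coeff f i)) * v \<alpha> ^ i"
      using generator_mem by (simp add: v.v_mult v.v_power power_mem vint)
    also have "\<dots> \<le> 1 * v \<alpha> ^ (d - 1)"
      using padic_abs_of_int_le_1[OF p(1)] i gt by (intro mult_mono power_increasing) auto
    finally show "v (of_int (coeff f i) * \<alpha> ^ i) \<le> v \<alpha> ^ (d - 1)" by simp
  qed (use mem gt in auto)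
  finally have "v \<alpha> ^ d \<le> v \<alpha> ^ (d - 1)" .
  moreover have "v \<alpha> ^ (d - 1) < v \<alpha> ^ d" using gt d by (intro power_strict_increasing) auto
  ultimately show False by simp
qed

lemma finite_large_places: "finite {v \<in> places F. v \<alpha> > 1}"
proof -
  obtain f :: "int poly" where f: "content f = 1" "degree f = degree m"
    "map_poly of_int f = smult (of_int (lead_coeff f)) m" using ex_primitive_int_poly[OF minimal] by blast
  have "f \<noteq> 0" using f(1) by auto
  hence lc: "lead_coeff f \<noteq> 0" by simp
  obtain B where B: "finite B" "F \<subseteq> ratvs.span B" using ex_span by blast
  define S where "S = {p. prime p \<and> int p dvd lead_coeff f}"
  have "int ` S \<subseteq> {d. d dvd lead_coeff f}" by (auto simp: S_def)
  hence "finite (int ` S)" using finite_divisors_int[OF lc] finite_subset by blast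
  hence "finite S" by (rule finite_imageD) auto
  hence "finite (arch_places F \<union> (\<Union>p\<in>S. padic_places p F))"
    using finite_arch_places finite_padic_places[OF complex_subfield_axioms B] by (auto simp: S_def)
  moreover have "{v \<in> places F. v \<alpha> > 1} \<subseteq> arch_places F \<union> (\<Union>p\<in>S. padic_places p F)"
  proof
    fix v assume v: "v \<in> {v \<in> places F. v \<alpha> > 1}"
    show "v \<in> arch_places F \<union> (\<Union>p\<in>S. padic_places p F)"
    proof (cases "v \<in> arch_places F")
      case False
      then obtain p where p: "prime p" "v \<in> padic_places p F" using v by (auto simp: places_eq)
      hence "p \<in> S" using padic_integral[OF f(2,3) p(1) _ p(2)] v by (auto simp: S_def not_less)
      thus ?thesis using p by blast
    qed simp
  qed
  ultimately show ?thesis by (rule finite_subset[rotated])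
qed

lemma weil_height_finite_sum:
  "real (degree m) * weil_height \<alpha> = (\<Sum>v | v \<in> places F \<and> v \<alpha> > 1. real (local_degree F v) * ln (v \<alpha>))"
proof -
  have "(\<Sum>\<^sub>\<infinity>v\<in>places F. real (local_degree F v) * ln (max 1 (v \<alpha>)))
      = (\<Sum>\<^sub>\<infinity>v\<in>{v \<in> places F. v \<alpha> > 1}. real (local_degree F v) * ln (v \<alpha>))"
    by (rule infsum_cong_neutral) (auto simp: max_def)
  thus ?thesis using finite_large_places by (simp add: weil_height_eq)
qed

text \<open>Since local degrees are positive, the whole sum bounds each of its terms. For elements of
  bounded degree this crude bound suffices.\<close>
lemma ln_place_le:
  assumes v: "v \<in> places F" and gt: "v \<alpha> > 1"
  shows "ln (v \<alpha>) \<le> real (degree m) * weil_height \<alpha>"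
proof -
  have "ln (v \<alpha>) = 1 * ln (v \<alpha>)" by simp
  also have "\<dots> \<le> real (local_degree F v) * ln (v \<alpha>)"
    using local_degree_pos[OF v] gt by (intro mult_right_mono) auto
  also have "\<dots> \<le> (\<Sum>v | v \<in> places F \<and> v \<alpha> > 1. real (local_degree F v) * ln (v \<alpha>))"
    using v gt by (intro member_le_sum[OF _ _ finite_large_places]) auto
  finally show ?thesis by (simp add: weil_height_finite_sum)
qed

lemma weil_height_nonneg: "0 \<le> weil_height \<alpha>"
proof -
  have "0 \<le> real (degree m) * weil_height \<alpha>"
    unfolding weil_height_finite_sum by (intro sum_nonneg mult_nonneg_nonneg) auto
  thus ?thesis using degree_pos by (simp add: zero_le_mult_iff)
qed

lemma place_le_exp:
  assumes v: "v \<in> places F"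
  shows "v \<alpha> \<le> exp (real (degree m) * weil_height \<alpha>)"
proof (cases "v \<alpha> > 1")
  case True
  hence "v \<alpha> = exp (ln (v \<alpha>))" by simp
  also have "\<dots> \<le> exp (real (degree m) * weil_height \<alpha>)" using ln_place_le[OF v True] by simp
  finally show ?thesis .
next
  case False
  have "1 \<le> exp (real (degree m) * weil_height \<alpha>)" using weil_height_nonneg by simp
  thus ?thesis using False by linarith
qed

lemma conjugate_le_exp:
  assumes "poly m z = 0"
  shows "cmod z \<le> exp (real (degree m) * weil_height \<alpha>)"
proof -
  have "conj_place z (poly [:0, 1:] \<alpha>) = cmod (poly [:0, 1:] z)"
    using assms by (intro conj_place_poly Q.polys_over_pCons) auto
  thus ?thesis using place_le_exp[of "conj_place z"] conj_place_arch[OF assms] by (simp add: arch_places_def)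
qed

lemma lead_coeff_prime_power_le_exp:
  fixes f :: "int poly"
  assumes f: "content f = 1" "degree f = degree m" "map_poly of_int f = smult (of_int (lead_coeff f)) m"
    and p: "prime p" "int p ^ k dvd lead_coeff f" and nz: "\<alpha> \<noteq> 0"
  shows "real p ^ k \<le> exp (real (degree m) ^ 2 * weil_height \<alpha>)"
proof (cases "k = 0")
  case True
  have "1 \<le> exp (real (degree m) ^ 2 * weil_height \<alpha>)" using weil_height_nonneg by simp
  thus ?thesis using True by simp
next
  case False
  then obtain v where v: "v \<in> padic_places p F" "v \<alpha> ^ degree m \<ge> real p ^ k"
    using ex_padic_place_large[OF number_field_axioms nz f p] by blast
  have pl: "v \<in> places F" using v(1) by (auto simp: padic_places_def)
  interpret v: abs_value_field F v by (rule abs_value_field_place[OF pl])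
  have "real p ^ k \<le> v \<alpha> ^ degree m" by (rule v(2))
  also have "\<dots> \<le> exp (real (degree m) * weil_height \<alpha>) ^ degree m"
    using place_le_exp[OF pl] generator_mem by (intro power_mono) auto
  also have "\<dots> = exp (real (degree m) ^ 2 * weil_height \<alpha>)"
    by (simp add: exp_of_nat_mult[symmetric] power2_eq_square algebra_simps)
  finally show ?thesis .
qed

end

lemma coeff_prod_linear_le:
  fixes R :: real
  assumes "finite S" "\<And>z. z \<in> S \<Longrightarrow> cmod z \<le> R" "R \<ge> 0"
  shows "cmod (coeff (\<Prod>z\<in>S. [:-z, 1:]) i) \<le> (1 + R) ^ card S"
  using assms(1,2)
proof (induction S arbitrary: i rule: finite_induct)
  case empty
  thus ?case by (simp add: coeff_1)
next
  case (insert z S)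
  define P where "P = (\<Prod>z\<in>S. [:-z, 1:])"
  have IH: "cmod (coeff P i) \<le> (1 + R) ^ card S" for i using insert unfolding P_def by auto
  have shift: "cmod (coeff (pCons 0 P) i) \<le> (1 + R) ^ card S"
    using IH assms(3) by (cases i) (auto simp: coeff_pCons)
  have "[:-z, 1:] * P = smult (-z) P + pCons 0 P" by simp
  hence "cmod (coeff ([:-z, 1:] * P) i) \<le> cmod z * cmod (coeff P i) + cmod (coeff (pCons 0 P) i)"
    by (metis coeff_add coeff_smult norm_minus_cancel norm_mult norm_triangle_ineq)
  also have "\<dots> \<le> R * (1 + R) ^ card S + (1 + R) ^ card S"
    using insert.prems[of z] IH shift assms(3) by (intro add_mono mult_mono) auto
  also have "\<dots> = (1 + R) ^ card (insert z S)" using insert.hyps by (simp add: algebra_simps)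
  finally show ?case using insert.hyps by (simp add: P_def)
qed

lemma finite_int_polys_bounded: "finite {f :: int poly. degree f \<le> D \<and> (\<forall>i. \<bar>coeff f i\<bar> \<le> M)}"
proof -
  define L where "L = {xs :: int list. set xs \<subseteq> {-M..M} \<and> length xs = Suc D}"
  have "finite L" unfolding L_def by (rule finite_lists_length_eq) simp
  moreover have "{f :: int poly. degree f \<le> D \<and> (\<forall>i. \<bar>coeff f i\<bar> \<le> M)} \<subseteq> Poly ` L"
  proof
    fix f :: "int poly" assume f: "f \<in> {f. degree f \<le> D \<and> (\<forall>i. \<bar>coeff f i\<bar> \<le> M)}"
    define xs where "xs = map (coeff f) [0..<Suc D]"
    have "f = Poly xs"
    proof (rule poly_eqI)
      fix i show "coeff f i = coeff (Poly xs) i"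
      proof (cases "i \<le> D")
        case True
        hence "xs ! i = coeff f i" unfolding xs_def by (simp del: upt_Suc)
        thus ?thesis using True by (simp add: coeff_Poly_eq nth_default_def xs_def del: upt_Suc)
      next
        case False
        thus ?thesis using f by (simp add: coeff_Poly_eq nth_default_def xs_def coeff_eq_0 del: upt_Suc)
      qed
    qed
    moreover have "xs \<in> L" using f by (auto simp: L_def xs_def abs_le_iff simp del: upt_Suc) (smt (verit))
    ultimately show "f \<in> Poly ` L" by blast
  qed
  ultimately show ?thesis by (meson finite_imageI finite_subset)
qed

text \<open>Northcott's theorem: bounded height bounds the conjugates and all prime powers dividing the
  leading coefficient, hence all coefficients of the primitive minimal polynomial.\<close>
theorem finite_bounded_degree_height:
  "finite {\<alpha>. \<alpha> \<noteq> 0 \<and> (\<exists>g\<in>polys_over \<rat>. g \<noteq> 0 \<and> degree g \<le> D \<and> poly g \<alpha> = 0) \<and> weil_height \<alpha> < T}"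
    (is "finite ?A")
proof -
  define T' where "T' = max T 0"
  define R where "R = exp (real D * T')"
  define B where "B = nat \<lfloor>exp (real D ^ 2 * T')\<rfloor>"
  define M where "M = \<lceil>fact B * (1 + R) ^ D\<rceil>"
  define P where "P = {f :: int poly. degree f \<le> D \<and> (\<forall>i. \<bar>coeff f i\<bar> \<le> M)}"
  have R: "R \<ge> 0" by (simp add: R_def)
  have "?A \<subseteq> (\<Union>f\<in>P - {0}. {z. poly (map_poly of_int f) z = (0::complex)})"
  proof
    fix \<alpha> assume "\<alpha> \<in> ?A"
    then obtain g where g: "\<alpha> \<noteq> 0" "g \<in> polys_over \<rat>" "g \<noteq> 0" "degree g \<le> D" "poly g \<alpha> = 0" "weil_height \<alpha> < T" by blast
    obtain m where m: "minimal_poly \<rat> \<alpha> m" "degree m \<le> degree g"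
      using complex_subfield.ex_minimal_poly[OF complex_subfield_Rats g(2,3,5)] by blast
    interpret number_field \<alpha> m "simple_ext \<rat> \<alpha>" by (rule number_field_simple_ext[OF m(1)])
    obtain f :: "int poly" where f: "content f = 1" "degree f = degree m"
      "map_poly of_int f = smult (of_int (lead_coeff f)) m" using ex_primitive_int_poly[OF m(1)] by blast
    have dm: "degree m \<le> D" using m g by simp
    have hT: "weil_height \<alpha> \<le> T'" using g by (simp add: T'_def)
    have T': "T' \<ge> 0" by (simp add: T'_def)
    have zR: "cmod z \<le> R" if "poly m z = 0" for z
    proof -
      have "real (degree m) * weil_height \<alpha> \<le> real D * T'"
        using dm hT weil_height_nonneg by (intro mult_mono) auto
      thus ?thesis using conjugate_le_exp[OF that] unfolding R_def by (meson exp_le_cancel_iff order_trans)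
    qed
    have "f \<noteq> 0" using f(1) by auto
    hence lc: "lead_coeff f \<noteq> 0" by simp
    have "lead_coeff f dvd int (fact B)"
    proof (rule multiplicity_le_imp_dvd[OF lc])
      fix q :: int assume q: "prime q"
      define p where "p = nat q"
      have p: "prime p" "q = int p" using q prime_gt_0_int[OF q] by (auto simp: p_def)
      define k where "k = multiplicity q (lead_coeff f)"
      have "int p ^ k dvd lead_coeff f" using p by (simp add: k_def multiplicity_dvd)
      from lead_coeff_prime_power_le_exp[OF f p(1) this g(1)]
      have "real p ^ k \<le> exp (real (degree m) ^ 2 * weil_height \<alpha>)" .
      also have "real (degree m) ^ 2 * weil_height \<alpha> \<le> real D ^ 2 * T'"
        using dm hT weil_height_nonneg by (intro mult_mono power_mono) auto
      hence "exp (real (degree m) ^ 2 * weil_height \<alpha>) \<le> exp (real D ^ 2 * T')" by simp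
      finally have "real (p ^ k) \<le> exp (real D ^ 2 * T')" by simp
      hence "p ^ k \<le> B" unfolding B_def by (simp add: le_nat_floor)
      hence "p ^ k dvd fact B" using prime_gt_0_nat[OF p(1)] by (intro dvd_fact) (auto simp: Suc_le_eq)
      hence "int (p ^ k) dvd int (fact B)" by (simp only: int_dvd_int_iff)
      hence "q ^ k dvd int (fact B)" by (simp add: p(2))
      thus "multiplicity q (lead_coeff f) \<le> multiplicity q (int (fact B))"
        using q unfolding k_def[symmetric] by (intro multiplicity_geI) (auto simp: prime_elem_not_unit)
    qed
    hence lcB: "\<bar>lead_coeff f\<bar> \<le> fact B" by (metis abs_of_nonneg dvd_imp_le_int fact_nonzero fact_ge_zero of_nat_fact)
    have "\<bar>coeff f i\<bar> \<le> M" for i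
    proof -
      have rt: "finite {z. poly m z = 0}" "card {z. poly m z = 0} = degree m" "m = (\<Prod>z | poly m z = 0. [:-z, 1:])"
        using Q.minimal_poly_roots[OF m(1)] by auto
      have "of_int (coeff f i) = (of_int (lead_coeff f) * coeff m i :: complex)"
        using arg_cong[OF f(3), of "\<lambda>q. coeff q i"] by (simp add: coeff_map_poly)
      hence "real_of_int \<bar>coeff f i\<bar> = real_of_int \<bar>lead_coeff f\<bar> * cmod (coeff m i)"
        by (metis norm_mult norm_of_int of_int_abs)
      also have "\<dots> \<le> fact B * (1 + R) ^ D"
      proof (rule mult_mono)
        show "real_of_int \<bar>lead_coeff f\<bar> \<le> fact B" using lcB by (metis of_int_fact of_int_le_iff)
        have "cmod (coeff m i) \<le> (1 + R) ^ degree m"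
          using coeff_prod_linear_le[OF rt(1) _ R, of i] zR rt(2,3) by simp
        also have "\<dots> \<le> (1 + R) ^ D" using dm R by (intro power_increasing) auto
        finally show "cmod (coeff m i) \<le> (1 + R) ^ D" .
      qed auto
      finally show ?thesis unfolding M_def by linarith
    qed
    hence "f \<in> P - {0}" using f dm \<open>f \<noteq> 0\<close> by (simp add: P_def)
    moreover have "poly (map_poly of_int f) \<alpha> = 0" unfolding f(3) using m_props by simp
    ultimately show "\<alpha> \<in> (\<Union>f\<in>P - {0}. {z. poly (map_poly of_int f) z = (0::complex)})" by blast
  qed
  moreover have "finite (\<Union>f\<in>P - {0}. {z. poly (map_poly of_int f) z = (0::complex)})"
  proof (intro finite_UN_I)
    show "finite (P - {0})" unfolding P_def using finite_int_polys_bounded by simp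
    fix f :: "int poly" assume "f \<in> P - {0}"
    hence "f \<noteq> 0" by simp
    hence "map_poly of_int f \<noteq> (0 :: complex poly)" by (simp add: map_poly_eq_0_iff)
    thus "finite {z. poly (map_poly of_int f) z = (0::complex)}" by (rule poly_roots_finite)
  qed
  ultimately show ?thesis by (rule finite_subset)
qed

text \<open>Only the Archimedean places contribute, as a unit has value 1 at all others. There are at most
  as many of them as the degree, and their local degrees are at most 2.\<close>
theorem weil_height_radical_of_unit:
  assumes n: "n > 0" and \<beta>: "\<beta> ^ n = u" "u ^ 2 + 6 * u + 1 = 0"
  shows "weil_height \<beta> \<le> 2 * ln 7 / real n"
proof -
  have alg: "algebraic \<beta>"
  proof (rule algebraicI)
    define g :: "complex poly" where "g = monom 1 (2 * n) + monom 6 n + 1"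
    show "coeff g i \<in> \<int>" for i by (simp add: g_def coeff_monom coeff_1)
    have "coeff g 0 = 1" using n by (simp add: g_def coeff_monom)
    thus "g \<noteq> 0" by auto
    show "poly g \<beta> = 0"
      using \<beta> by (simp add: g_def poly_monom power_mult mult.commute[of 2 n])
  qed
  obtain m where m: "minimal_poly \<rat> \<beta> m" using algebraic_minimal_poly[OF alg] by blast
  define F where "F = simple_ext \<rat> \<beta>"
  interpret number_field \<beta> m F unfolding F_def by (rule number_field_simple_ext[OF m])
  have uF: "u \<in> F" using generator_mem \<beta> by auto
  have u2: "u ^ 2 = - (of_nat 6 * u + 1)" using \<beta>(2) by (simp add: eq_neg_iff_add_eq_0 algebra_simps)
  have mem: "of_nat 6 * u + 1 \<in> F" using uF of_nat_mem[of 6] by (intro add_mem mult_mem) simp_all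
  have six: "6 \<in> F" using of_nat_mem[of 6] by simp
  have arch: "v \<beta> > 1 \<Longrightarrow> v \<in> arch_places F" and small: "v \<in> arch_places F \<Longrightarrow> v \<beta> > 1 \<Longrightarrow> ln (v \<beta>) \<le> ln 7 / n"
    if v: "v \<in> places F" for v
  proof -
    interpret v: abs_value_field F v by (rule abs_value_field_place[OF v])
    have vn: "v \<beta> ^ n = v u" using v.v_power[OF generator_mem, of n] \<beta>(1) by simp
    have v2: "v u ^ 2 = v (of_nat 6 * u + 1)"
      using v.v_power[OF uF, of 2] u2 v.v_minus[OF mem] by simp
    show "v \<in> arch_places F" if gt: "v \<beta> > 1"
    proof (rule ccontr)
      assume "v \<notin> arch_places F"
      then obtain p where p: "prime p" "v \<in> padic_places p F" using v by (auto simp: places_eq)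
      have "v (of_nat 6) \<le> 1"
        using p padic_abs_of_int_le_1[OF p(1), of 6] by (auto simp: padic_places_def dest!: spec[of _ 6])
      hence "v (of_nat 6 * u) \<le> 1 * v u" unfolding v.v_mult[OF of_nat_mem uF] using uF
        by (intro mult_right_mono) auto
      hence "v u ^ 2 \<le> max (v u) 1"
        using padic_place_ultrametric[OF complex_subfield_axioms p, of "of_nat 6 * u" 1] uF v2 mult_mem[OF six uF]
        by auto
      moreover have "v u > 1" using gt n vn by (metis one_less_power)
      ultimately have "v u * v u \<le> v u * 1" by (simp add: power2_eq_square)
      thus False using \<open>v u > 1\<close> by simp
    qed
    show "ln (v \<beta>) \<le> ln 7 / n" if "v \<in> arch_places F" "v \<beta> > 1"
    proof -
      have "v (of_nat 6) = 6" using that(1) by (auto simp: arch_places_def dest!: spec[of _ 6])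
      hence "v u ^ 2 \<le> 6 * v u + 1"
        unfolding v2 using v.v_add[of "of_nat 6 * u" 1] uF six mult_mem[OF six uF] by (simp add: v.v_mult)
      \<comment> \<open>Any bound for the solutions of \<open>x^2 \<le> 6 x + 1\<close> would do.\<close>
      have "v u \<le> 7"
      proof (rule ccontr)
        assume "\<not> v u \<le> 7"
        hence "7 * v u \<le> v u * v u" by (intro mult_right_mono) auto
        thus False using \<open>v u ^ 2 \<le> 6 * v u + 1\<close> \<open>\<not> v u \<le> 7\<close> unfolding power2_eq_square by linarith
      qed
      moreover have "0 < v u" unfolding vn[symmetric] using that(2) by simp
      ultimately have "ln (v \<beta> ^ n) \<le> ln 7" unfolding vn by simp
      thus ?thesis using that(2) n by (simp add: ln_realpow field_simps)
    qed
  qed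
  define S where "S = {v. v \<in> places F \<and> v \<beta> > 1}"
  have SA: "S \<subseteq> arch_places F" using arch by (auto simp: S_def)
  have "real (degree m) * weil_height \<beta> = (\<Sum>v\<in>S. real (local_degree F v) * ln (v \<beta>))"
    unfolding S_def by (rule weil_height_finite_sum)
  also have "\<dots> \<le> (\<Sum>v\<in>S. 2 * (ln 7 / n))"
    using SA small local_degree_arch by (intro sum_mono mult_mono) (auto simp: S_def)
  also have "\<dots> = real (card S) * (2 * (ln 7 / n))" by simp
  also have "\<dots> \<le> real (degree m) * (2 * (ln 7 / n))"
    using card_mono[OF finite_arch_places SA] card_arch_places by (intro mult_right_mono) auto
  finally have "real (degree m) * weil_height \<beta> \<le> real (degree m) * (2 * ln 7 / real n)" by simp
  thus ?thesis using degree_pos by (subst (asm) mult_le_cancel_left_pos) auto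
qed

section \<open>Real radical extensions of prime degree\<close>

text \<open>All conjugates of a real radical have the same absolute value, so the constant coefficient
  of its minimal polynomial is, up to sign, a power of the radical.\<close>
lemma radical_minimal_degree:
  fixes t :: real
  assumes M: "complex_subfield M" "M \<subseteq> \<real>" and n: "prime n"
    and t: "t > 0" "of_real t ^ n \<in> M" "of_real t \<notin> M"
    and g: "g \<in> polys_over M" "degree g < n" "poly g (of_real t) = 0"
  shows "g = 0"
proof (rule ccontr)
  assume "g \<noteq> 0"
  interpret complex_subfield M by fact
  define \<theta> where "\<theta> = complex_of_real t"
  obtain m where m: "minimal_poly M \<theta> m" "degree m \<le> degree g"
    using ex_minimal_poly[OF g(1) \<open>g \<noteq> 0\<close> g(3)] by (auto simp: \<theta>_def)
  define d where "d = degree m"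
  have d: "0 < d" "d < n" using minimal_poly_degree_pos[OF m(1)] m(2) g(2) by (auto simp: d_def)
  define h where "h = monom 1 n - [:\<theta> ^ n:]"
  have "h \<in> polys_over M" "poly h \<theta> = 0"
    using t(2) by (auto simp: h_def \<theta>_def poly_monom intro!: polys_over_closed)
  from minimal_poly_dvd[OF m(1) this] obtain q where q: "h = m * q" by blast
  have root: "cmod z = t" if "poly m z = 0" for z
  proof -
    have "poly h z = 0" using that q by simp
    hence "z ^ n = \<theta> ^ n" by (simp add: h_def poly_monom)
    hence "cmod z ^ n = t ^ n" using t(1) by (metis \<theta>_def norm_of_real norm_power abs_of_pos)
    thus ?thesis using t(1) n by (metis norm_ge_zero less_imp_le power_eq_imp_eq_base prime_gt_0_nat)
  qed
  have cm: "cmod (coeff m 0) = t ^ d"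
    unfolding d_def by (rule minimal_poly_norm_coeff_0[OF m(1) root])
  have c0: "coeff m 0 \<in> M" using m(1) by (auto simp: minimal_poly_def polys_overD)
  then obtain x where x: "coeff m 0 = of_real x" using M(2) by (auto elim: Reals_cases)
  hence "x = t ^ d \<or> x = - (t ^ d)" using cm by auto
  hence "\<theta> ^ d = coeff m 0 \<or> \<theta> ^ d = - coeff m 0" using x by (auto simp: \<theta>_def)
  hence \<theta>d: "\<theta> ^ d \<in> M" using c0 by auto
  have "coprime d n" using n d by (metis coprime_commute prime_imp_coprime nat_dvd_not_less)
  then obtain a b where ab: "d * a = n * b + 1" using bezout_nat[of d n] d by auto
  have "(\<theta> ^ d) ^ a = \<theta> ^ (n * b + 1)" using ab by (simp flip: power_mult)
  also have "\<dots> = (\<theta> ^ n) ^ b * \<theta>" by (simp add: power_add power_mult)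
  finally have "(\<theta> ^ d) ^ a = (\<theta> ^ n) ^ b * \<theta>" .
  moreover have "\<theta> \<noteq> 0" using t by (simp add: \<theta>_def)
  ultimately have "\<theta> = (\<theta> ^ d) ^ a / (\<theta> ^ n) ^ b" by simp
  moreover have "(\<theta> ^ d) ^ a / (\<theta> ^ n) ^ b \<in> M" using \<theta>d t(2) by (auto simp: \<theta>_def)
  ultimately show False using t(3) by (simp add: \<theta>_def)
qed

lemma degree_pure: "n > 0 \<Longrightarrow> degree (monom 1 n - [:a:] :: complex poly) = n"
  unfolding diff_conv_add_uminus by (subst degree_add_eq_left) (auto simp: degree_monom_eq)

lemma radical_algebraic:
  assumes "algebraic (x ^ n)" "n > 0"
  shows "algebraic (x::complex)"
proof (rule algebraic_root[OF assms(1)])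
  show "poly (monom 1 n) x = x ^ n" by (simp add: poly_monom)
qed (use assms(2) in \<open>simp_all add: coeff_monom degree_monom_eq\<close>)

lemma radical_minimal_poly:
  fixes t :: real
  assumes M: "complex_subfield M" "M \<subseteq> \<real>" and n: "prime n"
    and t: "t > 0" "of_real t ^ n \<in> M" "of_real t \<notin> M"
  shows "minimal_poly M (of_real t) (monom 1 n - [:of_real t ^ n:])"
proof -
  interpret complex_subfield M by fact
  define h where "h = monom 1 n - [:complex_of_real t ^ n:]"
  have n0: "n > 0" using prime_gt_0_nat[OF n] .
  have "degree h = n" unfolding h_def using n0 by (rule degree_pure)
  moreover have "coeff h n = 1" using n0 by (cases n) (auto simp: h_def)
  moreover have "h \<in> polys_over M" using t by (auto simp: h_def intro!: polys_over_closed)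
  moreover have "n \<le> degree g" if "g \<in> polys_over M" "poly g (of_real t) = 0" "g \<noteq> 0" for g
    using radical_minimal_degree[OF M n t that(1) _ that(2)] that(3) by (meson not_le)
  ultimately show ?thesis by (auto simp: minimal_poly_def h_def poly_monom)
qed

lemma simple_ext_real:
  assumes "k \<subseteq> \<real>" "x \<in> \<real>"
  shows "simple_ext k x \<subseteq> \<real>"
proof
  fix y assume "y \<in> simple_ext k x"
  then obtain p where p: "p \<in> polys_over k" "y = poly p x" by (auto simp: simple_ext_def)
  hence "p \<in> polys_over \<real>" using polys_over_mono[OF assms(1)] by blast
  thus "y \<in> \<real>" using complex_subfield.poly_mem[OF complex_subfield_Reals _ assms(2)] p by simp
qed

lemma algebraic_minimal_poly_over:
  assumes "complex_subfield k" "algebraic y"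
  shows "\<exists>m. minimal_poly k y m"
proof -
  interpret complex_subfield k by fact
  obtain g where "g \<in> polys_over \<rat>" "g \<noteq> 0" "poly g y = 0"
    using assms(2) by (auto simp: algebraic_iff_polys_over_Rats)
  thus ?thesis using ex_minimal_poly[of g y] polys_over_mono[OF Rats_subset] by blast
qed

text \<open>Over the field generated by \<open>y\<close>, the expansion of \<open>y\<close> in powers of the radical is a relation of
  degree less than \<open>n\<close>. So this field contains the radical, and a real radical extension of prime
  degree has no intermediate fields.\<close>
lemma radical_in_simple_ext:
  fixes t :: real
  assumes k: "complex_subfield k" "k \<subseteq> \<real>" and n: "prime n"
    and t: "t > 0" "of_real t ^ n \<in> k" "of_real t \<notin> k"
    and y: "y \<in> simple_ext k (of_real t)" "y \<notin> k" "algebraic y"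
  shows "of_real t \<in> simple_ext k y"
proof (rule ccontr)
  assume notin: "of_real t \<notin> simple_ext k y"
  interpret complex_subfield k by fact
  obtain my where my: "minimal_poly k y my" using algebraic_minimal_poly_over[OF k(1) y(3)] by blast
  define M where "M = simple_ext k y"
  interpret M: complex_subfield M unfolding M_def by (rule simple_ext_subfield[OF my])
  have "y \<in> \<real>" using y(1) simple_ext_real[OF k(2), of "of_real t"] by auto
  hence MR: "M \<subseteq> \<real>" unfolding M_def by (rule simple_ext_real[OF k(2)])
  have kM: "k \<subseteq> M" unfolding M_def by (rule simple_ext_superset)
  have yM: "y \<in> M" unfolding M_def by (rule simple_ext_generator)
  note mp = radical_minimal_poly[OF k n t]
  have n2: "n \<ge> 2" using prime_ge_2_nat[OF n] .
  have dm: "degree (monom 1 n - [:complex_of_real t ^ n:]) = n" using n2 by (intro degree_pure) simp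
  obtain p where p: "p \<in> polys_over k" "degree p < n" "y = poly p (of_real t)"
    using simple_ext_reduced[OF mp y(1)] unfolding dm by blast
  have "p - [:y:] = 0"
  proof (rule radical_minimal_degree[OF M.complex_subfield_axioms MR n t(1)])
    show "complex_of_real t ^ n \<in> M" using t(2) kM by blast
    show "complex_of_real t \<notin> M" using notin by (simp add: M_def)
    show "p - [:y:] \<in> polys_over M" using p(1) polys_over_mono[OF kM] yM
      by (intro M.polys_over_diff M.polys_over_pCons) auto
    show "degree (p - [:y:]) < n" using p(2) n2 by (intro degree_diff_less) auto
    show "poly (p - [:y:]) (complex_of_real t) = 0" using p(3) by simp
  qed
  hence "y = coeff p 0" by (metis coeff_pCons_0 right_minus_eq)
  thus False using polys_overD[OF p(1), of 0] y(2) by simp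
qed

text \<open>The trace of a radical outside \<open>k\<close> is the sum of all roots of its pure equation, so it
  vanishes. If no product of \<open>s\<close> with a power of \<open>t\<close> were in \<open>k\<close>, then expanding
  \<open>1 = s * (1 / s)\<close> in powers of \<open>t\<close> would show that the trace of 1 vanishes.\<close>
lemma radicals_in_same_field:
  fixes s t :: real
  assumes k: "complex_subfield k" "k \<subseteq> \<real>" "\<And>x. x \<in> k \<Longrightarrow> algebraic x"
    and n: "prime n"
    and t: "t > 0" "of_real t ^ n \<in> k" "of_real t \<notin> k"
    and s: "s > 0" "of_real s ^ n \<in> k" "of_real s \<in> simple_ext k (of_real t)"
  shows "\<exists>i<n. of_real s * of_real t ^ i \<in> k"
proof (rule ccontr)
  assume neg: "\<not> ?thesis"
  interpret complex_subfield k by fact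
  define \<theta> where "\<theta> = complex_of_real t"
  define \<sigma> where "\<sigma> = complex_of_real s"
  define Z where "Z = {z. z ^ n = \<theta> ^ n}"
  have n2: "n \<ge> 2" using prime_ge_2_nat[OF n] .
  have \<theta>0: "\<theta> \<noteq> 0" "\<sigma> \<noteq> 0" using t s by (auto simp: \<theta>_def \<sigma>_def)
  have Z: "finite Z" "card Z = n" using card_nth_roots[of "\<theta> ^ n" n] finite_nth_roots[of n "\<theta> ^ n"] \<theta>0 n2
    by (auto simp: Z_def)
  have mp: "minimal_poly k \<theta> (monom 1 n - [:\<theta> ^ n:])" unfolding \<theta>_def by (rule radical_minimal_poly[OF k(1,2) n t])
  have dm: "degree (monom 1 n - [:\<theta> ^ n:]) = n" using n2 by (intro degree_pure) simp
  have vanish: "poly p z = 0" if "p \<in> polys_over k" "poly p \<theta> = 0" "z \<in> Z" for p z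
  proof -
    from minimal_poly_dvd[OF mp that(1,2)] obtain q where "p = (monom 1 n - [:\<theta> ^ n:]) * q" by blast
    thus ?thesis using that(3) by (simp add: Z_def poly_monom)
  qed
  interpret E: complex_subfield "simple_ext k \<theta>" by (rule simple_ext_subfield[OF mp])
  have trace0: "(\<Sum>z\<in>Z. poly p z) = 0"
    if p: "p \<in> polys_over k" "poly p \<theta> = of_real r" and r: "r > 0" "of_real r ^ n \<in> k" "of_real r \<notin> k" for p r
  proof -
    define \<rho> where "\<rho> = complex_of_real r"
    have "algebraic (\<rho> ^ n)" unfolding \<rho>_def by (rule k(3)[OF r(2)])
    hence alg: "algebraic \<rho>" by (rule radical_algebraic) (use n2 in simp)
    have "\<rho> \<in> simple_ext k \<theta>" unfolding simple_ext_def \<rho>_def using p by (intro image_eqI[of _ _ p]) auto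
    hence "\<theta> \<in> simple_ext k \<rho>" using radical_in_simple_ext[OF k(1,2) n t, of \<rho>] r(3) alg
      by (simp add: \<theta>_def \<rho>_def)
    then obtain h where h: "h \<in> polys_over k" "\<theta> = poly h \<rho>" by (auto simp: simple_ext_def)
    have img: "poly p z ^ n = \<rho> ^ n" if z: "z \<in> Z" for z
    proof -
      have "poly (p ^ n - [:\<rho> ^ n:]) z = 0"
      proof (rule vanish[OF _ _ z])
        show "p ^ n - [:\<rho> ^ n:] \<in> polys_over k" unfolding \<rho>_def
          by (intro polys_over_diff polys_over_power polys_over_pCons polys_over_0 p(1) r(2))
        show "poly (p ^ n - [:\<rho> ^ n:]) \<theta> = 0" using p(2) by (simp add: \<rho>_def poly_power)
      qed
      thus ?thesis by (simp add: poly_power)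
    qed
    have left_inv: "poly h (poly p z) = z" if z: "z \<in> Z" for z
    proof -
      have "poly (pcompose h p - [:0, 1:]) z = 0"
      proof (rule vanish[OF _ _ z])
        show "pcompose h p - [:0, 1:] \<in> polys_over k"
          by (intro polys_over_diff polys_over_pcompose polys_over_pCons polys_over_0 p(1) h(1)) simp_all
        show "poly (pcompose h p - [:0, 1:]) \<theta> = 0" using p(2) h(2) by (simp add: \<rho>_def poly_pcompose)
      qed
      thus ?thesis by (simp add: poly_pcompose)
    qed
    have inj: "inj_on (poly p) Z" by (rule inj_on_inverseI[of _ "poly h"]) (rule left_inv)
    have "poly p ` Z = {w. w ^ n = \<rho> ^ n}"
    proof (rule card_subset_eq)
      show "finite {w. w ^ n = \<rho> ^ n}" using n2 by (intro finite_nth_roots) simp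
      show "poly p ` Z \<subseteq> {w. w ^ n = \<rho> ^ n}" using img by auto
      have "\<rho> \<noteq> 0" using r by (simp add: \<rho>_def)
      thus "card (poly p ` Z) = card {w. w ^ n = \<rho> ^ n}"
        using card_image[OF inj] Z(2) card_nth_roots[of "\<rho> ^ n" n] n2 by simp
    qed
    hence "(\<Sum>z\<in>Z. poly p z) = \<Sum>{w. w ^ n = \<rho> ^ n}"
      using sum.reindex[OF inj, of "\<lambda>w. w"] by simp
    also have "\<dots> = 0" using n2 by (intro sum_nth_roots) simp
    finally show ?thesis .
  qed
  obtain g where g: "g \<in> polys_over k" "\<sigma> = poly g \<theta>"
    using s(3) by (auto simp: simple_ext_def \<theta>_def \<sigma>_def)
  have "inverse \<sigma> \<in> simple_ext k \<theta>" using s(3) by (intro E.inverse_mem) (simp add: \<theta>_def \<sigma>_def)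
  then obtain q where q: "q \<in> polys_over k" "degree q < n" "inverse \<sigma> = poly q \<theta>"
    using simple_ext_reduced[OF mp] unfolding dm by blast
  have "(\<Sum>z\<in>Z. poly (g * q) z) = (\<Sum>z\<in>Z. 1)"
  proof (rule sum.cong)
    fix z assume z: "z \<in> Z"
    have "poly (g * q - 1) \<theta> = 0" using g(2) q(3) \<theta>0 by (metis poly_mult poly_diff poly_1 right_inverse diff_self)
    hence "poly (g * q - 1) z = 0"
      by (rule vanish[OF polys_over_diff[OF polys_over_mult[OF g(1) q(1)] polys_over_1] _ z])
    thus "poly (g * q) z = 1" by simp
  qed simp
  moreover have "(\<Sum>z\<in>Z. poly (g * q) z) = (\<Sum>i\<le>degree q. coeff q i * (\<Sum>z\<in>Z. poly (g * monom 1 i) z))"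
    unfolding sum_distrib_left
    by (subst sum.swap) (simp add: poly_altdef[of q] poly_monom sum_distrib_left algebra_simps)
  moreover have "(\<Sum>z\<in>Z. poly (g * monom 1 i) z) = 0" if "i \<le> degree q" for i
  proof (rule trace0[of _ "s * t ^ i"])
    show "g * monom 1 i \<in> polys_over k" by (intro polys_over_mult polys_over_monom g(1) one_mem)
    show "poly (g * monom 1 i) \<theta> = of_real (s * t ^ i)" using g by (simp add: poly_monom \<theta>_def \<sigma>_def)
    show "s * t ^ i > 0" using s t by simp
    have "complex_of_real (s * t ^ i) ^ n = of_real s ^ n * (of_real t ^ n) ^ i"
      by (simp add: power_mult_distrib mult.commute flip: power_mult)
    thus "complex_of_real (s * t ^ i) ^ n \<in> k" using s t by auto
    show "complex_of_real (s * t ^ i) \<notin> k" using neg that q(2) by simp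
  qed
  ultimately have "of_nat n = (0::complex)" using Z by simp
  thus False using n2 by simp
qed

section \<open>Choosing a radical of large height\<close>

lemma padic_abs_power: "prime p \<Longrightarrow> padic_abs p (r ^ n) = padic_abs p r ^ n"
  by (induction n) (simp_all add: padic_abs_mult)

lemma padic_abs_power_neq:
  assumes p: "prime p" and n: "n \<ge> 2"
  shows "padic_abs p (r ^ n) \<noteq> 1 / real p"
proof
  assume eq: "padic_abs p (r ^ n) = 1 / real p"
  have p1: "real p > 1" using prime_gt_1_nat[OF p] by simp
  have "r \<noteq> 0" using eq p1 n by (auto simp: power_0_left)
  then obtain j where j: "padic_abs p r = real p powi j" by (auto simp: padic_abs_def)
  have "real p powi (j * int n) = real p powi (-1)"
    using eq j by (simp add: padic_abs_power[OF p] power_int_mult power_int_minus inverse_eq_divide)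
  hence "j * int n = -1"
    using p1 power_int_strict_increasing[of "j * int n" "-1" "real p"]
      power_int_strict_increasing[of "-1" "j * int n" "real p"] by (metis less_irrefl linorder_neqE)
  hence "int n dvd 1" by (metis dvd_minus_iff dvd_triv_right)
  thus False using n by simp
qed

lemma prime_ratio_root_irrational:
  assumes q: "prime (q::nat)" "prime q'" "q \<noteq> q'" and n: "n \<ge> 2"
    and r: "r ^ n = of_nat q / of_nat q'"
  shows "(r::complex) \<notin> \<rat>"
proof
  assume "r \<in> \<rat>"
  then obtain x where x: "r = of_rat x" by (auto elim: Rats_cases)
  have "of_rat (x ^ n * of_nat q') = (of_rat (of_nat q) :: complex)"
    using r prime_gt_0_nat[OF q(2)] by (simp add: x of_rat_mult of_rat_power)
  hence eq: "x ^ n * of_nat q' = of_nat q" by (simp only: of_rat_eq_iff)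
  have "\<not> q dvd q'" using q by (metis primes_dvd_imp_eq)
  hence "multiplicity (int q) (int q') = 0" by (intro not_dvd_imp_multiplicity_0) simp
  hence "padic_abs q (of_nat q') = 1"
    using padic_abs_of_int[OF q(1), of "int q'"] prime_gt_0_nat[OF q(2)] by simp
  moreover have "padic_abs q (of_nat q) = 1 / real q"
    using padic_abs_of_int[OF q(1), of "int q"] prime_gt_1_nat[OF q(1)]
    by (simp add: multiplicity_self)
  ultimately have "padic_abs q (x ^ n) = 1 / real q"
    using arg_cong[OF eq, of "padic_abs q"] by (simp add: padic_abs_mult[OF q(1)])
  thus False using padic_abs_power_neq[OF q(1) n] by simp
qed

definition real_number_field :: "complex set \<Rightarrow> bool" where
  "real_number_field k \<longleftrightarrow> complex_subfield k \<and> k \<subseteq> \<real> \<and> (\<exists>B. finite B \<and> k \<subseteq> ratvs.span B)"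

lemma number_field_bounded_degree:
  assumes "complex_subfield k" "finite B" "k \<subseteq> ratvs.span B" "x \<in> k"
  shows "\<exists>g\<in>polys_over \<rat>. g \<noteq> 0 \<and> degree g \<le> card B \<and> poly g x = 0"
proof (rule ratvs_dependent_poly[OF assms(2)])
  show "x ^ i \<in> ratvs.span B" for i using complex_subfield.power_mem[OF assms(1,4), of i] assms(3) by blast
qed

lemma real_number_field_algebraic: "real_number_field k \<Longrightarrow> x \<in> k \<Longrightarrow> algebraic x"
  using number_field_bounded_degree unfolding real_number_field_def algebraic_iff_polys_over_Rats by metis

lemma real_number_field_simple_ext:
  assumes k: "real_number_field k" and x: "x \<in> \<real>" "algebraic x"
  shows "real_number_field (simple_ext k x)"
proof -
  have k': "complex_subfield k" "k \<subseteq> \<real>" using k by (auto simp: real_number_field_def)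
  obtain B where B: "finite B" "k \<subseteq> ratvs.span B" using k by (auto simp: real_number_field_def)
  obtain m where m: "minimal_poly k x m" using algebraic_minimal_poly_over[OF k'(1) x(2)] by blast
  show ?thesis unfolding real_number_field_def
    using complex_subfield.simple_ext_subfield[OF k'(1) m] simple_ext_real[OF k'(2) x(1)]
      simple_ext_span[OF k'(1) m B] by blast
qed

text \<open>By Northcott's theorem the elements of small height in all the extensions \<open>k ((c q)^{1/n})\<close>
  form a finite set. If every prime \<open>q\<close> were bad, one such element would generate infinitely many
  of these extensions. Then two radicals differ from the same power of a third one by elements of
  \<open>k\<close>, and their quotient would be an element of \<open>k\<close> of degree \<open>n\<close> over the rationals.\<close>
lemma ex_radical_large_height:
  fixes c T :: real
  assumes k: "real_number_field k" and c: "c > 0" "of_real c \<in> k"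
  shows "\<exists>n q. prime n \<and> n > N \<and> prime q \<and>
    (\<forall>y\<in>simple_ext k (of_real (root n (c * real q))) - k. weil_height y \<ge> T)"
proof -
  have k': "complex_subfield k" "k \<subseteq> \<real>" using k by (auto simp: real_number_field_def)
  interpret complex_subfield k by fact
  obtain B where B: "finite B" "k \<subseteq> ratvs.span B" using k by (auto simp: real_number_field_def)
  \<comment> \<open>As \<open>n > card B\<close>, no element of \<open>k\<close> has degree \<open>n\<close> over the rationals.\<close>
  obtain n where n: "prime n" "n > max N (card B)" using bigger_prime by blast
  have n2: "n \<ge> 2" using prime_ge_2_nat[OF n(1)] .
  define r where "r = (\<lambda>q::nat. root n (c * real q))"
  have rpos: "r q > 0" if "prime q" for q
    using that c prime_gt_0_nat[OF that] n2 by (simp add: r_def)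
  have rpow: "r q ^ n = c * real q" for q using c n2 by (simp add: r_def real_root_pow_pos2)
  have rpow': "complex_of_real (r q) ^ n = of_real c * of_nat q" for q
    using rpow[of q] by (metis of_real_mult of_real_of_nat_eq of_real_power)
  have rk: "complex_of_real (r q) ^ n \<in> k" for q unfolding rpow' using c(2) by auto
  have ralg: "algebraic (complex_of_real (r q))" for q
    by (rule radical_algebraic[OF real_number_field_algebraic[OF k rk[of q]]]) (use n2 in simp)
  define L where "L = (\<lambda>q. simple_ext k (complex_of_real (r q)))"
  define A where "A = {y. y \<noteq> 0 \<and> (\<exists>g\<in>polys_over \<rat>. g \<noteq> 0 \<and> degree g \<le> n * card B \<and> poly g y = 0) \<and> weil_height y < T}"
  have A: "finite A" unfolding A_def by (rule finite_bounded_degree_height)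
  have "\<exists>q. prime q \<and> (\<forall>y\<in>L q - k. weil_height y \<ge> T)"
  proof (rule ccontr)
    assume "\<not> ?thesis"
    hence "\<forall>q\<in>{q. prime q}. \<exists>y. y \<in> L q - k \<and> weil_height y < T" by (auto simp: not_le)
    from bchoice[OF this] obtain y where
      y: "\<And>q. prime q \<Longrightarrow> y q \<in> L q" "\<And>q. prime q \<Longrightarrow> y q \<notin> k"
         "\<And>q. prime q \<Longrightarrow> weil_height (y q) < T" by blast
    have rnk: "of_real (r q) \<notin> k" if q: "prime q" for q
    proof
      assume "of_real (r q) \<in> k"
      hence "L q \<subseteq> k" unfolding L_def by (intro simple_ext_least k'(1)) auto
      thus False using y[OF q] by blast
    qed
    have yA: "y q \<in> A" if q: "prime q" for q
    proof -
      note mp = radical_minimal_poly[OF k' n(1) rpos[OF q] rk rnk[OF q]]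
      have dm: "degree (monom 1 n - [:complex_of_real (r q) ^ n:]) = n" using n2 by (intro degree_pure) simp
      obtain B' where B': "finite B'" "L q \<subseteq> ratvs.span B'" "card B' \<le> n * card B"
        using simple_ext_span[OF k'(1) mp B] unfolding L_def dm by blast
      have "complex_subfield (L q)" unfolding L_def by (rule simple_ext_subfield[OF mp])
      from number_field_bounded_degree[OF this B'(1,2) y(1)[OF q]]
      have "\<exists>g\<in>polys_over \<rat>. g \<noteq> 0 \<and> degree g \<le> n * card B \<and> poly g (y q) = 0"
        using B'(3) by (meson le_trans)
      moreover have "y q \<noteq> 0" using y(2)[OF q] by auto
      ultimately show ?thesis using y(3)[OF q] by (simp add: A_def)
    qed
    have "infinite {q::nat. prime q}" by (rule primes_infinite)
    moreover have "y ` {q. prime q} \<subseteq> A" using yA by blast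
    hence "finite (y ` {q. prime q})" by (rule finite_subset[OF _ A])
    ultimately have "\<exists>q0\<in>{q. prime q}. infinite {q \<in> {q. prime q}. y q = y q0}"
      by (rule pigeonhole_infinite)
    then obtain q0 where q0: "prime q0"
      and inf: "infinite {q \<in> {q. prime q}. y q = y q0}" by (elim bexE) simp
    define S where "S = {q. prime q \<and> y q = y q0}"
    have S: "infinite S" using inf unfolding S_def by simp
    have "\<exists>i<n. of_real (r q) * of_real (r q0) ^ i \<in> k" if q: "q \<in> S" for q
    proof -
      have qp: "prime q" and yq: "y q = y q0" using q by (auto simp: S_def)
      have alg: "algebraic (y q)" using yA[OF qp] by (auto simp: A_def algebraic_iff_polys_over_Rats)
      have "of_real (r q) \<in> simple_ext k (y q)"
        using y[OF qp] alg
        by (intro radical_in_simple_ext[OF k' n(1) rpos[OF qp] rk rnk[OF qp]]) (auto simp: L_def)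
      also have "simple_ext k (y q) \<subseteq> L q0"
      proof (rule simple_ext_least)
        show "complex_subfield (L q0)" unfolding L_def
          by (rule simple_ext_subfield[OF radical_minimal_poly[OF k' n(1) rpos[OF q0] rk rnk[OF q0]]])
        show "k \<subseteq> L q0" unfolding L_def by (rule simple_ext_superset)
        show "y q \<in> L q0" unfolding yq by (rule y(1)[OF q0])
      qed
      finally show ?thesis
        using real_number_field_algebraic[OF k]
        by (intro radicals_in_same_field[OF k' _ n(1) rpos[OF q0] rk rnk[OF q0] rpos[OF qp] rk]) (auto simp: L_def)
    qed
    hence "\<forall>q\<in>S. \<exists>i. i < n \<and> of_real (r q) * of_real (r q0) ^ i \<in> k" by blast
    from bchoice[OF this] obtain i where
      i: "\<And>q. q \<in> S \<Longrightarrow> i q < n" "\<And>q. q \<in> S \<Longrightarrow> of_real (r q) * of_real (r q0) ^ i q \<in> k" by blast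
    have "\<not> inj_on i S"
    proof
      assume "inj_on i S"
      moreover have "finite (i ` S)" using i(1) by (meson finite_lessThan finite_subset image_subsetI lessThan_iff)
      ultimately show False using S finite_imageD by blast
    qed
    then obtain q q' where q: "q \<in> S" "q' \<in> S" "q \<noteq> q'" "i q = i q'" by (auto simp: inj_on_def)
    have qp: "prime q" "prime q'" using q by (auto simp: S_def)
    \<comment> \<open>The quotient of two radicals related to the same power of \<open>r q0\<close> lies in \<open>k\<close>.\<close>
    define w where "w = r q / r q'"
    have w0: "w > 0" using rpos qp by (simp add: w_def)
    have "complex_of_real w = (of_real (r q) * of_real (r q0) ^ i q) / (of_real (r q') * of_real (r q0) ^ i q')"
      using rpos[OF q0] rpos[OF qp(2)] q(4) by (simp add: w_def)
    hence wk: "of_real w \<in> k" using i(2)[OF q(1)] i(2)[OF q(2)] by auto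
    have wn: "complex_of_real w ^ n = of_nat q / of_nat q'"
      using c(1) by (simp add: w_def power_divide rpow')
    obtain g where g: "g \<in> polys_over \<rat>" "g \<noteq> 0" "degree g \<le> card B" "poly g (of_real w) = 0"
      using number_field_bounded_degree[OF k'(1) B wk] by blast
    have "g = 0"
    proof (rule radical_minimal_degree[OF complex_subfield_Rats _ n(1) w0 _ _ g(1) _ g(4)])
      show "\<rat> \<subseteq> (\<real> :: complex set)" using complex_subfield.Rats_subset[OF complex_subfield_Reals] .
      show "complex_of_real w ^ n \<in> \<rat>" unfolding wn by auto
      show "complex_of_real w \<notin> \<rat>" by (rule prime_ratio_root_irrational[OF qp q(3) n2 wn])
      show "degree g < n" using g(3) n(2) by simp
    qed
    thus False using g(2) by simp
  qed
  thus ?thesis using n by (auto simp: L_def r_def)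
qed

section \<open>Conjugate radicals\<close>

lemma minimal_poly_irreducible:
  assumes m: "minimal_poly \<rat> \<alpha> (map_poly of_rat f)"
  shows "irreducible f"
proof -
  interpret Q: complex_subfield \<rat> by (rule complex_subfield_Rats)
  have dmap: "degree (map_poly of_rat g :: complex poly) = degree g" for g by (rule degree_map_poly) auto
  have m0: "degree f > 0" using Q.minimal_poly_degree_pos[OF m] by (simp add: dmap)
  hence f0: "f \<noteq> 0" by auto
  have const: "is_unit b" if ab: "f = a * b" "poly (map_poly of_rat a) \<alpha> = 0" for a b
  proof -
    have nz: "a \<noteq> 0" "b \<noteq> 0" using ab f0 by auto
    hence "map_poly of_rat a \<noteq> (0 :: complex poly)" by (simp add: map_poly_eq_0_iff)
    hence "degree (map_poly of_rat f :: complex poly) \<le> degree (map_poly of_rat a :: complex poly)"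
      using m ab(2) by (auto simp: minimal_poly_def polys_over_Rats_eq)
    hence "degree b = 0" using nz by (simp add: dmap ab(1) degree_mult_eq)
    thus ?thesis using nz by (simp add: is_unit_iff_degree)
  qed
  show ?thesis
  proof (rule Factorial_Ring.irreducibleI[OF f0])
    show "\<not> is_unit f" using m0 f0 by (simp add: is_unit_iff_degree)
    fix a b assume ab: "f = a * b"
    have "poly (map_poly of_rat a) \<alpha> * poly (map_poly of_rat b) \<alpha> = 0"
      using m by (simp add: minimal_poly_def ab map_poly_of_rat_mult)
    thus "is_unit a \<or> is_unit b" using const[of a b] const[of b a] ab by (auto simp: mult.commute)
  qed
qed

lemma sqrt2_irrational: "complex_of_real (sqrt 2) \<notin> \<rat>"
proof
  assume "complex_of_real (sqrt 2) \<in> \<rat>"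
  then obtain x where x: "complex_of_real (sqrt 2) = of_rat x" by (rule Rats_cases)
  have "of_rat (x ^ 2) = (of_rat 2 :: complex)"
    by (simp add: of_rat_power flip: x of_real_power)
  hence "x ^ 2 = 2" by (simp only: of_rat_eq_iff)
  moreover have "padic_abs 2 2 = 1 / real 2"
    using padic_abs_of_int[of 2 2] multiplicity_self[of "2::int"] by simp
  ultimately show False using padic_abs_power_neq[of 2 2 x] by simp
qed

lemma one_plus_sqrt2_power:
  "\<exists>a b::nat. (1 + sqrt 2) ^ Suc d = real a + real b * sqrt 2 \<and> b > 0"
proof (induction d)
  case 0
  show ?case by (intro exI[of _ 1]) simp
next
  case (Suc d)
  then obtain a b :: nat where ab: "(1 + sqrt 2) ^ Suc d = real a + real b * sqrt 2" "b > 0" by blast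
  have "(1 + sqrt 2) ^ Suc (Suc d) = (1 + sqrt 2) * (real a + real b * sqrt 2)"
    using ab(1) by (metis power_Suc)
  also have "\<dots> = real (a + 2 * b) + real (a + b) * sqrt 2" by (simp add: algebra_simps)
  finally show ?case using ab(2) by (intro exI[of _ "a + 2 * b"] exI[of _ "a + b"]) simp
qed

lemma one_plus_sqrt2_power_irrational:
  assumes "d > 0"
  shows "complex_of_real ((1 + sqrt 2) ^ d) \<notin> \<rat>"
proof
  assume rat: "complex_of_real ((1 + sqrt 2) ^ d) \<in> \<rat>"
  obtain d' where "d = Suc d'" using assms by (cases d) auto
  then obtain a b :: nat where ab: "(1 + sqrt 2) ^ d = real a + real b * sqrt 2" "b > 0"
    using one_plus_sqrt2_power by blast
  have "complex_of_real (sqrt 2) = (complex_of_real ((1 + sqrt 2) ^ d) - of_nat a) / of_nat b"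
    using ab(2) unfolding ab(1) by simp
  also have "\<dots> \<in> \<rat>" using rat by auto
  finally show False using sqrt2_irrational by simp
qed

text \<open>If all conjugates of the radical of \<open>(1 + sqrt 2) q\<close> were roots of the same pure equation,
  the constant coefficient of the minimal polynomial would make a power of \<open>1 + sqrt 2\<close> rational.\<close>
lemma ex_conjugate_radical:
  fixes t :: real
  assumes n: "n > 0" and q: "q > 0" and t: "t > 0" "t ^ n = (1 + sqrt 2) * real q"
    and m: "minimal_poly \<rat> (of_real t) m"
  shows "\<exists>z. poly m z = 0 \<and> z ^ n = of_real ((1 - sqrt 2) * real q)"
proof (rule ccontr)
  assume neg: "\<not> ?thesis"
  interpret Q: complex_subfield \<rat> by (rule complex_subfield_Rats)
  define c where "c = complex_of_real ((1 + sqrt 2) * real q)"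
  define c' where "c' = complex_of_real ((1 - sqrt 2) * real q)"
  have cc: "c + c' = of_nat (2 * q)" "c * c' = - of_nat (q ^ 2)"
  proof -
    show "c + c' = of_nat (2 * q)" by (simp add: c_def c'_def algebra_simps)
    have "((1 + sqrt 2) * real q) * ((1 - sqrt 2) * real q) = - (real q ^ 2)"
      by (simp add: algebra_simps power2_eq_square)
    hence "complex_of_real (((1 + sqrt 2) * real q) * ((1 - sqrt 2) * real q)) = of_real (- (real q ^ 2))"
      by (simp only:)
    thus "c * c' = - of_nat (q ^ 2)" by (simp add: c_def c'_def)
  qed
  define g :: "complex poly" where "g = monom 1 (2 * n) - monom (of_nat (2 * q)) n - [:of_nat (q ^ 2):]"
  have pg: "poly g z = (z ^ n - c) * (z ^ n - c')" for z
  proof -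
    have "(z ^ n - c) * (z ^ n - c') = z ^ n * z ^ n - (c + c') * z ^ n + c * c'" by (simp add: algebra_simps)
    also have "\<dots> = z ^ (2 * n) - of_nat (2 * q) * z ^ n + - of_nat (q ^ 2)"
      unfolding cc mult_2 power_add ..
    also have "\<dots> = poly g z" by (simp add: g_def poly_monom)
    finally show ?thesis ..
  qed
  have tn: "complex_of_real t ^ n = c" unfolding c_def t(2)[symmetric] by simp
  have "g \<in> polys_over \<rat>" unfolding g_def by (intro Q.polys_over_diff Q.polys_over_monom Q.polys_over_pCons) auto
  moreover have "poly g (of_real t) = 0" by (simp add: pg tn)
  ultimately obtain h where h: "g = m * h" using Q.minimal_poly_dvd[OF m] by blast
  have root: "cmod z = t" if z: "poly m z = 0" for z
  proof -
    have "poly g z = 0" using h z by simp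
    hence "z ^ n = c" using neg z by (auto simp: pg c'_def)
    hence "z ^ n = of_real t ^ n" by (simp add: tn)
    hence "cmod z ^ n = t ^ n" using t(1) by (metis norm_of_real norm_power abs_of_pos)
    thus ?thesis using t(1) n by (metis norm_ge_zero less_imp_le power_eq_imp_eq_base)
  qed
  define d where "d = degree m"
  have d: "d > 0" using Q.minimal_poly_degree_pos[OF m] by (simp add: d_def)
  have cm: "cmod (coeff m 0) = t ^ d"
    unfolding d_def by (rule Q.minimal_poly_norm_coeff_0[OF m root])
  have "coeff m 0 \<in> \<rat>" using m by (auto simp: minimal_poly_def polys_overD)
  then obtain x where x: "coeff m 0 = of_rat x" by (auto elim: Rats_cases)
  have "t ^ d = \<bar>of_rat x\<bar>" using cm by (simp add: x norm_of_rat)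
  hence "of_real (t ^ d) \<in> (\<rat> :: complex set)" by (cases x) (auto simp: of_rat_rat abs_if)
  hence "complex_of_real (t ^ d) ^ n \<in> \<rat>" by auto
  also have "complex_of_real (t ^ d) ^ n = of_real ((t ^ n) ^ d)" by (simp add: mult.commute flip: power_mult)
  also have "\<dots> = of_real ((1 + sqrt 2) ^ d) * of_nat q ^ d" by (simp add: t(2) power_mult_distrib)
  finally have "complex_of_real ((1 + sqrt 2) ^ d) * of_nat q ^ d \<in> \<rat>" .
  moreover have "of_nat q ^ d \<in> (\<rat> :: complex set)" by simp
  ultimately have "complex_of_real ((1 + sqrt 2) ^ d) * of_nat q ^ d / of_nat q ^ d \<in> \<rat>" by (rule Rats_divide)
  hence "complex_of_real ((1 + sqrt 2) ^ d) \<in> \<rat>" using q by (subst (asm) nonzero_mult_div_cancel_right) simp_all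
  thus False using one_plus_sqrt2_power_irrational[OF d] by simp
qed

text \<open>The quotient of two conjugate radicals is a root of the unit
  \<open>(1 - sqrt 2) / (1 + sqrt 2)\<close>, which is not a root of unity.\<close>
lemma ex_small_element_in_galois_closure:
  fixes t :: real
  assumes n: "n > 0" and q: "q > 0" and t: "t > 0" "t ^ n = (1 + sqrt 2) * real q"
    and K: "of_real t \<in> K"
  shows "\<exists>\<beta>\<in>galois_closure K. \<beta> \<noteq> 0 \<and> weil_height \<beta> \<le> 2 * ln 7 / real n \<and> \<not> (\<exists>j>0. \<beta> ^ j = 1)"
proof -
  interpret Q: complex_subfield \<rat> by (rule complex_subfield_Rats)
  define g :: "complex poly" where "g = monom 1 (2 * n) - monom (of_nat (2 * q)) n - [:of_nat (q ^ 2):]"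
  have "algebraic (complex_of_real t)"
  proof (rule algebraicI)
    show "coeff g i \<in> \<int>" for i
      by (auto simp: g_def coeff_monom coeff_pCons intro!: Ints_diff Ints_mult split: nat.splits)
    have "coeff g (2 * n) = 1" using n by (simp add: g_def coeff_pCons split: nat.splits)
    thus "g \<noteq> 0" by auto
    have "t ^ (2 * n) - 2 * real q * t ^ n - real q ^ 2 = 0"
    proof -
      have "t ^ (2 * n) = (t ^ n) ^ 2" by (simp add: mult.commute flip: power_mult)
      thus ?thesis unfolding t(2) by (simp add: power2_eq_square algebra_simps)
    qed
    hence "complex_of_real (t ^ (2 * n) - 2 * real q * t ^ n - real q ^ 2) = 0" by simp
    thus "poly g (complex_of_real t) = 0" by (simp add: g_def poly_monom)
  qed
  then obtain m where m: "minimal_poly \<rat> (of_real t) m" using algebraic_minimal_poly by blast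
  then obtain f where f: "m = map_poly of_rat f" by (auto simp: minimal_poly_def polys_over_Rats_eq)
  obtain z where z: "poly m z = 0" "z ^ n = of_real ((1 - sqrt 2) * real q)"
    using ex_conjugate_radical[OF n q t m] by blast
  define \<beta> where "\<beta> = z / of_real t"
  define u where "u = complex_of_real ((1 - sqrt 2) / (1 + sqrt 2))"
  have s2: "1 + sqrt 2 > 0" by (simp add: add_pos_pos)
  have \<beta>n: "\<beta> ^ n = u"
  proof -
    have "\<beta> ^ n = of_real ((1 - sqrt 2) * real q) / of_real (t ^ n)" by (simp add: \<beta>_def power_divide z(2))
    also have "\<dots> = of_real (((1 - sqrt 2) * real q) / ((1 + sqrt 2) * real q))" unfolding t(2) by simp
    also have "\<dots> = u" using q by (simp add: u_def)
    finally show ?thesis .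
  qed
  have ru: "((1 - sqrt 2) / (1 + sqrt 2)) ^ 2 + 6 * ((1 - sqrt 2) / (1 + sqrt 2)) + 1 = 0"
  proof -
    have "(1 - sqrt 2) ^ 2 + 6 * ((1 - sqrt 2) * (1 + sqrt 2)) + (1 + sqrt 2) ^ 2 = 0"
      by (simp add: power2_eq_square algebra_simps)
    hence "((1 - sqrt 2) ^ 2 + 6 * ((1 - sqrt 2) * (1 + sqrt 2)) + (1 + sqrt 2) ^ 2) / (1 + sqrt 2) ^ 2 = 0" by simp
    moreover have "((1 - sqrt 2) ^ 2 + 6 * ((1 - sqrt 2) * (1 + sqrt 2)) + (1 + sqrt 2) ^ 2) / (1 + sqrt 2) ^ 2
      = ((1 - sqrt 2) / (1 + sqrt 2)) ^ 2 + 6 * ((1 - sqrt 2) / (1 + sqrt 2)) + 1"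
      using s2 by (simp add: add_divide_distrib power_divide power2_eq_square)
    ultimately show ?thesis by simp
  qed
  have u2: "u ^ 2 + 6 * u + 1 = 0"
    using arg_cong[OF ru, of complex_of_real] by (simp add: u_def)
  have "sqrt 2 > 1" by simp
  hence u_lt: "0 < cmod u" "cmod u < 1" using s2 unfolding u_def norm_of_real by (auto simp: abs_if field_simps)
  have "\<beta> \<in> galois_closure K" unfolding galois_closure_def
  proof (rule InterI)
    fix L assume "L \<in> {L. galois_over_rat L \<and> K \<subseteq> L}"
    hence L: "galois_over_rat L" "of_real t \<in> L" using K by auto
    have irr: "irreducible f" by (rule minimal_poly_irreducible) (use m f in simp)
    have "poly (map_poly of_rat f) (complex_of_real t) = 0" using m f by (simp add: minimal_poly_def)
    hence "z \<in> L" using L irr z(1) f unfolding galois_over_rat_def by blast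
    moreover have "complex_subfield L" using L(1) by (simp add: galois_over_rat_def subfield_CC_iff)
    ultimately show "\<beta> \<in> L" using L(2) complex_subfield.divide_mem unfolding \<beta>_def by blast
  qed
  moreover have "\<beta> \<noteq> 0" using u_lt \<beta>n n by (auto simp: power_0_left)
  moreover have "\<not> (\<exists>j>0. \<beta> ^ j = 1)"
  proof
    assume "\<exists>j>0. \<beta> ^ j = 1"
    then obtain j where j: "j > 0" "\<beta> ^ j = 1" by blast
    have "u ^ j = (\<beta> ^ j) ^ n" unfolding \<beta>n[symmetric] by (simp add: mult.commute flip: power_mult)
    hence "cmod u ^ j = 1" using j(2) by (simp flip: norm_power)
    moreover have "cmod u ^ j < 1" using u_lt j(1) by (simp add: power_less_one_iff)
    ultimately show False by simp
  qed
  ultimately show ?thesis using weil_height_radical_of_unit[OF n \<beta>n u2] by blast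
qed

section \<open>The tower\<close>

text \<open>The height bound for the new elements gives the Northcott property of the union, and the
  conjugates of the radical \<open>t\<close> give the small elements in its Galois closure.\<close>
definition tower_step :: "nat \<Rightarrow> complex set \<Rightarrow> complex set \<Rightarrow> bool" where
  "tower_step i k k' \<longleftrightarrow> k \<subseteq> k' \<and> (\<forall>y\<in>k' - k. weil_height y \<ge> real i) \<and>
     (\<exists>n>i. \<exists>q>0. \<exists>t>0. t ^ n = (1 + sqrt 2) * real q \<and> complex_of_real t \<in> k')"

lemma ex_tower:
  "\<exists>k. \<forall>i. real_number_field (k i) \<and> complex_of_real (1 + sqrt 2) \<in> k i \<and> tower_step i (k i) (k (Suc i))"
proof -
  define good where "good = (\<lambda>k. real_number_field k \<and> complex_of_real (1 + sqrt 2) \<in> k)"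
  have "\<exists>k. \<forall>i. good (k i) \<and> tower_step i (k i) (k (Suc i))"
  proof (rule dependent_nat_choice)
    have Q: "real_number_field \<rat>"
    proof -
      have "\<rat> \<subseteq> (\<real> :: complex set)"
        using complex_subfield.Rats_subset[OF complex_subfield_Reals] .
      thus ?thesis using complex_subfield_Rats Rats_subset_span unfolding real_number_field_def
        by (intro conjI exI[of _ "{1}"]) auto
    qed
    have "algebraic (complex_of_real (1 + sqrt 2))"
    proof (rule algebraicI)
      show "coeff [:-1, -2, 1:] i \<in> (\<int> :: complex set)" for i by (auto simp: coeff_pCons split: nat.splits)
      have "poly [:-1, -2, 1:] (complex_of_real x) = of_real (poly [:-1, -2, 1:] x)" for x by simp
      moreover have "poly [:-1, -2, 1:] (1 + sqrt 2) = 0" by (simp add: algebra_simps)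
      ultimately have "poly [:-1, -2, 1:] (complex_of_real (1 + sqrt 2)) = of_real 0" by (simp only:)
      thus "poly [:-1, -2, 1:] (complex_of_real (1 + sqrt 2)) = 0" by (simp only: of_real_0)
    qed simp
    hence "real_number_field (simple_ext \<rat> (complex_of_real (1 + sqrt 2)))"
      by (intro real_number_field_simple_ext[OF Q]) auto
    thus "\<exists>k. good k" unfolding good_def
      using complex_subfield.simple_ext_generator[OF complex_subfield_Rats] by blast
  next
    fix k i assume "good k"
    hence k: "real_number_field k" and c: "complex_of_real (1 + sqrt 2) \<in> k" by (auto simp: good_def)
    have k': "complex_subfield k" using k by (simp add: real_number_field_def)
    interpret complex_subfield k by fact
    have cpos: "1 + sqrt 2 > 0" by (simp add: add_pos_pos)
    obtain n q where nq: "prime n" "n > i" "prime q"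
      "\<forall>y\<in>simple_ext k (of_real (root n ((1 + sqrt 2) * real q))) - k. weil_height y \<ge> real i"
      using ex_radical_large_height[OF k cpos c, of i "real i"] by blast
    define t where "t = root n ((1 + sqrt 2) * real q)"
    have q0: "q > 0" and n0: "n > 0" using nq prime_gt_0_nat by auto
    have t: "t > 0" "t ^ n = (1 + sqrt 2) * real q"
      using cpos q0 n0 by (auto simp: t_def intro!: mult_pos_pos real_root_pow_pos2)
    have "complex_of_real t ^ n = of_real (1 + sqrt 2) * of_nat q"
      using t(2) by (metis of_real_mult of_real_of_nat_eq of_real_power)
    hence "complex_of_real t ^ n \<in> k" using mult_mem[OF c of_nat_mem[of q]] by simp
    hence "algebraic (complex_of_real t)"
      by (rule radical_algebraic[OF real_number_field_algebraic[OF k] n0])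
    hence "real_number_field (simple_ext k (complex_of_real t))"
      by (intro real_number_field_simple_ext[OF k]) auto
    moreover have "complex_of_real (1 + sqrt 2) \<in> simple_ext k (complex_of_real t)"
      using c simple_ext_superset by blast
    moreover have "tower_step i k (simple_ext k (complex_of_real t))"
      unfolding tower_step_def
    proof (intro conjI)
      show "k \<subseteq> simple_ext k (complex_of_real t)" by (rule simple_ext_superset)
      show "\<forall>y\<in>simple_ext k (complex_of_real t) - k. real i \<le> weil_height y" using nq(4) by (simp add: t_def)
      show "\<exists>n>i. \<exists>q>0. \<exists>t'>0. t' ^ n = (1 + sqrt 2) * real q \<and> complex_of_real t' \<in> simple_ext k (complex_of_real t)"
        using nq(2) q0 t simple_ext_generator by blast
    qed
    ultimately show "\<exists>k'. good k' \<and> tower_step i k k'" unfolding good_def by blast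
  qed
  thus ?thesis unfolding good_def by blast
qed

theorem proposition1p1:
  shows "\<exists>K. subfield K CC \<and> K \<subseteq> Qbar \<and> northcott K \<and> \<not> bogomolov (galois_closure K)"
proof -
  obtain k where k: "\<And>i. real_number_field (k i)" "\<And>i. tower_step i (k i) (k (Suc i))"
    using ex_tower by blast
  define K where "K = (\<Union>i. k i)"
  have mono: "mono k" using k(2) by (intro mono_iff_le_Suc[THEN iffD2]) (auto simp: tower_step_def)
  have sub: "complex_subfield (k i)" for i using k(1) by (simp add: real_number_field_def)
  have common: "\<exists>i. x \<in> k i \<and> y \<in> k i" if "x \<in> K" "y \<in> K" for x y
  proof -
    from that obtain i j where ij: "x \<in> k i" "y \<in> k j" by (auto simp: K_def)
    have "k i \<subseteq> k (max i j)" "k j \<subseteq> k (max i j)" using mono by (auto simp: mono_def)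
    thus ?thesis using ij by blast
  qed
  have field: "complex_subfield K"
  proof
    show "1 \<in> K" using complex_subfield.one_mem[OF sub[of 0]] by (auto simp: K_def)
    show "x - y \<in> K" "x / y \<in> K" if xy: "x \<in> K" "y \<in> K" for x y
    proof -
      obtain i where "x \<in> k i" "y \<in> k i" using common[OF xy] by blast
      hence "x - y \<in> k i" "x / y \<in> k i" using complex_subfield.diff_mem[OF sub] complex_subfield.divide_mem[OF sub] by auto
      thus "x - y \<in> K" "x / y \<in> K" by (auto simp: K_def)
    qed
  qed
  have alg: "K \<subseteq> Qbar" using real_number_field_algebraic[OF k(1)] by (auto simp: K_def Qbar_def)
  have north: "northcott K" unfolding northcott_def
  proof (intro allI impI)
    fix T :: real assume "T > 0"
    define N where "N = nat \<lceil>T\<rceil>"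
    have N: "real N \<ge> T" unfolding N_def by (rule real_nat_ceiling_ge)
    have low: "y \<in> k N" if y: "y \<in> height_less K T" for y
    proof -
      have yK: "y \<in> K" and yT: "weil_height y < T" using y by (auto simp: height_less_def)
      have "y \<in> k i \<Longrightarrow> y \<in> k N" for i
      proof (induction i)
        case 0
        thus ?case using mono by (auto simp: mono_def)
      next
        case (Suc i)
        show ?case
        proof (cases "y \<in> k i")
          case False
          hence "weil_height y \<ge> real i" using k(2)[of i] Suc.prems by (auto simp: tower_step_def)
          hence "Suc i \<le> N" using yT N by linarith
          thus ?thesis using Suc.prems mono by (auto simp: mono_def)
        qed (rule Suc.IH)
      qed
      thus ?thesis using yK by (auto simp: K_def)
    qed
    obtain B where B: "finite B" "k N \<subseteq> ratvs.span B" using k(1)[of N] by (auto simp: real_number_field_def)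
    have "height_less K T \<subseteq> {\<alpha>. \<alpha> \<noteq> 0 \<and>
        (\<exists>g\<in>polys_over \<rat>. g \<noteq> 0 \<and> degree g \<le> card B \<and> poly g \<alpha> = 0) \<and> weil_height \<alpha> < T}"
      using number_field_bounded_degree[OF sub B low] by (auto simp: height_less_def)
    thus "finite (height_less K T)" by (rule finite_subset[OF _ finite_bounded_degree_height])
  qed
  have "\<not> bogomolov (galois_closure K)"
  proof
    assume "bogomolov (galois_closure K)"
    then obtain T where T: "T > 0" "\<And>\<alpha>. \<alpha> \<in> height_less (galois_closure K) T \<Longrightarrow> \<exists>n>0. \<alpha> ^ n = 1"
      by (auto simp: bogomolov_def)
    obtain i :: nat where i: "real i > 2 * ln 7 / T" using reals_Archimedean2 by blast
    obtain n q t where nqt: "n > i" "q > 0" "t > 0" "t ^ n = (1 + sqrt 2) * real q" "complex_of_real t \<in> k (Suc i)"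
      using k(2)[of i] unfolding tower_step_def by blast
    have "complex_of_real t \<in> K" using nqt(5) by (auto simp: K_def)
    moreover have n0: "n > 0" using nqt(1) by simp
    ultimately obtain \<beta> where \<beta>: "\<beta> \<in> galois_closure K" "\<beta> \<noteq> 0" "weil_height \<beta> \<le> 2 * ln 7 / real n" "\<not> (\<exists>j>0. \<beta> ^ j = 1)"
      using ex_small_element_in_galois_closure[OF n0 nqt(2,3,4)] by blast
    have "2 * ln 7 / T < real n" using i nqt(1) by simp
    hence "2 * ln 7 / real n < T" using T(1) n0 by (simp add: field_simps)
    hence "\<beta> \<in> height_less (galois_closure K) T" using \<beta> by (simp add: height_less_def)
    thus False using T(2) \<beta>(4) by blast
  qed
  thus ?thesis using field alg north by (auto simp: subfield_CC_iff)
qed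

end
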